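(* Let $p\ge3$, let $J\subset F$ be nonempty, and, with the notation of the context, let $$\Lambda_J=\mathrm{diag}\Bigl(\tfrac{d_{J,1}(p-2)}{n-k_F-p+3},\dots,\tfrac{d_{J,k_J}(p-2)}{n-k_F-p+3}\Bigr),\qquad C_J=\mathrm{diag}\bigl(x_{J,1}^\top S_F^{-1}x_{J,1},\dots,x_{J,k_J}^\top S_F^{-1}x_{J,k_J}\bigr),$$ $\hat B_{J,\mathrm B}=P_J(I_{k_J}-\Lambda_JC_J^{-1})D_JP_J^\top A_J^\top Y$, and $$\mathrm{ZMCp}(J)=(n-k_F-p-1)\,\mathrm{tr}(S_F^{-1}S_J)+p(2k_J+p+1-n)-(p-2)\,\mathrm{tr}(\Lambda_JC_J^{-1}).$$ Suppose the true model satisfies $J_*\in\mathcal J$, where $\mathcal J$ is the power set of $F$, i.e. $Y\sim\mathcal N_{n\times p}(A_{J_*}B_{J_*},\Sigma\otimes I_n)$ with $J_*\subset F$; the parameters $J_*$, $B_{J_*}$ and the positive definite $\Sigma$ are unknown, so the family of possible distributions of $Y$ is $\{\mathcal N_{n\times p}(AB,\Sigma\otimes I_n): B\in\mathbb R^{k\times p},\ \Sigma\text{ positive definite}\}$. Then $\mathrm{ZMCp}(J)$ is a uniformly minimum variance unbiased estimator of the squared risk $R_{\mathrm S}(B_{J_*},\Sigma,\hat B_{J,\mathrm B})$.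
   Context: $\mathcal N_{n\times p}(M,\Sigma\otimes I_n)$ is the law of an $n\times p$ random matrix with mean $M$ whose rows are independent $p$-variate normal with covariance $\Sigma$. $A$ is a fixed $n\times k$ matrix with $\mathrm{rank}(A)=k$; $n-p-k-1>0$; $F=\{1,\dots,k\}$, so $k_F=k$. For $J\subset F$, $k_J=|J|$ and $A_J$ is the $n\times k_J$ submatrix of $A$ with columns indexed by $J$. $P_J$ is an orthogonal matrix with $P_J^\top(A_J^\top A_J)^{-1}P_J=D_J=\mathrm{diag}(d_{J,1},\dots,d_{J,k_J})$, $d_{J,1}\ge\cdots\ge d_{J,k_J}$. $X_J=D_JP_J^\top A_J^\top Y$ is the $k_J\times p$ matrix with rows $x_{J,1}^\top,\dots,x_{J,k_J}^\top$ ($x_{J,i}\in\mathbb R^p$). $S_J=Y^\top(I_n-A_J(A_J^\top A_J)^{-1}A_J^\top)Y$, and $S_F$ is this with $J=F$. For a $k_J\times p$ estimator $\Phi$ of the coefficients in model $J$, the squared risk is $$R_{\mathrm S}(B_{J_*},\Sigma,\Phi)=E\bigl[\mathrm{tr}\bigl(\Sigma^{-1}(A_J\Phi-A_{J_*}B_{J_*})^\top(A_J\Phi-A_{J_*}B_{J_*})\bigr)\bigr],$$ the expectation being under the true model. A statistic $T(Y)$ is a uniformly minimum variance unbiased estimator of a function $g$ of the parameters if $E[T(Y)]=g$ for all parameter values and, for every other unbiased estimator $T'(Y)$ of $g$, $\mathrm{Var}(T(Y))\le\mathrm{Var}(T'(Y))$ for all parameter values (variances taken in $[0,\infty]$). 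*)

theory Defs
  imports "HOL-Probability.Probability"
begin

section \<open>Normal laws\<close>

definition pos_def :: "real^'p^'p \<Rightarrow> bool" where
  "pos_def \<Sigma> \<longleftrightarrow> transpose \<Sigma> = \<Sigma> \<and> (\<forall>x. x \<noteq> 0 \<longrightarrow> 0 < x \<bullet> (\<Sigma> *v x))"

definition mv_normal_density :: "real^'p \<Rightarrow> real^'p^'p \<Rightarrow> real^'p \<Rightarrow> real" where
  "mv_normal_density \<mu> \<Sigma> y =
     exp (- ((y - \<mu>) \<bullet> (matrix_inv \<Sigma> *v (y - \<mu>))) / 2) / sqrt ((2 * pi) ^ CARD('p) * det \<Sigma>)"

definition mv_normal :: "real^'p \<Rightarrow> real^'p^'p \<Rightarrow> (real^'p) measure" where
  "mv_normal \<mu> \<Sigma> = density lborel (\<lambda>y. ennreal (mv_normal_density \<mu> \<Sigma> y))"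

text \<open>The product measure makes the rows independent; \<open>M $ i\<close> is the \<open>i\<close>-th row of \<open>M\<close>.\<close>

definition matrix_normal :: "real^'p^'n \<Rightarrow> real^'p^'p \<Rightarrow> (real^'p^'n) measure" where
  "matrix_normal M \<Sigma> =
     distr (\<Pi>\<^sub>M i\<in>(UNIV :: 'n set). mv_normal (M $ i) \<Sigma>) borel (\<lambda>r. \<chi> i. r i)"

section \<open>Uniformly minimum variance unbiased estimation\<close>

text \<open>A statistical model is a parameter set \<open>\<Theta>\<close> with a law \<open>L \<theta>\<close> of the observation
  for every \<open>\<theta> \<in> \<Theta>\<close>. Integrability, which includes measurability, is required explicitly
  because the Bochner integral of a non-integrable function is 0.\<close>

definition unbiased_estimator ::
  "'t set \<Rightarrow> ('t \<Rightarrow> 'y measure) \<Rightarrow> ('y \<Rightarrow> real) \<Rightarrow> ('t \<Rightarrow> real) \<Rightarrow> bool" where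
  "unbiased_estimator \<Theta> L T g \<longleftrightarrow>
     (\<forall>\<theta>\<in>\<Theta>. integrable (L \<theta>) T \<and> (\<integral>y. T y \<partial>L \<theta>) = g \<theta>)"

definition ext_variance :: "'y measure \<Rightarrow> ('y \<Rightarrow> real) \<Rightarrow> ennreal" where
  "ext_variance M T = (\<integral>\<^sup>+ y. ennreal ((T y - (\<integral>z. T z \<partial>M))\<^sup>2) \<partial>M)"

definition umvu_estimator ::
  "'t set \<Rightarrow> ('t \<Rightarrow> 'y measure) \<Rightarrow> ('y \<Rightarrow> real) \<Rightarrow> ('t \<Rightarrow> real) \<Rightarrow> bool" where
  "umvu_estimator \<Theta> L T g \<longleftrightarrow>
     unbiased_estimator \<Theta> L T g \<and>
     (\<forall>T'. unbiased_estimator \<Theta> L T' g \<longrightarrow>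
        (\<forall>\<theta>\<in>\<Theta>. ext_variance (L \<theta>) T \<le> ext_variance (L \<theta>) T'))"

section \<open>Regression submodels\<close>

definition diag_mat :: "real^'j \<Rightarrow> real^'j^'j" where
  "diag_mat d = (\<chi> a b. if a = b then d $ a else 0)"

text \<open>A set \<open>J\<close> of columns of \<open>A\<close> is enumerated by a bijection \<open>\<iota>\<close> from a finite type \<open>'j\<close>,
  so that \<open>CARD('j) = card J\<close> and \<open>sub_cols A \<iota>\<close> is the submatrix of \<open>A\<close> with columns in \<open>J\<close>.\<close>

definition sub_cols :: "real^'k^'n \<Rightarrow> ('j \<Rightarrow> 'k) \<Rightarrow> real^'j^'n" where
  "sub_cols A \<iota> = (\<chi> i a. A $ i $ \<iota> a)"

text \<open>The mean of the model with column set \<open>K\<close>: the product of the submatrix of \<open>A\<close> with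
  columns in \<open>K\<close> and the coefficient matrix with rows \<open>B $ j\<close>, \<open>j \<in> K\<close>.
  Rows of \<open>B\<close> outside \<open>K\<close> are ignored, and \<open>K\<close> may be empty.\<close>

definition model_mean :: "real^'k^'n \<Rightarrow> 'k set \<Rightarrow> real^'p^'k \<Rightarrow> real^'p^'n" where
  "model_mean A K B = (\<chi> i l. \<Sum>j\<in>K. A $ i $ j * B $ j $ l)"

definition gram_inv :: "real^'j^'n \<Rightarrow> real^'j^'j" where
  "gram_inv A = matrix_inv (transpose A ** A)"

definition resid_SS :: "real^'j^'n \<Rightarrow> real^'p^'n \<Rightarrow> real^'p^'p" where
  "resid_SS A Y = transpose Y ** (mat 1 - A ** gram_inv A ** transpose A) ** Y"

definition sq_loss ::
  "real^'j^'n \<Rightarrow> real^'p^'n \<Rightarrow> real^'p^'p \<Rightarrow> real^'p^'j \<Rightarrow> real" where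
  "sq_loss AJ M \<Sigma> \<Phi> =
     trace (matrix_inv \<Sigma> ** transpose (AJ ** \<Phi> - M) ** (AJ ** \<Phi> - M))"

definition sq_risk ::
  "real^'j^'n \<Rightarrow> real^'p^'n \<Rightarrow> real^'p^'p \<Rightarrow> (real^'p^'n \<Rightarrow> real^'p^'j) \<Rightarrow> real" where
  "sq_risk AJ M \<Sigma> \<Phi> = (\<integral>Y. sq_loss AJ M \<Sigma> (\<Phi> Y) \<partial>matrix_normal M \<Sigma>)"

section \<open>The shrinkage estimator and its risk estimator\<close>

text \<open>Below, \<open>P\<close> is an orthogonal matrix diagonalising
  \<open>gram_inv (sub_cols A \<iota>)\<close> with diagonal \<open>d\<close>; this is assumed where the definitions are used.\<close>

definition X_mat ::
  "real^'k^'n \<Rightarrow> ('j \<Rightarrow> 'k) \<Rightarrow> real^'j^'j \<Rightarrow> real^'j \<Rightarrow> real^'p^'n \<Rightarrow> real^'p^'j" where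
  "X_mat A \<iota> P d Y = diag_mat d ** transpose P ** transpose (sub_cols A \<iota>) ** Y"

definition Lambda_mat ::
  "'n::finite itself \<Rightarrow> 'p::finite itself \<Rightarrow> 'k::finite itself \<Rightarrow> real^'j \<Rightarrow> real^'j^'j" where
  "Lambda_mat TN TP TK d =
     diag_mat (\<chi> a. d $ a * (real CARD('p) - 2) /
                    (real CARD('n) - real CARD('k) - real CARD('p) + 3))"

definition C_mat ::
  "real^'k^'n \<Rightarrow> ('j \<Rightarrow> 'k) \<Rightarrow> real^'j^'j \<Rightarrow> real^'j \<Rightarrow> real^'p^'n \<Rightarrow> real^'j^'j" where
  "C_mat A \<iota> P d Y =
     diag_mat (\<chi> a. X_mat A \<iota> P d Y $ a \<bullet> (matrix_inv (resid_SS A Y) *v X_mat A \<iota> P d Y $ a))"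

definition B_hat ::
  "real^'k^'n \<Rightarrow> ('j \<Rightarrow> 'k) \<Rightarrow> real^'j^'j \<Rightarrow> real^'j \<Rightarrow> real^'p^'n \<Rightarrow> real^'p^'j" where
  "B_hat A \<iota> P d Y =
     P ** (mat 1 - Lambda_mat TYPE('n) TYPE('p) TYPE('k) d ** matrix_inv (C_mat A \<iota> P d Y))
       ** diag_mat d ** transpose P ** transpose (sub_cols A \<iota>) ** Y"

definition ZMCp ::
  "real^'k^'n \<Rightarrow> ('j \<Rightarrow> 'k) \<Rightarrow> real^'j^'j \<Rightarrow> real^'j \<Rightarrow> real^'p^'n \<Rightarrow> real" where
  "ZMCp A \<iota> P d Y =
     (real CARD('n) - real CARD('k) - real CARD('p) - 1) *
       trace (matrix_inv (resid_SS A Y) ** resid_SS (sub_cols A \<iota>) Y)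
     + real CARD('p) * (2 * real CARD('j) + real CARD('p) + 1 - real CARD('n))
     - (real CARD('p) - 2) *
       trace (Lambda_mat TYPE('n) TYPE('p) TYPE('k) d ** matrix_inv (C_mat A \<iota> P d Y))"

end

theory Submission
  imports Defs
begin

text \<open>
  Write \<open>N\<close> for the projection onto the orthogonal complement of the columns of \<open>A\<close>,
  \<open>S = Y\<^sup>T N Y\<close>, \<open>x = Y\<^sup>T r\<close> with \<open>N r = 0\<close> for a row of \<open>X_mat\<close>, \<open>\<xi>\<close> for its mean and
  \<open>c = x\<^sup>T S\<^sup>-\<^sup>1 x\<close>. All expectations come from Stein's identity, which is translation invariance of
  Lebesgue measure applied to the normal density, so neither a Wishart law nor independence is used.
  In the directions \<open>N v w\<^sup>T\<close>, which leave \<open>x\<close> fixed, the field \<open>N Y (S + e I)\<^sup>-\<^sup>1 x x\<^sup>T h(c\<^sub>e)\<close> gives in the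
  limit \<open>e \<rightarrow> 0\<close> that \<open>S\<close> is almost surely invertible, that
  \<open>(n - k - p - 1) E c = E x\<^sup>T \<Sigma>\<^sup>-\<^sup>1 x\<close> and that
  \<open>E (x\<^sup>T \<Sigma>\<^sup>-\<^sup>1 x / c\<^sup>2) = (n - k - p + 3) E (1 / c)\<close>. In the directions \<open>r w\<^sup>T\<close>, which leave \<open>S\<close> fixed, it gives
  \<open>E ((x - \<xi>)\<^sup>T \<Sigma>\<^sup>-\<^sup>1 x / c) = |r|\<^sup>2 (p - 2) E (1 / c)\<close>. The same identities bound the regularised integrands
  uniformly, hence yield integrability. With the chosen coefficients in \<open>\<Lambda>\<close> the last two
  contributions to the risk add up to \<open>- (p - 2) E tr (\<Lambda> C\<^sup>-\<^sup>1)\<close>.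

  For optimality, let \<open>T'\<close> be another unbiased estimator. Then \<open>T' - T\<close> integrates to zero against all
  functions \<open>exp (- tr (\<Omega> Y\<^sup>T Y) / 2 + tr (H\<^sup>T A\<^sup>T Y))\<close>. These are closed under products, so by Stone and
  Weierstrass \<open>T' - T\<close> integrates to zero over every event generated by \<open>(A\<^sup>T Y, Y\<^sup>T Y)\<close>. Hence \<open>T\<close> is a
  conditional expectation of \<open>T'\<close>, and the conditional Jensen inequality compares the variances,
  finite or not.
\<close>

section \<open>Symmetric matrices and the matrix inverse\<close>

text \<open>Two singularities have to be removed: \<open>S\<close> may fail to be invertible, and
  \<open>1 / c\<close> is unbounded. Each has its own regulariser, a ridge \<open>e\<close> in the
  inverse and a shift \<open>de\<close> in the denominator. With both present every field is
  differentiable along the lines used and grows polynomially, so Stein's identity applies. The ridge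
  is removed at fixed \<open>de\<close>, which keeps the denominators away from 0; then the shift is
  removed, and this requires E (1 / c) to be finite. Here p >= 3 enters: Stein's identity bounds (p
  - 2) |r|^2 E (1 / (c + de)) by the cross term E ((x - xi)^T Sigma^-1 x / (c + de)). Since |x|^2 <=
  tr S c, the cross term grows only like c^(-1/2), and the arithmetic-geometric mean inequality
  splits it into a term free of \<open>de\<close> and half of the left-hand side, which is absorbed.
  Singular \<open>S\<close> and vanishing \<open>c\<close> are null events by one argument: a
  quantity with bounded expectation is at least the reciprocal of the regulariser there. For
  optimality the natural sufficient statistic is unbounded, so polynomial approximation is applied
  to finitely many bounded members of the family that determine it.\<close>

lemma inner_matrix_vector_transpose:
  fixes A :: "real^'n^'m"
  shows "x \<bullet> (A *v y) = (transpose A *v x) \<bullet> y"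
  by (simp add: dot_lmul_matrix)

lemma matrix_inv_inverse:
  fixes A :: "real^'n^'n"
  assumes "det A \<noteq> 0"
  shows "A ** matrix_inv A = mat 1" "matrix_inv A ** A = mat 1"
proof -
  have "\<exists>B. A ** B = mat 1 \<and> B ** A = mat 1"
    using assms invertible_det_nz[of A] by (simp add: invertible_def)
  from someI_ex[OF this] show "A ** matrix_inv A = mat 1" "matrix_inv A ** A = mat 1"
    by (simp_all add: matrix_inv_def)
qed

lemma matrix_inv_vector:
  fixes A :: "real^'n^'n"
  assumes "det A \<noteq> 0"
  shows "A *v (matrix_inv A *v x) = x" "matrix_inv A *v (A *v x) = x"
  using matrix_inv_inverse[OF assms] by (simp_all add: matrix_vector_mul_assoc)

lemma matrix_inv_eqI:
  fixes A :: "real^'n^'n"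
  assumes "A ** B = mat 1"
  shows "matrix_inv A = B" "det A \<noteq> 0"
proof -
  show nz: "det A \<noteq> 0" using assms det_mul[of A B] by auto
  have "matrix_inv A = matrix_inv A ** (A ** B)" using assms by simp
  also have "\<dots> = B" by (simp add: matrix_mul_assoc matrix_inv_inverse[OF nz])
  finally show "matrix_inv A = B" .
qed

lemma matrix_inv_symmetric:
  fixes A :: "real^'n^'n"
  assumes "det A \<noteq> 0" "transpose A = A"
  shows "transpose (matrix_inv A) = matrix_inv A"
proof -
  have "A ** transpose (matrix_inv A) = transpose (matrix_inv A ** A)"
    by (simp add: matrix_transpose_mul assms(2))
  also have "\<dots> = mat 1" by (simp add: matrix_inv_inverse[OF assms(1)] transpose_mat)
  finally show ?thesis using matrix_inv_eqI(1) by metis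
qed

section \<open>Positive semidefinite and positive definite forms\<close>

definition psd :: "real^'n^'n \<Rightarrow> bool" where
  "psd S \<longleftrightarrow> transpose S = S \<and> (\<forall>x. 0 \<le> x \<bullet> (S *v x))"

lemma pos_def_imp_psd: "pos_def S \<Longrightarrow> psd S"
  unfolding pos_def_def psd_def by (metis inner_zero_left less_eq_real_def)

lemma psdD:
  assumes "psd S"
  shows "transpose S = S" "0 \<le> x \<bullet> (S *v x)" "x \<bullet> (S *v y) = (S *v x) \<bullet> y"
  using assms by (auto simp: psd_def inner_matrix_vector_transpose[of x S y])

text \<open>Nonnegativity of the form at s x + t y is a quadratic inequality in (s, t), and the
  claim is its discriminant. An isotropic \<open>y\<close> is treated separately because the leading
  coefficient then vanishes.\<close>

lemma psd_Cauchy_Schwarz: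
  assumes "psd S"
  shows "(x \<bullet> (S *v y))\<^sup>2 \<le> (x \<bullet> (S *v x)) * (y \<bullet> (S *v y))"
proof -
  let ?a = "x \<bullet> (S *v x)" and ?b = "x \<bullet> (S *v y)" and ?c = "y \<bullet> (S *v y)"
  have q: "0 \<le> s\<^sup>2 * ?a + 2 * s * t * ?b + t\<^sup>2 * ?c" for s t
  proof -
    have "0 \<le> (s *\<^sub>R x + t *\<^sub>R y) \<bullet> (S *v (s *\<^sub>R x + t *\<^sub>R y))"
      by (rule psdD(2)[OF assms])
    also have "\<dots> = s\<^sup>2 * ?a + 2 * s * t * ?b + t\<^sup>2 * ?c"
      using psdD(3)[OF assms, of y x]
      by (simp add: matrix_vector_right_distrib matrix_vector_mult_scaleR inner_add_left inner_add_right
          power2_eq_square algebra_simps inner_commute)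
    finally show ?thesis .
  qed
  have a: "0 \<le> ?a" and c: "0 \<le> ?c" using psdD(2)[OF assms] by auto
  show ?thesis
  proof (cases "?c = 0")
    case True
    have "0 \<le> 2 * t * ?b + ?a" for t using q[of 1 t] True by simp
    \<comment> \<open>For nonzero \<open>?b\<close> this witness would make the affine function of
      \<open>t\<close> equal to -1.\<close>
    from this[of "- (?a + 1) / (2 * ?b)"] have "?b = 0" by (cases "?b = 0") (auto simp: field_simps)
    with True show ?thesis by simp
  next
    case False
    with c have "0 < ?c" by simp
    \<comment> \<open>The form is smallest along t / s = - b / c; scaling by c avoids the
      quotient.\<close>
    have "0 \<le> ?c * (?a * ?c - ?b\<^sup>2)"
      using q[of ?c "- ?b"] by (simp add: power2_eq_square algebra_simps)
    with \<open>0 < ?c\<close> have "0 \<le> ?a * ?c - ?b\<^sup>2" by (simp add: zero_le_mult_iff)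
    then show ?thesis by simp
  qed
qed

lemma trace_eq_sum_inner_axis:
  fixes S :: "real^'n^'n"
  shows "trace S = (\<Sum>i\<in>UNIV. axis i 1 \<bullet> (S *v axis i 1))"
  by (simp add: trace_def inner_axis' matrix_vector_mul_component row_def cart_eq_inner_axis[symmetric] column_def
      matrix_vector_mult_basis)

lemma inner_eq_sum_axis:
  fixes x :: "real^'n"
  shows "x \<bullet> y = (\<Sum>i\<in>UNIV. (x \<bullet> axis i 1) * (y \<bullet> axis i 1))"
  by (simp only: inner_axis inner_real_def mult_1_right) (simp add: inner_vec_def)

text \<open>This is S^2 <= tr(S) S in the Loewner order, obtained from Cauchy-Schwarz for the form
  in each coordinate of \<open>S *v y\<close>. It stands in for spectral bounds throughout.\<close>

lemma psd_norm_le_trace: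
  fixes S :: "real^'n^'n"
  assumes "psd S"
  shows "(S *v y) \<bullet> (S *v y) \<le> trace S * (y \<bullet> (S *v y))"
proof -
  have "(S *v y) \<bullet> (S *v y) = (\<Sum>i\<in>UNIV. (axis i 1 \<bullet> (S *v y))\<^sup>2)"
    by (subst inner_eq_sum_axis) (simp add: power2_eq_square inner_commute)
  also have "\<dots> \<le> (\<Sum>i\<in>UNIV. (axis i 1 \<bullet> (S *v axis i 1)) * (y \<bullet> (S *v y)))"
    by (intro sum_mono psd_Cauchy_Schwarz[OF assms])
  finally show ?thesis by (simp add: trace_eq_sum_inner_axis sum_distrib_right)
qed

lemma psd_trace_nonneg: "psd S \<Longrightarrow> 0 \<le> trace S"
  unfolding trace_eq_sum_inner_axis by (intro sum_nonneg psdD(2))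

lemma det_nz_iff_ker:
  fixes A :: "real^'n^'n"
  shows "det A \<noteq> 0 \<longleftrightarrow> (\<forall>x. A *v x = 0 \<longrightarrow> x = 0)"
  by (simp add: invertible_det_nz[symmetric] invertible_left_inverse matrix_left_invertible_ker)

lemma pos_def_det_nz: "pos_def S \<Longrightarrow> det S \<noteq> 0"
  unfolding det_nz_iff_ker pos_def_def by (metis inner_zero_right less_irrefl)

text \<open>A vector on which the form vanishes lies in the kernel, by S^2 <= tr(S) S.\<close>

lemma psd_pos_def_iff:
  assumes "psd S"
  shows "pos_def S \<longleftrightarrow> det S \<noteq> 0"
proof
  assume nz: "det S \<noteq> 0"
  have "0 < x \<bullet> (S *v x)" if "x \<noteq> 0" for x
  proof -
    have "x \<bullet> (S *v x) \<noteq> 0"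
    proof
      assume "x \<bullet> (S *v x) = 0"
      then have "(S *v x) \<bullet> (S *v x) \<le> 0" using psd_norm_le_trace[OF assms, of x] by simp
      then have "S *v x = 0" by (metis inner_ge_zero inner_eq_zero_iff order_antisym)
      with nz that show False unfolding det_nz_iff_ker by blast
    qed
    with psdD(2)[OF assms, of x] show ?thesis by simp
  qed
  with psdD(1)[OF assms] show "pos_def S" by (simp add: pos_def_def)
qed (rule pos_def_det_nz)

lemma pos_def_matrix_inv:
  assumes "pos_def S"
  shows "pos_def (matrix_inv S)"
  unfolding pos_def_def
proof (intro conjI allI impI)
  have nz: "det S \<noteq> 0" and t: "transpose S = S" using assms pos_def_det_nz by (auto simp: pos_def_def)
  show "transpose (matrix_inv S) = matrix_inv S" by (rule matrix_inv_symmetric[OF nz t])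
  fix x :: "real^'a" assume "x \<noteq> 0"
  let ?z = "matrix_inv S *v x"
  have x: "S *v ?z = x" by (rule matrix_inv_vector[OF nz])
  with \<open>x \<noteq> 0\<close> have "?z \<noteq> 0" by (metis matrix_vector_mult_0_right)
  then have "0 < ?z \<bullet> (S *v ?z)" using assms by (simp add: pos_def_def)
  then show "0 < x \<bullet> ?z" by (simp add: x inner_commute)
qed

lemma matrix_inv_matrix_inv:
  fixes S :: "real^'n^'n"
  assumes "det S \<noteq> 0"
  shows "matrix_inv (matrix_inv S) = S"
  by (rule matrix_inv_eqI(1)) (rule matrix_inv_inverse(2)[OF assms])

text \<open>Gram--Schmidt for the inner product given by \<open>\<Omega>\<close>, one column at a time.\<close>

lemma pos_def_obtain_orthonormal:
  fixes \<Omega> :: "real^'n^'n"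
  assumes "pos_def \<Omega>"
  obtains B :: "real^'n^'n" where "transpose B ** \<Omega> ** B = mat 1"
proof -
  have sym: "x \<bullet> (\<Omega> *v y) = y \<bullet> (\<Omega> *v x)" for x y
    using psdD(3)[OF pos_def_imp_psd[OF assms]] by (metis inner_commute)
  have "\<exists>v :: 'n \<Rightarrow> real^'n. \<forall>i\<in>I. \<forall>j\<in>I. v i \<bullet> (\<Omega> *v v j) = of_bool (i = j)" for I :: "'n set"
    using finite[of I]
  proof (induction I)
    case (insert a I)
    then obtain v :: "'n \<Rightarrow> real^'n"
      where v: "\<And>i j. i \<in> I \<Longrightarrow> j \<in> I \<Longrightarrow> v i \<bullet> (\<Omega> *v v j) = of_bool (i = j)" by blast
    let ?W = "(\<lambda>i. \<Omega> *v v i) ` I"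
    have "I \<noteq> UNIV" using insert.hyps by auto
    then have "card I < CARD('n)" by (simp add: psubset_card_mono psubsetI)
    have "dim ?W \<le> card ?W" by (rule dim_le_card') simp
    also have "\<dots> \<le> card I" by (rule card_image_le) simp
    finally have "dim ?W < DIM(real^'n)" using \<open>card I < CARD('n)\<close> by simp
    then obtain w where w: "w \<noteq> 0" "\<And>y. y \<in> span ?W \<Longrightarrow> orthogonal w y"
      using orthogonal_to_subspace_exists by blast
    have wv: "w \<bullet> (\<Omega> *v v i) = 0" if "i \<in> I" for i
      using w(2)[of "\<Omega> *v v i"] that by (auto simp: orthogonal_def intro: span_base)
    have pos: "0 < w \<bullet> (\<Omega> *v w)" using assms w(1) by (simp add: pos_def_def)
    define c where "c = 1 / sqrt (w \<bullet> (\<Omega> *v w))"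
    have c: "c * (c * (w \<bullet> (\<Omega> *v w))) = 1" using pos by (simp add: c_def field_simps)
    define v' where "v' = v(a := c *\<^sub>R w)"
    have "v' i \<bullet> (\<Omega> *v v' j) = of_bool (i = j)" if "i \<in> insert a I" "j \<in> insert a I" for i j
    proof -
      have "v k \<bullet> (\<Omega> *v w) = 0" if "k \<in> I" for k using wv[OF that] sym[of "v k" w] by simp
      then show ?thesis using that insert.hyps v c wv
        by (cases "i = a"; cases "j = a") (auto simp: v'_def matrix_vector_mult_scaleR)
    qed
    then show ?case by blast
  qed auto
  then obtain v :: "'n \<Rightarrow> real^'n" where v: "\<And>i j. v i \<bullet> (\<Omega> *v v j) = of_bool (i = j)" by (metis UNIV_I)
  define B :: "real^'n^'n" where "B = (\<chi> i j. v j $ i)"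
  have col: "B *v axis j 1 = v j" for j
    by (simp add: B_def matrix_vector_mult_basis column_def vec_eq_iff)
  have "(transpose B ** \<Omega> ** B) $ i $ j = mat 1 $ i $ j" for i j
  proof -
    have "(transpose B ** \<Omega> ** B) $ i $ j = axis i 1 \<bullet> ((transpose B ** \<Omega> ** B) *v axis j 1)"
      by (simp add: inner_axis' matrix_vector_mult_basis column_def)
    also have "\<dots> = v i \<bullet> (\<Omega> *v v j)"
      using inner_matrix_vector_transpose[of "axis i 1" "transpose B" "\<Omega> *v (B *v axis j 1)"] col
      by (simp only: matrix_vector_mul_assoc[symmetric] transpose_transpose)
    finally show ?thesis by (simp add: v mat_def)
  qed
  then have "transpose B ** \<Omega> ** B = mat 1" by (simp add: vec_eq_iff)
  then show thesis by (rule that)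
qed

text \<open>Congruence with the identity: B^T S B = I forces (det B)^2 det S = 1.\<close>

lemma pos_def_det_pos:
  fixes S :: "real^'n^'n"
  assumes "pos_def S" shows "0 < det S"
proof -
  obtain B :: "real^'n^'n" where "transpose B ** S ** B = mat 1"
    using pos_def_obtain_orthonormal[OF assms] by blast
  then have "det (transpose B ** S ** B) = 1" by simp
  then have "(det B)\<^sup>2 * det S = 1" by (simp add: det_mul power2_eq_square mult_ac)
  moreover have "0 \<le> (det B)\<^sup>2" by simp
  ultimately show ?thesis by (metis zero_less_mult_pos zero_less_one less_eq_real_def mult_zero_left zero_neq_one)
qed

text \<open>The constant is the reciprocal of \<open>trace (matrix_inv \<Omega>) + 1\<close>: the
  bound S^2 <= tr(S) S is applied to the inverse, at the vector \<open>\<Omega> *v z\<close>. The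
  summand 1 secures positivity.\<close>

lemma pos_def_lower_bound:
  fixes \<Omega> :: "real^'n^'n"
  assumes "pos_def \<Omega>"
  obtains l where "0 < l" "\<And>z. l * (z \<bullet> z) \<le> z \<bullet> (\<Omega> *v z)"
proof -
  have nz: "det \<Omega> \<noteq> 0" by (rule pos_def_det_nz[OF assms])
  have psi: "psd (matrix_inv \<Omega>)" by (intro pos_def_imp_psd pos_def_matrix_inv assms)
  define t where "t = trace (matrix_inv \<Omega>) + 1"
  have t: "0 < t" using psd_trace_nonneg[OF psi] by (simp add: t_def)
  have "(1/t) * (z \<bullet> z) \<le> z \<bullet> (\<Omega> *v z)" for z
  proof -
    have "z \<bullet> z \<le> trace (matrix_inv \<Omega>) * (z \<bullet> (\<Omega> *v z))"
      using psd_norm_le_trace[OF psi, of "\<Omega> *v z"] by (simp add: matrix_inv_vector[OF nz] inner_commute)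
    also have "\<dots> \<le> t * (z \<bullet> (\<Omega> *v z))"
      using psdD(2)[OF pos_def_imp_psd[OF assms], of z] by (simp add: t_def algebra_simps)
    finally show ?thesis using t by (simp add: field_simps)
  qed
  then show thesis using t by (intro that[of "1/t"]) auto
qed

lemma matrix_inner_bound:
  fixes \<Omega> :: "real^'n^'m"
  obtains C where "0 < C" "\<And>y z. \<bar>y \<bullet> (\<Omega> *v z)\<bar> \<le> C * norm y * norm z"
proof -
  have "\<exists>C>0. \<forall>z. norm (\<Omega> *v z) \<le> norm z * C"
    by (rule bounded_linear.pos_bounded) (simp add: linear_conv_bounded_linear[symmetric])
  then obtain C where C: "0 < C" "\<And>z. norm (\<Omega> *v z) \<le> norm z * C" by blast
  have "\<bar>y \<bullet> (\<Omega> *v z)\<bar> \<le> C * norm y * norm z" for y z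
  proof -
    have "\<bar>y \<bullet> (\<Omega> *v z)\<bar> \<le> norm y * norm (\<Omega> *v z)" by (rule Cauchy_Schwarz_ineq2)
    also have "\<dots> \<le> norm y * (norm z * C)" by (intro mult_left_mono C) simp
    finally show ?thesis by (simp add: mult_ac)
  qed
  with C(1) show thesis by (rule that)
qed


section \<open>Resolvent estimates for the ridge\<close>

lemma ridge_vector:
  fixes S :: "real^'n^'n"
  shows "(S + e *\<^sub>R mat 1) *v x = S *v x + e *\<^sub>R x"
  by (simp add: matrix_vector_mult_add_rdistrib scaleR_matrix_vector_assoc[symmetric])

lemma pos_def_ridge:
  assumes "psd S" "0 < e"
  shows "pos_def (S + e *\<^sub>R mat 1)"
  unfolding pos_def_def
proof (intro conjI allI impI)
  show "transpose (S + e *\<^sub>R mat 1) = S + e *\<^sub>R mat 1"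
    using psdD(1)[OF assms(1)] by (simp add: transpose_def vec_eq_iff mat_def)
  fix x :: "real^'a" assume "x \<noteq> 0"
  then have "0 < e * (x \<bullet> x)" using assms(2) by simp
  with psdD(2)[OF assms(1), of x] show "0 < x \<bullet> ((S + e *\<^sub>R mat 1) *v x)"
    by (simp add: ridge_vector inner_add_right)
qed

text \<open>The resolvent relation S K = I - e K, combined with S >= 0, yields the estimates. The
  upper bounds give functions of \<open>K\<close> polynomial growth at fixed \<open>e\<close>; the
  lower bound on the trace detects singular \<open>S\<close>; the comparison with the inverse of
  \<open>S\<close> supplies dominating functions as \<open>e\<close> tends to 0.\<close>

lemma
  fixes S :: "real^'n^'n"
  assumes S: "psd S" and e: "0 < e"
  defines "K \<equiv> matrix_inv (S + e *\<^sub>R mat 1)"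
  shows psd_ridge_inv: "psd K"
    and ridge_inv_mult: "S *v (K *v x) = x - e *\<^sub>R (K *v x)"
    and ridge_inv_sq_le: "e * ((K *v x) \<bullet> (K *v x)) \<le> x \<bullet> (K *v x)"
    and ridge_inv_norm_le: "e * norm (K *v x) \<le> norm x"
    and ridge_inv_trace_le: "e * trace K \<le> real CARD('n)"
    and ridge_inv_trace_ge: "det S = 0 \<Longrightarrow> 1 \<le> e * trace K"
    and ridge_inv_le_inv: "det S \<noteq> 0 \<Longrightarrow> x \<bullet> (K *v x) \<le> x \<bullet> (matrix_inv S *v x)"
proof -
  have pd: "pos_def (S + e *\<^sub>R mat 1)" by (rule pos_def_ridge[OF S e])
  note nz = pos_def_det_nz[OF pd]
  show K: "psd K" unfolding K_def by (intro pos_def_imp_psd pos_def_matrix_inv pd)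
  have KS: "S *v (K *v x) + e *\<^sub>R (K *v x) = x" for x
    using matrix_inv_vector(1)[OF nz, of x] by (simp add: K_def ridge_vector)
  show mult: "S *v (K *v x) = x - e *\<^sub>R (K *v x)" for x
    using KS[of x] by (simp add: algebra_simps)
  show sq: "e * ((K *v x) \<bullet> (K *v x)) \<le> x \<bullet> (K *v x)" for x
    using psdD(2)[OF S, of "K *v x"] by (simp add: mult inner_diff_right inner_commute)
  show nrm: "e * norm (K *v x) \<le> norm x" for x
  proof (cases "K *v x = 0")
    case False
    have "e * norm (K *v x) * norm (K *v x) \<le> norm x * norm (K *v x)"
      using sq[of x] norm_cauchy_schwarz[of x "K *v x"]
      by (simp add: dot_square_norm power2_eq_square mult.assoc)
    with False show ?thesis by simp
  qed simp
  have form: "e * (x \<bullet> (K *v x)) \<le> x \<bullet> x" for x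
  proof -
    have "e * (x \<bullet> (K *v x)) \<le> norm x * (e * norm (K *v x))"
      using norm_cauchy_schwarz[of x "K *v x"] e by (simp add: mult_ac)
    also have "\<dots> \<le> norm x * norm x" by (intro mult_left_mono nrm) simp
    finally show ?thesis by (simp add: dot_square_norm power2_eq_square)
  qed
  have "e * trace K = (\<Sum>i\<in>UNIV. e * (axis i 1 \<bullet> (K *v axis i 1)))"
    by (simp add: trace_eq_sum_inner_axis sum_distrib_left)
  also have "\<dots> \<le> (\<Sum>i\<in>(UNIV::'n set). axis i 1 \<bullet> (axis i 1 :: real^'n))" by (intro sum_mono form)
  also have "\<dots> = real CARD('n)" by (simp add: inner_axis_axis)
  finally show "e * trace K \<le> real CARD('n)" .
  show "1 \<le> e * trace K" if sing: "det S = 0"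
  proof -
    \<comment> \<open>A null vector of \<open>S\<close> is an eigenvector of \<open>K\<close> with
      eigenvalue 1 / e, which forces the trace of \<open>K\<close> up to at least that size.\<close>
    obtain z where z: "z \<noteq> 0" "S *v z = 0" using sing det_nz_iff_ker[of S] by blast
    have "K *v z = (1 / e) *\<^sub>R z"
    proof -
      have "e *\<^sub>R (K *v z) = z"
        using matrix_inv_vector(2)[OF nz, of z] z(2) by (simp add: K_def ridge_vector matrix_vector_mult_scaleR)
      then have "(1 / e) *\<^sub>R (e *\<^sub>R (K *v z)) = (1 / e) *\<^sub>R z" by simp
      with e show ?thesis by simp
    qed
    then have "(1 / e) * (1/e) * (z \<bullet> z) \<le> trace K * ((1/e) * (z \<bullet> z))"
      using psd_norm_le_trace[OF K, of z] by simp
    moreover have "0 < z \<bullet> z" using z by simp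
    ultimately show ?thesis using e by (simp add: field_simps)
  qed
  show "x \<bullet> (K *v x) \<le> x \<bullet> (matrix_inv S *v x)" if "det S \<noteq> 0" for x
  proof -
    \<comment> \<open>Cauchy-Schwarz for the form \<open>S\<close>, between K x and S^-1 x, bounds
      the square of x^T K x by x^T K x times x^T S^-1 x; one factor then cancels.\<close>
    let ?a = "K *v x" and ?b = "matrix_inv S *v x"
    have Sb: "S *v ?b = x" by (rule matrix_inv_vector(1)[OF that])
    have c: "x \<bullet> ?a = ?a \<bullet> (S *v ?b)" by (simp add: Sb inner_commute)
    have c0: "?b \<bullet> (S *v ?b) = x \<bullet> ?b" by (simp add: Sb inner_commute)
    have le: "?a \<bullet> (S *v ?a) \<le> x \<bullet> ?a" using e by (simp add: mult inner_diff_right inner_commute)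
    have b0: "0 \<le> x \<bullet> ?b" using psdD(2)[OF S, of ?b] by (simp add: c0)
    have "(x \<bullet> ?a)\<^sup>2 \<le> (?a \<bullet> (S *v ?a)) * (x \<bullet> ?b)"
      using psd_Cauchy_Schwarz[OF S, of ?a ?b] by (simp only: c[symmetric] c0)
    also have "\<dots> \<le> (x \<bullet> ?a) * (x \<bullet> ?b)" by (rule mult_right_mono[OF le b0])
    finally have *: "(x \<bullet> ?a) * (x \<bullet> ?a) \<le> (x \<bullet> ?a) * (x \<bullet> ?b)" by (simp only: power2_eq_square)
    show ?thesis
    proof (cases "x \<bullet> ?a = 0")
      case False
      then have "0 < x \<bullet> ?a" using psdD(2)[OF K, of x] by simp
      then show ?thesis using mult_left_le_imp_le[OF *] by simp
    qed (simp add: b0)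
  qed
qed

section \<open>Continuity, measurability and derivative of the matrix inverse\<close>

text \<open>Cramer's rule makes every entry a ratio of determinants, so continuity and measurability
  of the inverse reduce to polynomials in the entries.\<close>

lemma matrix_inv_component:
  fixes A :: "real^'n^'n"
  assumes "det A \<noteq> 0"
  shows "matrix_inv A $ a $ b = det (\<chi> i j. if j = a then axis b 1 $ i else A $ i $ j) / det A"
proof -
  have "matrix_inv A $ a $ b = (matrix_inv A *v axis b 1) $ a"
    by (simp add: matrix_vector_mult_basis column_def)
  also have "matrix_inv A *v axis b 1 = (\<chi> k. det (\<chi> i j. if j = k then axis b 1 $ i else A $ i $ j) / det A)"
    using cramer[OF assms, of "matrix_inv A *v axis b 1" "axis b 1"] matrix_inv_vector(1)[OF assms] by blast
  finally show ?thesis by simp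
qed

lemma tendsto_det:
  fixes A :: "'a \<Rightarrow> real^'n^'n"
  assumes "\<And>i j. ((\<lambda>x. A x $ i $ j) \<longlongrightarrow> L $ i $ j) F"
  shows "((\<lambda>x. det (A x)) \<longlongrightarrow> det L) F"
  unfolding det_def by (intro tendsto_sum tendsto_mult tendsto_const tendsto_prod assms)

lemma tendsto_matrix_inv:
  fixes A :: "'a \<Rightarrow> real^'n^'n"
  assumes "(A \<longlongrightarrow> L) F" "det L \<noteq> 0"
  shows "((\<lambda>x. matrix_inv (A x)) \<longlongrightarrow> matrix_inv L) F"
proof (intro vec_tendstoI)
  have c: "((\<lambda>x. A x $ i $ j) \<longlongrightarrow> L $ i $ j) F" for i j
    by (intro tendsto_vec_nth assms(1))
  have d: "((\<lambda>x. det (A x)) \<longlongrightarrow> det L) F" by (rule tendsto_det[OF c])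
  then have ev: "\<forall>\<^sub>F x in F. det (A x) \<noteq> 0" using assms(2) by (rule tendsto_imp_eventually_ne)
  fix a b
  have "((\<lambda>x. det (\<chi> i j. if j = a then axis b 1 $ i else A x $ i $ j) / det (A x)) \<longlongrightarrow>
      det (\<chi> i j. if j = a then axis b 1 $ i else L $ i $ j) / det L) F"
    by (intro tendsto_divide d tendsto_det assms(2)) (simp add: c)
  then show "((\<lambda>x. matrix_inv (A x) $ a $ b) \<longlongrightarrow> matrix_inv L $ a $ b) F"
    unfolding matrix_inv_component[OF assms(2)]
    by (rule Lim_transform_eventually) (use ev in eventually_elim, simp add: matrix_inv_component)
qed

lemma borel_measurable_det:
  fixes A :: "'a \<Rightarrow> real^'n^'n"
  assumes "\<And>i j. (\<lambda>x. A x $ i $ j) \<in> borel_measurable G"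
  shows "(\<lambda>x. det (A x)) \<in> borel_measurable G"
  unfolding det_def by (intro borel_measurable_sum borel_measurable_times borel_measurable_const borel_measurable_prod assms)

lemma borel_measurable_matrix_inv_component:
  fixes A :: "'a \<Rightarrow> real^'n^'n"
  assumes A: "\<And>i j. (\<lambda>x. A x $ i $ j) \<in> borel_measurable G"
  shows "(\<lambda>x. matrix_inv (A x) $ a $ b) \<in> borel_measurable G"
proof -
  \<comment> \<open>No matrix meets the defining condition of an inverse of a singular matrix, so
    all singular matrices share one unspecified default value. The inverse is therefore constant on
    the singular set, hence measurable there too.\<close>
  have sing: "matrix_inv M = (SOME B. False)" if "det M = 0" for M :: "real^'n^'n"
  proof -
    have "\<not> invertible M" using that by (simp add: invertible_det_nz)
    then show ?thesis unfolding matrix_inv_def invertible_def by (intro arg_cong[where f=Eps]) auto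
  qed
  have "(\<lambda>x. matrix_inv (A x) $ a $ b) = (\<lambda>x. if det (A x) = 0 then (SOME B::real^'n^'n. False) $ a $ b
      else det (\<chi> i j. if j = a then axis b 1 $ i else A x $ i $ j) / det (A x))"
    by (auto simp: sing matrix_inv_component)
  moreover have "\<dots> \<in> borel_measurable G"
  proof (intro measurable_If borel_measurable_divide borel_measurable_det)
    show "{x \<in> space G. det (A x) = 0} \<in> sets G"
      using borel_measurable_det[OF A] by measurable
    show "(\<lambda>x. (\<chi> i j. if j = a then axis b 1 $ i else A x $ i $ j) $ i $ j) \<in> borel_measurable G" for i j
      by (cases "j = a") (simp_all add: A)
  qed (auto simp: A)
  ultimately show ?thesis by simp
qed

lemma bounded_bilinear_matrix_mult:
  "bounded_bilinear (\<lambda>(A::real^'n^'m) (B::real^'p^'n). A ** B)"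
  unfolding bilinear_conv_bounded_bilinear[symmetric] bilinear_def
  by (auto intro!: linearI simp: matrix_matrix_mult_def vec_eq_iff sum.distrib sum_distrib_left algebra_simps)

lemma bounded_bilinear_matrix_vector_mult:
  "bounded_bilinear (\<lambda>(A::real^'n^'m) (x::real^'n). A *v x)"
  unfolding bilinear_conv_bounded_bilinear[symmetric] bilinear_def
  by (auto intro!: linearI simp: matrix_vector_mult_def vec_eq_iff sum.distrib sum_distrib_left algebra_simps)

lemma has_vector_derivative_iff_quotient:
  fixes f :: "real \<Rightarrow> 'b::real_normed_vector"
  shows "(f has_vector_derivative D) (at x) \<longleftrightarrow> ((\<lambda>y. (f y - f x) /\<^sub>R (y - x)) \<longlongrightarrow> D) (at x)"
proof -
  have eq: "norm (f y - f x - (y - x) *\<^sub>R D) / norm (y - x) = norm ((f y - f x) /\<^sub>R (y - x) - D)" if "y \<noteq> x" for y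
  proof -
    have "(f y - f x) /\<^sub>R (y - x) - D = (f y - f x - (y - x) *\<^sub>R D) /\<^sub>R (y - x)"
      using that by (simp add: scaleR_diff_right)
    then show ?thesis using that by (simp add: divide_inverse_commute)
  qed
  have "(f has_vector_derivative D) (at x) \<longleftrightarrow> ((\<lambda>y. norm (f y - f x - (y - x) *\<^sub>R D) / norm (y - x)) \<longlongrightarrow> 0) (at x)"
    by (simp add: has_vector_derivative_def has_derivative_iff_norm bounded_linear_scaleR_left)
  also have "\<dots> \<longleftrightarrow> ((\<lambda>y. norm ((f y - f x) /\<^sub>R (y - x) - D)) \<longlongrightarrow> 0) (at x)"
    by (intro filterlim_cong refl eventually_at_filter[THEN iffD2] always_eventually allI impI eq)
  finally show ?thesis by (simp add: tendsto_norm_zero_iff LIM_zero_iff)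
qed

text \<open>The identity K_t - K_x = - K_t (S_t - S_x) K_x turns the difference quotient of the
  inverse into a product of convergent factors.\<close>

lemma has_vector_derivative_matrix_inv:
  fixes S :: "real \<Rightarrow> real^'n^'n"
  assumes S: "(S has_vector_derivative S') (at x)" and nz: "det (S x) \<noteq> 0"
  shows "((\<lambda>t. matrix_inv (S t)) has_vector_derivative - (matrix_inv (S x) ** S' ** matrix_inv (S x))) (at x)"
proof (rule has_vector_derivative_iff_quotient[THEN iffD2])
  have "isCont S x" using S by (rule has_vector_derivative_continuous)
  then have St: "(S \<longlongrightarrow> S x) (at x)" by (simp add: isCont_def)
  note Kt = tendsto_matrix_inv[OF St nz]
  have "((\<lambda>t. det (S t)) \<longlongrightarrow> det (S x)) (at x)"
    by (intro tendsto_det tendsto_vec_nth St)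
  then have ev: "\<forall>\<^sub>F t in at x. det (S t) \<noteq> 0" using nz by (rule tendsto_imp_eventually_ne)
  have Q: "((\<lambda>t. (S t - S x) /\<^sub>R (t - x)) \<longlongrightarrow> S') (at x)"
    using S by (simp only: has_vector_derivative_iff_quotient)
  interpret mm: bounded_bilinear "\<lambda>(A::real^'n^'n) (B::real^'n^'n). A ** B"
    by (rule bounded_bilinear_matrix_mult)
  have "((\<lambda>t. - (matrix_inv (S t) ** ((S t - S x) /\<^sub>R (t - x)) ** matrix_inv (S x))) \<longlongrightarrow>
      - (matrix_inv (S x) ** S' ** matrix_inv (S x))) (at x)"
    by (intro tendsto_minus mm.tendsto Kt Q tendsto_const)
  then show "((\<lambda>t. (matrix_inv (S t) - matrix_inv (S x)) /\<^sub>R (t - x)) \<longlongrightarrow>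
      - (matrix_inv (S x) ** S' ** matrix_inv (S x))) (at x)"
  proof (rule Lim_transform_eventually)
    show "\<forall>\<^sub>F t in at x. - (matrix_inv (S t) ** ((S t - S x) /\<^sub>R (t - x)) ** matrix_inv (S x)) =
        (matrix_inv (S t) - matrix_inv (S x)) /\<^sub>R (t - x)"
      using ev
    proof eventually_elim
      case (elim t)
      have "- (matrix_inv (S t) ** ((S t - S x) /\<^sub>R (t - x)) ** matrix_inv (S x)) =
          - ((matrix_inv (S t) ** (S t - S x) ** matrix_inv (S x)) /\<^sub>R (t - x))"
        by (simp only: mm.scaleR_right mm.scaleR_left)
      also have "matrix_inv (S t) ** (S t - S x) ** matrix_inv (S x) = matrix_inv (S x) - matrix_inv (S t)"
        by (simp only: mm.diff_right mm.diff_left matrix_inv_inverse[OF elim] matrix_mul_lid)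
           (simp only: matrix_mul_assoc[symmetric] matrix_inv_inverse[OF nz] matrix_mul_rid)
      finally show ?case by (simp add: scaleR_minus_right[symmetric] del: scaleR_minus_right)
    qed
  qed
qed

section \<open>Normal laws as densities\<close>

lemma prod_Basis_vec:
  fixes g :: "'a::euclidean_space^'n \<Rightarrow> 'b::comm_monoid_mult"
  shows "(\<Prod>b\<in>Basis. g b) = (\<Prod>i\<in>UNIV. \<Prod>e\<in>Basis. g (axis i e))"
proof -
  have "(\<Prod>b\<in>Basis. g b) = (\<Prod>b\<in>(\<Union>i\<in>UNIV. axis i ` Basis). g b)"
    by (rule prod.cong) (auto simp: Basis_vec_def)
  also have "\<dots> = (\<Prod>i\<in>UNIV. \<Prod>b\<in>axis i ` Basis. g b)"
    by (rule prod.UNION_disjoint) (auto simp: axis_eq_axis)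
  also have "\<dots> = (\<Prod>i\<in>UNIV. \<Prod>e\<in>Basis. g (axis i e))"
    by (intro prod.cong refl, subst prod.reindex) (auto simp: inj_on_def axis_eq_axis)
  finally show ?thesis .
qed

lemma measurable_vec_lambda_PiM [measurable]:
  "(\<lambda>r. \<chi> i. r i) \<in> measurable (\<Pi>\<^sub>M i\<in>(UNIV::'n::finite set). (borel :: 'a::euclidean_space measure)) borel"
  by (subst borel_measurable_euclidean_space) (auto simp: Basis_vec_def inner_axis)

text \<open>Boxes determine Lebesgue measure, and a box of vectors with entries in a Euclidean space
  is a product of boxes.\<close>

lemma lborel_vec:
  "distr (\<Pi>\<^sub>M i\<in>(UNIV::'n::finite set). lborel) borel (\<lambda>r. \<chi> i. r i) = (lborel :: ('a::euclidean_space^'n) measure)"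
proof (rule lborel_eqI[symmetric])
  fix l u :: "'a^'n"
  assume le: "\<And>b. b \<in> Basis \<Longrightarrow> l \<bullet> b \<le> u \<bullet> b"
  have le': "l $ i \<bullet> e \<le> u $ i \<bullet> e" if "e \<in> Basis" for i e
    using le[of "axis i e"] that by (auto simp: Basis_vec_def inner_axis)
  interpret product_sigma_finite "\<lambda>_::'n. lborel :: 'a measure" by standard
  have [measurable]: "(\<lambda>r. \<chi> i. r i) \<in> measurable (\<Pi>\<^sub>M i\<in>(UNIV::'n set). (lborel :: 'a measure)) borel"
    using measurable_vec_lambda_PiM[where 'n='n and 'a='a]
    by (subst measurable_cong_sets[OF sets_PiM_cong refl]) (auto)
  have "emeasure (distr (\<Pi>\<^sub>M i\<in>(UNIV::'n set). lborel) borel (\<lambda>r. \<chi> i. r i)) (box l u) =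
      emeasure (\<Pi>\<^sub>M i\<in>(UNIV::'n set). lborel) (Pi\<^sub>E UNIV (\<lambda>i. box (l $ i) (u $ i)))"
    by (subst emeasure_distr) (auto intro!: arg_cong[where f="emeasure _"]
          simp: space_PiM PiE_def extensional_def mem_box Basis_vec_def inner_axis Pi_iff)
  also have "\<dots> = (\<Prod>i\<in>UNIV. emeasure lborel (box (l $ i) (u $ i)))"
    by (rule emeasure_PiM) auto
  also have "\<dots> = (\<Prod>i\<in>UNIV. \<Prod>e\<in>Basis. ennreal ((u $ i - l $ i) \<bullet> e))"
    using le' by (simp add: emeasure_lborel_box prod_ennreal inner_diff_left)
  also have "\<dots> = (\<Prod>b\<in>Basis. ennreal ((u - l) \<bullet> b))"
    by (subst prod_Basis_vec) (simp add: inner_axis)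
  also have "\<dots> = ennreal (\<Prod>b\<in>Basis. (u - l) \<bullet> b)"
    using le by (subst prod_ennreal) (auto simp: inner_diff_left)
  finally show "emeasure (distr (\<Pi>\<^sub>M i\<in>(UNIV::'n set). lborel) borel (\<lambda>r. \<chi> i. r i)) (box l u) =
      ennreal (\<Prod>b\<in>Basis. (u - l) \<bullet> b)" .
qed simp

lemma nn_integral_lborel_vec:
  fixes f :: "'a::euclidean_space^'n \<Rightarrow> ennreal"
  assumes [measurable]: "f \<in> borel_measurable borel"
  shows "(\<integral>\<^sup>+y. f y \<partial>lborel) = (\<integral>\<^sup>+r. f (\<chi> i. r i) \<partial>(\<Pi>\<^sub>M i\<in>UNIV. lborel))"
proof -
  have [measurable]: "(\<lambda>r. \<chi> i. r i) \<in> measurable (\<Pi>\<^sub>M i\<in>(UNIV::'n set). (lborel :: 'a measure)) borel"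
    using measurable_vec_lambda_PiM[where 'n='n and 'a='a]
    by (subst measurable_cong_sets[OF sets_PiM_cong refl]) (auto)
  show ?thesis by (subst lborel_vec[symmetric]) (simp add: nn_integral_distr)
qed

lemma borel_measurable_matrix_vector_mult [measurable]:
  "(\<lambda>x. (A::real^'n^'m) *v x) \<in> borel_measurable borel"
  by (intro borel_measurable_continuous_onI linear_continuous_on)
     (simp add: linear_conv_bounded_linear[symmetric])

text \<open>The library's change of variables needs a well-ordered index type; for linear maps the
  reduction to elementary matrices does not.\<close>

lemma nn_integral_lborel_matrix:
  fixes A :: "real^'n^'n"
  assumes "det A \<noteq> 0" "f \<in> borel_measurable borel"
  shows "ennreal \<bar>det A\<bar> * (\<integral>\<^sup>+y. f (A *v y) \<partial>lborel) = (\<integral>\<^sup>+y. f y \<partial>lborel)"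
proof -
  define P :: "real^'n^'n \<Rightarrow> bool" where
    "P A \<longleftrightarrow> (det A \<noteq> 0 \<longrightarrow> (\<forall>f\<in>borel_measurable borel.
        ennreal \<bar>det A\<bar> * (\<integral>\<^sup>+y. f (A *v y) \<partial>lborel) = (\<integral>\<^sup>+y. f y \<partial>lborel)))" for A
  have "P A"
  proof (rule induct_matrix_elementary_alt)
    fix A B :: "real^'n^'n" assume A: "P A" and B: "P B"
    show "P (A ** B)" unfolding P_def
    proof (intro impI ballI)
      fix f :: "real^'n \<Rightarrow> ennreal" assume "det (A ** B) \<noteq> 0" and [measurable]: "f \<in> borel_measurable borel"
      then have nz: "det A \<noteq> 0" "det B \<noteq> 0" by (auto simp: det_mul)
      have "ennreal \<bar>det (A ** B)\<bar> * (\<integral>\<^sup>+y. f ((A ** B) *v y) \<partial>lborel) =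
          ennreal \<bar>det A\<bar> * (ennreal \<bar>det B\<bar> * (\<integral>\<^sup>+y. f (A *v (B *v y)) \<partial>lborel))"
        by (simp add: det_mul abs_mult ennreal_mult mult.assoc matrix_vector_mul_assoc)
      also have "ennreal \<bar>det B\<bar> * (\<integral>\<^sup>+y. f (A *v (B *v y)) \<partial>lborel) = (\<integral>\<^sup>+y. f (A *v y) \<partial>lborel)"
        using B nz(2) unfolding P_def by (auto dest: bspec[where x="\<lambda>y. f (A *v y)"])
      also have "ennreal \<bar>det A\<bar> * \<dots> = (\<integral>\<^sup>+y. f y \<partial>lborel)"
        using A nz(1) unfolding P_def by auto
      finally show "ennreal \<bar>det (A ** B)\<bar> * (\<integral>\<^sup>+y. f ((A ** B) *v y) \<partial>lborel) = (\<integral>\<^sup>+y. f y \<partial>lborel)" .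
    qed
  next
    fix A :: "real^'n^'n" and i assume "row i A = 0"
    then show "P A" by (simp add: P_def det_zero_row)
  next
    fix A :: "real^'n^'n" assume diag: "\<And>i j. i \<noteq> j \<Longrightarrow> A $ i $ j = 0"
    show "P A" unfolding P_def
    proof (intro impI ballI)
      fix f :: "real^'n \<Rightarrow> ennreal" assume nz: "det A \<noteq> 0" and [measurable]: "f \<in> borel_measurable borel"
      have det: "det A = (\<Prod>i\<in>UNIV. A $ i $ i)" by (rule det_diagonal) (rule diag)
      define c where "c b = (\<Sum>i\<in>UNIV. b $ i * A $ i $ i)" for b :: "real^'n"
      have c: "c (axis i 1) = A $ i $ i" for i
        by (simp add: c_def axis_def if_distrib[where f="\<lambda>x. x * _"] cong: if_cong)
      have "(\<Sum>b\<in>Basis. (c b * (x \<bullet> b)) *\<^sub>R b) = A *v x" for x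
      proof -
        have "(\<Sum>b\<in>Basis. (c b * (x \<bullet> b)) *\<^sub>R b) = (\<Sum>b\<in>range (\<lambda>i. axis i 1). (c b * (x \<bullet> b)) *\<^sub>R b)"
          by (rule sum.cong) (auto simp: Basis_vec_def)
        also have "\<dots> = (\<Sum>i\<in>UNIV. (A $ i $ i * x $ i) *\<^sub>R axis i 1)"
          by (subst sum.reindex) (auto simp: inj_on_def axis_eq_axis c inner_axis)
        also have "\<dots> = A *v x"
        proof (simp add: vec_eq_iff matrix_vector_mult_def, intro allI)
          fix j
          have "(\<Sum>i\<in>UNIV. A $ i $ i * x $ i * axis i 1 $ j) = (\<Sum>i\<in>UNIV. if i = j then A $ j $ j * x $ j else 0)"
            by (rule sum.cong) (auto simp: axis_def)
          moreover have "(\<Sum>i\<in>UNIV. A $ j $ i * x $ i) = (\<Sum>i\<in>UNIV. if i = j then A $ j $ j * x $ j else 0)"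
            by (rule sum.cong) (auto simp: diag)
          ultimately show "(\<Sum>i\<in>UNIV. A $ i $ i * x $ i * axis i 1 $ j) = (\<Sum>i\<in>UNIV. A $ j $ i * x $ i)" by simp
        qed
        finally show ?thesis .
      qed
      moreover have "c b \<noteq> 0" if "b \<in> Basis" for b
        using that nz by (auto simp: Basis_vec_def c det)
      moreover have "(\<Prod>b\<in>Basis. \<bar>c b\<bar>) = \<bar>det A\<bar>"
        by (subst prod_Basis_vec) (simp add: c det abs_prod)
      ultimately have "lborel = density (distr lborel borel ((*v) A)) (\<lambda>_. ennreal \<bar>det A\<bar>)"
        using lborel_affine_euclidean[of c 0] by simp
      then have "(\<integral>\<^sup>+y. f y \<partial>lborel) = (\<integral>\<^sup>+y. f y \<partial>density (distr lborel borel ((*v) A)) (\<lambda>_. ennreal \<bar>det A\<bar>))"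
        by simp
      also have "\<dots> = ennreal \<bar>det A\<bar> * (\<integral>\<^sup>+y. f (A *v y) \<partial>lborel)"
        by (subst nn_integral_density) (auto simp: nn_integral_cmult nn_integral_distr)
      finally show "ennreal \<bar>det A\<bar> * (\<integral>\<^sup>+y. f (A *v y) \<partial>lborel) = (\<integral>\<^sup>+y. f y \<partial>lborel)" ..
    qed
  next
    fix m n :: 'n assume "m \<noteq> n"
    let ?t = "Transposition.transpose m n"
    let ?A = "(\<chi> i j. mat 1 $ i $ ?t j) :: real^'n^'n"
    have A: "?A *v y = (\<chi> i. y $ ?t i)" for y
    proof (simp add: vec_eq_iff matrix_vector_mult_def mat_def, intro allI)
      fix i
      have "(\<Sum>j\<in>UNIV. (if i = ?t j then 1 else 0) * y $ j) = (\<Sum>j\<in>UNIV. if j = ?t i then y $ j else 0)"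
        by (rule sum.cong) (auto simp: transpose_involutory)
      then show "(\<Sum>j\<in>UNIV. (if i = ?t j then 1 else 0) * y $ j) = y $ ?t i" by simp
    qed
    have det: "\<bar>det ?A\<bar> = 1"
      by (subst det_permute_columns) (auto simp: permutes_swap_id sign_swap_id abs_mult)
    have "lborel = distr lborel borel ((*v) ?A)"
    proof (rule lborel_eqI)
      fix l u :: "real^'n" assume le: "\<And>b. b \<in> Basis \<Longrightarrow> l \<bullet> b \<le> u \<bullet> b"
      have le': "l $ i \<le> u $ i" for i using le[of "axis i 1"] by (auto simp: Basis_vec_def inner_axis)
      have "emeasure (distr lborel borel ((*v) ?A)) (box l u) = emeasure lborel (box (\<chi> i. l $ ?t i) (\<chi> i. u $ ?t i))"
        by (subst emeasure_distr) (auto intro!: arg_cong[where f="emeasure _"] simp: A mem_box_cart,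
           (metis transpose_involutory)+)
      also have "\<dots> = (\<Prod>i\<in>UNIV. ennreal (u $ ?t i - l $ ?t i))"
      proof -
        have "emeasure lborel (box (\<chi> i. l $ ?t i) (\<chi> i. u $ ?t i)) =
            ennreal (\<Prod>b\<in>Basis. ((\<chi> i. u $ ?t i) - (\<chi> i. l $ ?t i)) \<bullet> b)"
          by (rule emeasure_lborel_box) (auto simp: Basis_vec_def inner_axis le')
        then show ?thesis using le' by (simp add: prod_Basis_vec inner_axis prod_ennreal)
      qed
      also have "\<dots> = (\<Prod>i\<in>UNIV. ennreal (u $ i - l $ i))"
        by (rule prod.reindex_bij_betw) simp
      also have "\<dots> = ennreal (\<Prod>b\<in>Basis. (u - l) \<bullet> b)"
        using le' by (simp add: prod_Basis_vec inner_axis prod_ennreal)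
      finally show "emeasure (distr lborel borel ((*v) ?A)) (box l u) = ennreal (\<Prod>b\<in>Basis. (u - l) \<bullet> b)" .
    qed simp
    then have "(\<integral>\<^sup>+y. f (?A *v y) \<partial>lborel) = (\<integral>\<^sup>+y. f y \<partial>lborel)"
      if "f \<in> borel_measurable borel" for f :: "real^'n \<Rightarrow> ennreal"
      using nn_integral_distr[of "(*v) ?A" lborel borel f] that by simp
    then show "P ?A" unfolding P_def det ennreal_1 mult_1 by blast
  next
    fix m n :: 'n assume "m \<noteq> n"
    let ?A = "(\<chi> i j. of_bool (i = m \<and> j = n \<or> i = j)) :: real^'n^'n"
    have A: "?A *v y = (\<chi> i. if i = m then y $ m + y $ n else y $ i)" for y
    proof (subst vec_eq_iff, intro allI)
      fix i
      have "(?A *v y) $ i = (\<Sum>j\<in>UNIV. (if j = i then y $ j else 0) + (if i = m then if j = n then y $ j else 0 else 0))"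
        unfolding matrix_vector_mult_def using \<open>m \<noteq> n\<close> by (simp, intro sum.cong) auto
      then show "(?A *v y) $ i = (\<chi> i. if i = m then y $ m + y $ n else y $ i) $ i"
        by (simp add: sum.distrib)
    qed
    have det: "det ?A = 1"
    proof -
      have "?A = (\<chi> k. if k = m then row m (mat 1) + 1 *s row n (mat 1) else row k (mat 1))"
        using \<open>m \<noteq> n\<close> by (auto simp: vec_eq_iff row_def mat_def)
      then show ?thesis using det_row_operation[OF \<open>m \<noteq> n\<close>, of "mat 1 :: real^'n^'n" 1] by simp
    qed
    have "(\<integral>\<^sup>+y. f (?A *v y) \<partial>lborel) = (\<integral>\<^sup>+y. f y \<partial>lborel)"
      if [measurable]: "f \<in> borel_measurable borel" for f :: "real^'n \<Rightarrow> ennreal"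
    proof -
      interpret product_sigma_finite "\<lambda>_::'n. lborel :: real measure" by standard
      \<comment> \<open>With the other coordinates fixed, the shear merely translates coordinate
        \<open>m\<close>; Fubini splits off that coordinate and translation invariance
        finishes.\<close>
      let ?I = "UNIV - {m}"
      have U: "insert m ?I = UNIV" by auto
      have [measurable]: "(\<lambda>r. \<chi> i. r i) \<in> measurable (\<Pi>\<^sub>M i\<in>(UNIV::'n set). (lborel :: real measure)) borel"
        using measurable_vec_lambda_PiM[where 'n='n and 'a=real]
        by (subst measurable_cong_sets[OF sets_PiM_cong refl]) (auto)
      have ins: "(\<integral>\<^sup>+r. h r \<partial>(\<Pi>\<^sub>M i\<in>UNIV. lborel)) = (\<integral>\<^sup>+x. (\<integral>\<^sup>+t. h (x(m := t)) \<partial>lborel) \<partial>(\<Pi>\<^sub>M i\<in>?I. lborel))"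
        if "h \<in> borel_measurable (\<Pi>\<^sub>M i\<in>UNIV. lborel)" for h :: "('n \<Rightarrow> real) \<Rightarrow> ennreal"
        using product_nn_integral_insert[of ?I m h] that by (simp add: U)
      have "(\<integral>\<^sup>+y. f (?A *v y) \<partial>lborel) = (\<integral>\<^sup>+x. (\<integral>\<^sup>+t. f (?A *v (\<chi> i. (x(m := t)) i)) \<partial>lborel) \<partial>(\<Pi>\<^sub>M i\<in>?I. lborel))"
        by (subst nn_integral_lborel_vec, simp, subst ins) (auto)
      also have "\<dots> = (\<integral>\<^sup>+x. (\<integral>\<^sup>+t. f (\<chi> i. (x(m := t)) i) \<partial>lborel) \<partial>(\<Pi>\<^sub>M i\<in>?I. lborel))"
      proof (rule nn_integral_cong)
        fix x :: "'n \<Rightarrow> real"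
        have "(\<lambda>t. \<chi> i. (x(m := t)) i) \<in> borel_measurable borel"
          by (subst borel_measurable_euclidean_space) (auto simp: Basis_vec_def inner_axis)
        then have [measurable]: "(\<lambda>t. f (\<chi> i. (x(m := t)) i)) \<in> borel_measurable borel" by measurable
        have "?A *v (\<chi> i. (x(m := t)) i) = (\<chi> i. (x(m := x n + t)) i)" for t
          unfolding A using \<open>m \<noteq> n\<close> by (auto simp: vec_eq_iff)
        then have "(\<integral>\<^sup>+t. f (?A *v (\<chi> i. (x(m := t)) i)) \<partial>lborel) = (\<integral>\<^sup>+t. f (\<chi> i. (x(m := x n + t)) i) \<partial>lborel)"
          by simp
        also have "\<dots> = (\<integral>\<^sup>+t. f (\<chi> i. (x(m := t)) i) \<partial>distr lborel borel ((+) (x n)))"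
          by (subst nn_integral_distr) auto
        finally show "(\<integral>\<^sup>+t. f (?A *v (\<chi> i. (x(m := t)) i)) \<partial>lborel) = (\<integral>\<^sup>+t. f (\<chi> i. (x(m := t)) i) \<partial>lborel)"
          by (simp add: lborel_distr_plus)
      qed
      also have "\<dots> = (\<integral>\<^sup>+y. f y \<partial>lborel)"
        by (subst nn_integral_lborel_vec, simp, subst ins) (auto)
      finally show ?thesis .
    qed
    then show "P ?A" unfolding P_def det abs_one ennreal_1 mult_1 by blast
  qed
  with assms show ?thesis unfolding P_def by blast
qed


section \<open>Gaussian integrals and normal densities\<close>

lemma nn_integral_exp_half_square:
  "(\<integral>\<^sup>+x. ennreal (exp (- x\<^sup>2 / 2)) \<partial>lborel) = ennreal (sqrt (2 * pi))"
proof -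
  have "(\<integral>\<^sup>+x. ennreal (std_normal_density x) \<partial>lborel) = 1"
    using prob_space.emeasure_space_1[OF prob_space_normal_density[of 1 0]]
    by (simp add: emeasure_density)
  then have "ennreal (sqrt (2 * pi)) * 1 = ennreal (sqrt (2 * pi)) * (\<integral>\<^sup>+x. ennreal (std_normal_density x) \<partial>lborel)"
    by simp
  also have "\<dots> = (\<integral>\<^sup>+x. ennreal (sqrt (2 * pi)) * ennreal (std_normal_density x) \<partial>lborel)"
    by (rule nn_integral_cmult[symmetric]) simp
  also have "\<dots> = (\<integral>\<^sup>+x. ennreal (exp (- x\<^sup>2 / 2)) \<partial>lborel)"
    by (intro nn_integral_cong) (simp add: std_normal_density_def ennreal_mult[symmetric])
  finally show ?thesis by simp
qed

lemma nn_integral_exp_half_inner: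
  "(\<integral>\<^sup>+z. ennreal (exp (- (z \<bullet> z) / 2)) \<partial>(lborel :: 'a::euclidean_space measure)) = ennreal (sqrt (2 * pi) ^ DIM('a))"
proof -
  have "exp (- (z \<bullet> z) / 2) = (\<Prod>b\<in>Basis. exp (- (z \<bullet> b)\<^sup>2 / 2))" for z :: 'a
    by (subst euclidean_inner) (simp add: exp_sum[symmetric] sum_negf sum_divide_distrib power2_eq_square)
  then have "(\<integral>\<^sup>+z. ennreal (exp (- (z \<bullet> z) / 2)) \<partial>(lborel :: 'a measure)) =
      (\<integral>\<^sup>+z. (\<Prod>b\<in>Basis. ennreal (exp (- (z \<bullet> b)\<^sup>2 / 2))) \<partial>(lborel :: 'a measure))"
    by (simp add: prod_ennreal)
  also have "\<dots> = (\<Prod>b\<in>(Basis :: 'a set). ennreal (sqrt (2 * pi)))"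
    by (subst nn_integral_lborel_prod) (simp_all add: nn_integral_exp_half_square[simplified])
  finally show ?thesis by (simp add: ennreal_power)
qed

lemma borel_measurable_mv_normal_density [measurable]:
  "mv_normal_density \<mu> \<Sigma> \<in> borel_measurable borel"
proof -
  have "(\<lambda>y. matrix_inv \<Sigma> *v (y - \<mu>)) \<in> borel_measurable borel"
    by (rule measurable_compose[OF _ borel_measurable_matrix_vector_mult]) simp
  then show ?thesis unfolding mv_normal_density_def by measurable
qed

lemma mv_normal_density_nonneg: "pos_def \<Sigma> \<Longrightarrow> 0 \<le> mv_normal_density \<mu> \<Sigma> y"
  using pos_def_det_pos[of \<Sigma>] by (simp add: mv_normal_density_def)

text \<open>The substitution y = mu + B z with B^T Sigma^-1 B = I turns the exponent into - z^T z /
  2. Its Jacobian |det B| is the square root of det Sigma and cancels the normalising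
  factor.\<close>

lemma prob_space_mv_normal:
  fixes \<Sigma> :: "real^'p^'p"
  assumes "pos_def \<Sigma>"
  shows "prob_space (mv_normal \<mu> \<Sigma>)"
proof
  let ?Om = "matrix_inv \<Sigma>" and ?c = "sqrt ((2 * pi) ^ CARD('p) * det \<Sigma>)"
  let ?f = "\<lambda>y. ennreal (exp (- (y \<bullet> (?Om *v y)) / 2) / ?c)"
  have dS: "0 < det \<Sigma>" by (rule pos_def_det_pos[OF assms])
  obtain B :: "real^'p^'p" where B: "transpose B ** ?Om ** B = mat 1"
    by (rule pos_def_obtain_orthonormal[OF pos_def_matrix_inv[OF assms]])
  have "det (transpose B ** ?Om ** B) = 1" "det \<Sigma> * det ?Om = 1"
    using B matrix_inv_inverse(1)[of \<Sigma>] dS by (simp, metis det_I det_mul less_irrefl)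
  then have d: "(det B)\<^sup>2 * det ?Om = 1" "det \<Sigma> * det ?Om = 1" by (simp_all add: det_mul power2_eq_square mult_ac)
  then have "det ?Om \<noteq> 0" "det B \<noteq> 0" by auto
  with d have dB: "(det B)\<^sup>2 = det \<Sigma>" by (metis mult_right_cancel)
  have q: "(B *v z) \<bullet> (?Om *v (B *v z)) = z \<bullet> z" for z
  proof -
    have "(B *v z) \<bullet> (?Om *v (B *v z)) = z \<bullet> ((transpose B ** ?Om ** B) *v z)"
      using inner_matrix_vector_transpose[of z "transpose B" "?Om *v (B *v z)"]
      by (simp only: matrix_vector_mul_assoc transpose_transpose matrix_mul_assoc)
    then show ?thesis by (simp add: B)
  qed
  have [measurable]: "?f \<in> borel_measurable borel"
    by (intro measurable_compose[OF _ measurable_ennreal] borel_measurable_divide borel_measurable_exp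
        borel_measurable_uminus borel_measurable_inner borel_measurable_const measurable_ident_sets borel_measurable_matrix_vector_mult) simp
  have "emeasure (mv_normal \<mu> \<Sigma>) (space (mv_normal \<mu> \<Sigma>)) = (\<integral>\<^sup>+y. ?f (- \<mu> + y) \<partial>lborel)"
    by (simp add: mv_normal_def emeasure_density mv_normal_density_def)
  also have "\<dots> = (\<integral>\<^sup>+y. ?f y \<partial>distr lborel borel ((+) (- \<mu>)))"
    by (subst nn_integral_distr) auto
  also have "\<dots> = (\<integral>\<^sup>+y. ?f y \<partial>lborel)" by (simp only: lborel_distr_plus)
  also have "\<dots> = ennreal \<bar>det B\<bar> * (\<integral>\<^sup>+z. ?f (B *v z) \<partial>lborel)"
    by (rule nn_integral_lborel_matrix[symmetric]) (use \<open>det B \<noteq> 0\<close> in auto)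
  also have "(\<integral>\<^sup>+z. ?f (B *v z) \<partial>lborel) = (\<integral>\<^sup>+z. ennreal (1 / ?c) * ennreal (exp (- (z \<bullet> z) / 2)) \<partial>(lborel :: (real^'p) measure))"
  proof (rule nn_integral_cong)
    fix z show "?f (B *v z) = ennreal (1 / ?c) * ennreal (exp (- (z \<bullet> z) / 2))"
      using dS unfolding q by (simp add: ennreal_mult[symmetric])
  qed
  also have "\<dots> = ennreal (1 / ?c) * ennreal (sqrt (2 * pi) ^ CARD('p))"
    using nn_integral_exp_half_inner[where 'a="real^'p"] by (subst nn_integral_cmult) simp_all
  also have "ennreal \<bar>det B\<bar> * \<dots> = ennreal (\<bar>det B\<bar> * ((1 / ?c) * sqrt (2 * pi) ^ CARD('p)))"
  proof -
    have nn: "0 \<le> 1 / ?c" "0 \<le> sqrt (2 * pi) ^ CARD('p)" using dS by simp_all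
    show ?thesis
      by (simp only: ennreal_mult[symmetric, OF nn] ennreal_mult[symmetric, OF abs_ge_zero mult_nonneg_nonneg[OF nn]])
  qed
  also have "\<bar>det B\<bar> * ((1 / ?c) * sqrt (2 * pi) ^ CARD('p)) = 1"
  proof -
    have "?c = sqrt (2 * pi) ^ CARD('p) * \<bar>det B\<bar>"
      unfolding dB[symmetric] by (simp only: real_sqrt_mult[of "_ ^ CARD('p)"] real_sqrt_abs real_sqrt_power[of _ "CARD('p)"])
    then show ?thesis using \<open>det B \<noteq> 0\<close> by simp
  qed
  finally show "emeasure (mv_normal \<mu> \<Sigma>) (space (mv_normal \<mu> \<Sigma>)) = 1" by simp
qed

text \<open>This is tr (Omega Z^T Z), written by rows to match the product of the row
  densities.\<close>

definition row_quad :: "real^'p^'p \<Rightarrow> real^'p^'n \<Rightarrow> real" where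
  "row_quad \<Omega> Z = (\<Sum>i\<in>UNIV. Z $ i \<bullet> (\<Omega> *v Z $ i))"

definition matrix_normal_density :: "real^'p^'n \<Rightarrow> real^'p^'p \<Rightarrow> real^'p^'n \<Rightarrow> real" where
  "matrix_normal_density M \<Sigma> Y = (\<Prod>i\<in>UNIV. mv_normal_density (M $ i) \<Sigma> (Y $ i))"

lemma matrix_normal_density_exp:
  fixes M :: "real^'p^'n"
  shows "matrix_normal_density M \<Sigma> Y =
    exp (- row_quad (matrix_inv \<Sigma>) (Y - M) / 2) / sqrt ((2 * pi) ^ CARD('p) * det \<Sigma>) ^ CARD('n)"
  by (simp add: matrix_normal_density_def mv_normal_density_def row_quad_def prod_dividef
      exp_sum[symmetric] sum_negf sum_divide_distrib)

lemma borel_measurable_vec_nth [measurable]: "(\<lambda>Y :: 'a::euclidean_space^'n. Y $ i) \<in> borel_measurable borel"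
  by (intro borel_measurable_continuous_onI continuous_intros)

lemma borel_measurable_matrix_normal_density [measurable]:
  "matrix_normal_density M \<Sigma> \<in> borel_measurable borel"
  unfolding matrix_normal_density_def by measurable

lemma matrix_normal_density_nonneg: "pos_def \<Sigma> \<Longrightarrow> 0 \<le> matrix_normal_density M \<Sigma> Y"
  unfolding matrix_normal_density_def by (intro prod_nonneg mv_normal_density_nonneg ballI)

text \<open>Rectangles determine the product of the row laws. Afterwards the law is a single
  Lebesgue density on matrices, the form in which integration by parts is carried out.\<close>

lemma matrix_normal_eq_density:
  fixes M :: "real^'p^'n"
  assumes "pos_def \<Sigma>"
  shows "matrix_normal M \<Sigma> = density lborel (\<lambda>Y. ennreal (matrix_normal_density M \<Sigma> Y))"
proof -
  let ?N = "\<lambda>i::'n. mv_normal (M $ i) \<Sigma>"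
  let ?L = "\<Pi>\<^sub>M i\<in>(UNIV::'n set). (lborel :: (real^'p) measure)"
  let ?f = "\<lambda>r. ennreal (\<Prod>i\<in>UNIV. mv_normal_density (M $ i) \<Sigma> (r i))"
  have [measurable]: "(\<lambda>r. \<chi> i. r i) \<in> measurable ?L borel"
    using measurable_vec_lambda_PiM[where 'n='n and 'a="real^'p"]
    by (subst measurable_cong_sets[OF sets_PiM_cong refl]) (auto)
  interpret L: product_sigma_finite "\<lambda>_::'n. lborel :: (real^'p) measure" by standard
  interpret N: product_sigma_finite ?N
    unfolding product_sigma_finite_def
    using prob_space_mv_normal[OF assms] prob_space_imp_sigma_finite by blast
  have sN: "sets (?N i) = sets borel" for i by (simp add: mv_normal_def)
  have fm [measurable]: "?f \<in> borel_measurable ?L" by measurable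
  have "density ?L ?f = (\<Pi>\<^sub>M i\<in>UNIV. ?N i)"
  proof (rule N.PiM_eqI)
    show "sets (density ?L ?f) = sets (\<Pi>\<^sub>M i\<in>UNIV. ?N i)"
      unfolding sets_density by (rule sets_PiM_cong) (simp_all add: sN)
    fix A :: "'n \<Rightarrow> (real^'p) set" assume "\<And>i. i \<in> UNIV \<Longrightarrow> A i \<in> sets (?N i)"
    then have A [measurable]: "A i \<in> sets borel" for i by (simp add: sN)
    have "emeasure (density ?L ?f) (Pi\<^sub>E UNIV A) = (\<integral>\<^sup>+r. ?f r * indicator (Pi\<^sub>E UNIV A) r \<partial>?L)"
      by (rule emeasure_density[OF fm]) (auto intro!: sets_PiM_I_finite)
    also have "\<dots> = (\<integral>\<^sup>+r. (\<Prod>i\<in>UNIV. ennreal (mv_normal_density (M $ i) \<Sigma> (r i)) * indicator (A i) (r i)) \<partial>?L)"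
    proof (rule nn_integral_cong)
      fix r :: "'n \<Rightarrow> real^'p"
      have "(indicator (Pi\<^sub>E UNIV A) r :: ennreal) = (\<Prod>i\<in>UNIV. indicator (A i) (r i))"
        by (auto simp: indicator_def PiE_def Pi_def extensional_def prod_zero_iff intro!: prod.neutral[symmetric])
      then show "?f r * indicator (Pi\<^sub>E UNIV A) r = (\<Prod>i\<in>UNIV. ennreal (mv_normal_density (M $ i) \<Sigma> (r i)) * indicator (A i) (r i))"
        by (simp add: prod.distrib prod_ennreal mv_normal_density_nonneg[OF assms])
    qed
    also have "\<dots> = (\<Prod>i\<in>UNIV. \<integral>\<^sup>+y. ennreal (mv_normal_density (M $ i) \<Sigma> y) * indicator (A i) y \<partial>lborel)"
      by (rule L.product_nn_integral_prod) auto
    also have "\<dots> = (\<Prod>i\<in>UNIV. emeasure (?N i) (A i))"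
      by (simp add: mv_normal_def emeasure_density)
    finally show "emeasure (density ?L ?f) (Pi\<^sub>E UNIV A) = (\<Prod>i\<in>UNIV. emeasure (?N i) (A i))" .
  qed simp
  then have "matrix_normal M \<Sigma> = distr (density ?L ?f) borel (\<lambda>r. \<chi> i. r i)"
    by (simp add: matrix_normal_def)
  also have "\<dots> = density (distr ?L borel (\<lambda>r. \<chi> i. r i)) (\<lambda>Y. ennreal (matrix_normal_density M \<Sigma> Y))"
    by (subst density_distr) (auto simp: matrix_normal_density_def)
  finally show ?thesis by (simp only: lborel_vec)
qed

lemma sets_matrix_normal [simp, measurable_cong]: "sets (matrix_normal M \<Sigma>) = sets borel"
  and space_matrix_normal [simp]: "space (matrix_normal M \<Sigma>) = UNIV"
  by (simp_all add: matrix_normal_def)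

lemma prob_space_matrix_normal:
  assumes "pos_def \<Sigma>" shows "prob_space (matrix_normal M \<Sigma>)"
  unfolding matrix_normal_def
proof (rule prob_space.prob_space_distr)
  show "prob_space (\<Pi>\<^sub>M i\<in>UNIV. mv_normal (M $ i) \<Sigma>)"
    by (intro prob_space_PiM prob_space_mv_normal assms)
  show "(\<lambda>r. \<chi> i. r i) \<in> measurable (\<Pi>\<^sub>M i\<in>UNIV. mv_normal (M $ i) \<Sigma>) borel"
    using measurable_vec_lambda_PiM
    by (subst measurable_cong_sets[OF sets_PiM_cong refl]) (auto simp: mv_normal_def)
qed

lemma integrable_matrix_normal_iff:
  fixes g :: "real^'p^'n \<Rightarrow> real"
  assumes "pos_def \<Sigma>" and [measurable]: "g \<in> borel_measurable borel"
  shows "integrable (matrix_normal M \<Sigma>) g \<longleftrightarrow> integrable lborel (\<lambda>Y. matrix_normal_density M \<Sigma> Y * g Y)"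
  unfolding matrix_normal_eq_density[OF assms(1)]
  by (subst integrable_density) (auto simp: matrix_normal_density_nonneg[OF assms(1)])

lemma integral_matrix_normal:
  fixes g :: "real^'p^'n \<Rightarrow> real"
  assumes "pos_def \<Sigma>" and [measurable]: "g \<in> borel_measurable borel"
  shows "(\<integral>Y. g Y \<partial>matrix_normal M \<Sigma>) = (\<integral>Y. matrix_normal_density M \<Sigma> Y * g Y \<partial>lborel)"
  unfolding matrix_normal_eq_density[OF assms(1)]
  by (subst integral_density) (auto simp: matrix_normal_density_nonneg[OF assms(1)])

section \<open>Moments and Stein's identity\<close>

lemma norm_matrix_sq: "(norm Z)\<^sup>2 = (\<Sum>i\<in>UNIV. Z $ i \<bullet> Z $ i)" for Z :: "real^'p^'n"
  by (simp add: power2_norm_eq_inner inner_vec_def)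

lemma row_quad_lower_bound:
  fixes \<Omega> :: "real^'p^'p"
  assumes "pos_def \<Omega>"
  obtains l where "0 < l" "\<And>Z :: real^'p^'n. l * (norm Z)\<^sup>2 \<le> row_quad \<Omega> Z"
proof -
  obtain l where l: "0 < l" "\<And>z. l * (z \<bullet> z) \<le> z \<bullet> (\<Omega> *v z)"
    by (rule pos_def_lower_bound[OF assms]) blast
  have "l * (norm Z)\<^sup>2 \<le> row_quad \<Omega> Z" for Z :: "real^'p^'n"
    unfolding norm_matrix_sq row_quad_def sum_distrib_left by (intro sum_mono l)
  with l(1) show thesis by (rule that)
qed

lemma pos_def_scaleR:
  assumes "pos_def S" "0 < c"
  shows "pos_def (c *\<^sub>R S)"
  using assms
  by (auto simp: pos_def_def transpose_def vec_eq_iff scaleR_matrix_vector_assoc[symmetric])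

lemma matrix_inv_scaleR:
  fixes S :: "real^'n^'n"
  assumes "det S \<noteq> 0" "c \<noteq> 0"
  shows "matrix_inv (c *\<^sub>R S) = (1 / c) *\<^sub>R matrix_inv S"
proof (rule matrix_inv_eqI(1))
  interpret mm: bounded_bilinear "\<lambda>(A::real^'n^'n) (B::real^'n^'n). A ** B"
    by (rule bounded_bilinear_matrix_mult)
  show "(c *\<^sub>R S) ** ((1 / c) *\<^sub>R matrix_inv S) = mat 1"
    using assms(2) by (simp add: mm.scaleR_left mm.scaleR_right matrix_inv_inverse[OF assms(1)])
qed

lemma power_le_fact_exp:
  fixes x :: real
  assumes "0 \<le> x"
  shows "x ^ k \<le> fact k * exp x"
proof -
  have "x ^ k /\<^sub>R fact k \<le> (\<Sum>n. x ^ n /\<^sub>R fact n)"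
  proof -
    have "(\<Sum>n\<in>{k}. x ^ n /\<^sub>R fact n) \<le> (\<Sum>n. x ^ n /\<^sub>R fact n)"
      by (rule sum_le_suminf[OF summable_exp_generic]) (use assms in auto)
    then show ?thesis by simp
  qed
  then show ?thesis by (simp add: exp_def field_simps)
qed

text \<open>Half of the Gaussian exponent absorbs the polynomial. The other half is, up to a
  constant, the density with covariance \<open>2 *\<^sub>R \<Sigma>\<close>, which is integrable as
  a probability density.\<close>

lemma integrable_matrix_normal_poly:
  fixes g :: "real^'p^'n \<Rightarrow> real"
  assumes pd: "pos_def \<Sigma>" and [measurable]: "g \<in> borel_measurable borel"
    and bd: "\<And>Y. \<bar>g Y\<bar> \<le> C * (1 + norm Y) ^ k"
  shows "integrable (matrix_normal M \<Sigma>) g"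
proof -
  let ?Om = "matrix_inv \<Sigma>"
  have pd2: "pos_def (2 *\<^sub>R \<Sigma>)" by (rule pos_def_scaleR[OF pd]) simp
  define Z where "Z S = sqrt ((2 * pi) ^ CARD('p) * det S) ^ CARD('n)" for S :: "real^'p^'p"
  have Z: "0 < Z \<Sigma>" "0 < Z (2 *\<^sub>R \<Sigma>)"
    using pos_def_det_pos[OF pd] pos_def_det_pos[OF pd2] by (simp_all add: Z_def)
  obtain l where l: "0 < l" "\<And>Z :: real^'p^'n. l * (norm Z)\<^sup>2 \<le> row_quad ?Om Z"
    by (rule row_quad_lower_bound[OF pos_def_matrix_inv[OF pd]]) blast
  let ?d = "matrix_normal_density M \<Sigma>" and ?d2 = "matrix_normal_density M (2 *\<^sub>R \<Sigma>)"
  let ?q = "\<lambda>Y. row_quad ?Om (Y - M)"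
  have d: "?d Y = exp (- ?q Y / 4) * (Z (2 *\<^sub>R \<Sigma>) / Z \<Sigma>) * ?d2 Y" for Y
  proof -
    have "row_quad (matrix_inv (2 *\<^sub>R \<Sigma>)) (Y - M) = ?q Y / 2"
      by (simp add: matrix_inv_scaleR pos_def_det_nz[OF pd] row_quad_def scaleR_matrix_vector_assoc[symmetric] sum_divide_distrib)
    then have d2: "?d2 Y = exp (- (?q Y / 2) / 2) / Z (2 *\<^sub>R \<Sigma>)"
      unfolding Z_def matrix_normal_density_exp by simp
    have d1: "?d Y = exp (- ?q Y / 2) / Z \<Sigma>"
      unfolding Z_def by (rule matrix_normal_density_exp)
    have "exp (- ?q Y / 2) = exp (- ?q Y / 4) * exp (- ?q Y / 4)"
      by (simp add: exp_add[symmetric])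
    then show ?thesis using Z unfolding d1 d2 by simp
  qed
  define a where "a = 1 + norm M"
  define C2 where "C2 = \<bar>C\<bar> * (fact k * exp (a + 1 / l)) * (Z (2 *\<^sub>R \<Sigma>) / Z \<Sigma>)"
  have main: "\<bar>?d Y * g Y\<bar> \<le> C2 * ?d2 Y" for Y
  proof -
    define r where "r = norm (Y - M)"
    have ar: "1 + norm Y \<le> a + r" using norm_triangle_ineq[of "Y - M" M] by (simp add: a_def r_def)
    \<comment> \<open>Completing the square: linear growth in the exponent is outweighed by the
      spare quadratic part, whose size \<open>l\<close> bounds from below.\<close>
    have "r \<le> 1 / l + l * r\<^sup>2 / 4"
    proof -
      have "0 \<le> (l * r / 2 - 1)\<^sup>2 / l" using l(1) by simp
      also have "(l * r / 2 - 1)\<^sup>2 / l = 1 / l + l * r\<^sup>2 / 4 - r"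
        using l(1) by (simp add: power2_eq_square field_simps)
      finally show ?thesis by simp
    qed
    also have "l * r\<^sup>2 / 4 \<le> ?q Y / 4" using l(2)[of "Y - M"] by (simp add: r_def)
    finally have rr: "a + r - ?q Y / 4 \<le> a + 1 / l" by simp
    have "\<bar>g Y\<bar> * exp (- ?q Y / 4) \<le> \<bar>C\<bar> * (1 + norm Y) ^ k * exp (- ?q Y / 4)"
      using bd[of Y] abs_ge_self[of C] by (intro mult_right_mono order_trans[OF bd]) auto
    also have "\<dots> \<le> \<bar>C\<bar> * (fact k * exp (a + r)) * exp (- ?q Y / 4)"
    proof (intro mult_right_mono mult_left_mono)
      have "(1 + norm Y) ^ k \<le> (a + r) ^ k" by (intro power_mono ar) simp
      also have "\<dots> \<le> fact k * exp (a + r)" by (rule power_le_fact_exp) (simp add: a_def r_def)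
      finally show "(1 + norm Y) ^ k \<le> fact k * exp (a + r)" .
    qed auto
    also have "\<dots> = \<bar>C\<bar> * (fact k * exp (a + r - ?q Y / 4))" by (simp add: exp_add[symmetric])
    also have "\<dots> \<le> \<bar>C\<bar> * (fact k * exp (a + 1 / l))" using rr by (intro mult_left_mono) auto
    finally have *: "\<bar>g Y\<bar> * exp (- ?q Y / 4) \<le> \<bar>C\<bar> * (fact k * exp (a + 1 / l))" .
    have nn: "0 \<le> ?d2 Y" by (rule matrix_normal_density_nonneg[OF pd2])
    have "\<bar>?d Y * g Y\<bar> = (\<bar>g Y\<bar> * exp (- ?q Y / 4)) * ((Z (2 *\<^sub>R \<Sigma>) / Z \<Sigma>) * ?d2 Y)"
      unfolding d using nn Z by (simp add: abs_mult)
    also have "\<dots> \<le> (\<bar>C\<bar> * (fact k * exp (a + 1 / l))) * ((Z (2 *\<^sub>R \<Sigma>) / Z \<Sigma>) * ?d2 Y)"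
      using * nn Z by (intro mult_right_mono) auto
    finally show ?thesis by (simp add: C2_def mult.assoc)
  qed
  interpret pr: prob_space "matrix_normal M (2 *\<^sub>R \<Sigma>)" by (rule prob_space_matrix_normal[OF pd2])
  have "integrable (matrix_normal M (2 *\<^sub>R \<Sigma>)) (\<lambda>_. 1 :: real)" by simp
  then have "integrable lborel ?d2" using integrable_matrix_normal_iff[OF pd2, of "\<lambda>_. 1" M] by simp
  then have "integrable lborel (\<lambda>Y. C2 * ?d2 Y)" by simp
  then have "integrable lborel (\<lambda>Y. ?d Y * g Y)"
    by (rule Bochner_Integration.integrable_bound) (use main in \<open>auto intro: order_trans[OF _ abs_ge_self]\<close>)
  then show ?thesis by (simp add: integrable_matrix_normal_iff[OF pd])
qed

text \<open>Translation invariance gives \<open>\<integral> F (x + E) - F x = 0\<close>, and Fubini turns the integrand into the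
  derivative integrated over a unit segment; no continuity of the derivative is required.\<close>

lemma integral_directional_derivative_eq_0:
  fixes F :: "'a::euclidean_space \<Rightarrow> real"
  assumes F: "integrable lborel F" and F': "integrable lborel F'"
    and deriv: "\<And>x. ((\<lambda>t. F (x + t *\<^sub>R E)) has_real_derivative F' x) (at 0)"
  shows "(\<integral>x. F' x \<partial>lborel) = 0"
proof -
  have [measurable]: "F \<in> borel_measurable borel" "F' \<in> borel_measurable borel"
    using F F' by auto
  have transl: "integrable lborel (\<lambda>x. f (x + c))" "(\<integral>x. f (x + c) \<partial>lborel) = (\<integral>x. f x \<partial>lborel)"
    if f: "integrable lborel f" for f :: "'a \<Rightarrow> real" and c
  proof -
    have [measurable]: "f \<in> borel_measurable borel" using f by auto
    have "integrable (distr lborel borel ((+) c)) f" using f by (simp add: lborel_distr_plus)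
    then show "integrable lborel (\<lambda>x. f (x + c))" by (simp add: integrable_distr_eq add.commute)
    have "(\<integral>x. f x \<partial>distr lborel borel ((+) c)) = (\<integral>x. f (c + x) \<partial>lborel)"
      by (rule integral_distr) auto
    then show "(\<integral>x. f (x + c) \<partial>lborel) = (\<integral>x. f x \<partial>lborel)" by (simp add: lborel_distr_plus add.commute)
  qed
  define G where "G = (\<lambda>(x, t::real). indicator {0..1} t * F' (x + t *\<^sub>R E))"
  have Gm [measurable]: "G \<in> borel_measurable (lborel \<Otimes>\<^sub>M lborel)"
    unfolding G_def by measurable
  have "(\<integral>\<^sup>+z. norm (G z) \<partial>(lborel \<Otimes>\<^sub>M lborel)) = (\<integral>\<^sup>+t. (\<integral>\<^sup>+x. norm (G (x, t)) \<partial>lborel) \<partial>lborel)"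
    by (rule lborel_pair.nn_integral_snd[symmetric]) simp
  also have "\<dots> = (\<integral>\<^sup>+t. indicator {0..1::real} t * (\<integral>\<^sup>+x. norm (F' x) \<partial>lborel) \<partial>lborel)"
  proof (rule nn_integral_cong)
    fix t :: real
    have "(\<integral>\<^sup>+x. norm (G (x, t)) \<partial>lborel) = (\<integral>\<^sup>+x. indicator {0..1} t * ennreal (norm (F' (x + t *\<^sub>R E))) \<partial>lborel)"
      by (intro nn_integral_cong) (auto simp: G_def indicator_def)
    also have "\<dots> = indicator {0..1} t * (\<integral>\<^sup>+x. ennreal (norm (F' (t *\<^sub>R E + x))) \<partial>lborel)"
      by (subst nn_integral_cmult) (auto simp: add.commute)
    also have "(\<integral>\<^sup>+x. ennreal (norm (F' (t *\<^sub>R E + x))) \<partial>lborel) = (\<integral>\<^sup>+x. ennreal (norm (F' x)) \<partial>distr lborel borel ((+) (t *\<^sub>R E)))"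
      by (subst nn_integral_distr) auto
    finally show "(\<integral>\<^sup>+x. norm (G (x, t)) \<partial>lborel) = indicator {0..1} t * (\<integral>\<^sup>+x. norm (F' x) \<partial>lborel)"
      by (simp add: lborel_distr_plus)
  qed
  also have "\<dots> = (\<integral>\<^sup>+x. norm (F' x) \<partial>lborel)"
    by (simp add: nn_integral_multc)
  also have "\<dots> < \<infinity>" using F' by (simp add: integrable_iff_bounded)
  finally have intG: "integrable (lborel \<Otimes>\<^sub>M lborel) G"
    by (intro integrableI_bounded) auto
  have ae: "AE x in lborel. (\<integral>t. G (x, t) \<partial>lborel) = F (x + E) - F x"
    using lborel_pair.AE_integrable_fst'[OF intG]
  proof eventually_elim
    case (elim x)
    have d: "((\<lambda>t. F (x + t *\<^sub>R E)) has_real_derivative F' (x + t *\<^sub>R E)) (at t)" for t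
    proof -
      have "((\<lambda>s. F ((x + t *\<^sub>R E) + s *\<^sub>R E)) has_real_derivative F' (x + t *\<^sub>R E)) (at 0)" by (rule deriv)
      then have "((\<lambda>s. F (x + (s + t) *\<^sub>R E)) has_real_derivative F' (x + t *\<^sub>R E)) (at 0)"
        by (simp add: scaleR_add_left add_ac)
      then show ?thesis using DERIV_shift[of "\<lambda>t. F (x + t *\<^sub>R E)" _ 0 t] by simp
    qed
    have "((\<lambda>t. F' (x + t *\<^sub>R E)) has_integral (F (x + 1 *\<^sub>R E) - F (x + 0 *\<^sub>R E))) {0..1}"
      by (rule fundamental_theorem_of_calculus)
         (auto simp: has_real_derivative_iff_has_vector_derivative[symmetric] intro: has_field_derivative_at_within d)
    then have "((\<lambda>t. if t \<in> {0..1} then F' (x + t *\<^sub>R E) else 0) has_integral (F (x + E) - F x)) UNIV"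
      by (simp only: has_integral_restrict_UNIV scaleR_one scaleR_zero_left add_0_right)
    moreover have "(\<lambda>t. G (x, t)) = (\<lambda>t. if t \<in> {0..1} then F' (x + t *\<^sub>R E) else 0)"
      by (auto simp: G_def)
    ultimately have "((\<lambda>t. G (x, t)) has_integral (F (x + E) - F x)) UNIV" by simp
    with has_integral_integral_lborel[OF elim] show ?case by (rule has_integral_unique)
  qed
  have "(\<integral>t. (\<integral>x. G (x, t) \<partial>lborel) \<partial>lborel) = (\<integral>x. (\<integral>t. G (x, t) \<partial>lborel) \<partial>lborel)"
    using lborel_pair.Fubini_integral[of "\<lambda>x t. G (x, t)"] intG by simp
  also have "\<dots> = (\<integral>x. F (x + E) - F x \<partial>lborel)"
    by (rule integral_cong_AE) (use ae in auto)
  also have "\<dots> = 0" by (simp add: transl F)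
  also have "(\<integral>t. (\<integral>x. G (x, t) \<partial>lborel) \<partial>lborel) = (\<integral>t. indicator {0..1::real} t * (\<integral>x. F' x \<partial>lborel) \<partial>lborel)"
    by (intro Bochner_Integration.integral_cong refl) (simp add: G_def transl F')
  also have "\<dots> = (\<integral>x. F' x \<partial>lborel)" by simp
  finally show ?thesis .
qed

text \<open>With Z = Y - M and Omega the inverse covariance, this is minus the derivative of the log
  density in direction \<open>E\<close>.\<close>

definition row_form :: "real^'p^'p \<Rightarrow> real^'p^'n \<Rightarrow> real^'p^'n \<Rightarrow> real" where
  "row_form \<Omega> Z E = (\<Sum>i\<in>UNIV. Z $ i \<bullet> (\<Omega> *v E $ i))"

lemma borel_measurable_row_form [measurable]:
  "(\<lambda>Y. row_form \<Omega> (Y - M) E) \<in> borel_measurable borel"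
  unfolding row_form_def by measurable

lemma has_derivative_matrix_normal_density:
  fixes M :: "real^'p^'n"
  assumes "pos_def \<Sigma>"
  shows "((\<lambda>t. matrix_normal_density M \<Sigma> (Y + t *\<^sub>R E)) has_real_derivative
    - row_form (matrix_inv \<Sigma>) (Y - M) E * matrix_normal_density M \<Sigma> Y) (at 0)"
proof -
  let ?Om = "matrix_inv \<Sigma>" and ?Z = "Y - M"
  have sym: "x \<bullet> (?Om *v y) = y \<bullet> (?Om *v x)" for x y
    using psdD(3)[OF pos_def_imp_psd[OF pos_def_matrix_inv[OF assms]], of x y] by (simp add: inner_commute)
  have q: "row_quad ?Om (Y + t *\<^sub>R E - M) = row_quad ?Om ?Z + 2 * t * row_form ?Om ?Z E + t\<^sup>2 * row_quad ?Om E" for t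
  proof -
    have "(Y + t *\<^sub>R E - M) $ i \<bullet> (?Om *v (Y + t *\<^sub>R E - M) $ i) =
       ?Z $ i \<bullet> (?Om *v ?Z $ i) + 2 * t * (?Z $ i \<bullet> (?Om *v E $ i)) + t\<^sup>2 * (E $ i \<bullet> (?Om *v E $ i))" for i
    proof -
      have "(Y + t *\<^sub>R E - M) $ i = ?Z $ i + t *\<^sub>R E $ i" by simp
      then show ?thesis using sym[of "E $ i" "?Z $ i"]
        by (simp only: matrix_vector_right_distrib matrix_vector_mult_scaleR inner_add_left inner_add_right
          inner_scaleR_left inner_scaleR_right power2_eq_square) (simp add: algebra_simps)
    qed
    then show ?thesis
      by (simp add: row_quad_def row_form_def sum.distrib sum_distrib_left)
  qed
  show ?thesis unfolding matrix_normal_density_exp q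
    using pos_def_det_pos[OF assms] by (auto intro!: derivative_eq_intros)
qed

text \<open>The directional derivative of density times \<open>g\<close> integrates to zero. Only
  lines in the one direction \<open>E\<close> matter, so \<open>E\<close> can be chosen to keep
  other statistics constant.\<close>

lemma stein_identity:
  fixes M :: "real^'p^'n"
  assumes pd: "pos_def \<Sigma>"
    and [measurable]: "g \<in> borel_measurable borel" "g' \<in> borel_measurable borel"
    and deriv: "\<And>Y. ((\<lambda>t. g (Y + t *\<^sub>R E)) has_real_derivative g' Y) (at 0)"
    and ig: "integrable (matrix_normal M \<Sigma>) g" and ig': "integrable (matrix_normal M \<Sigma>) g'"
    and igs: "integrable (matrix_normal M \<Sigma>) (\<lambda>Y. g Y * row_form (matrix_inv \<Sigma>) (Y - M) E)"
  shows "(\<integral>Y. g Y * row_form (matrix_inv \<Sigma>) (Y - M) E \<partial>matrix_normal M \<Sigma>) = (\<integral>Y. g' Y \<partial>matrix_normal M \<Sigma>)"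
proof -
  let ?d = "matrix_normal_density M \<Sigma>" and ?s = "\<lambda>Y. row_form (matrix_inv \<Sigma>) (Y - M) E"
  have i: "integrable lborel (\<lambda>Y. ?d Y * g Y)" "integrable lborel (\<lambda>Y. ?d Y * g' Y)"
     "integrable lborel (\<lambda>Y. ?d Y * (g Y * ?s Y))"
    using ig ig' igs by (simp_all add: integrable_matrix_normal_iff[OF pd])
  have "(\<integral>Y. ?d Y * g' Y - ?d Y * (g Y * ?s Y) \<partial>lborel) = 0"
  proof (rule integral_directional_derivative_eq_0[OF i(1)])
    show "integrable lborel (\<lambda>Y. ?d Y * g' Y - ?d Y * (g Y * ?s Y))" by (intro Bochner_Integration.integrable_diff i)
    fix Y
    show "((\<lambda>t. ?d (Y + t *\<^sub>R E) * g (Y + t *\<^sub>R E)) has_real_derivative ?d Y * g' Y - ?d Y * (g Y * ?s Y)) (at 0)"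
      using DERIV_mult[OF has_derivative_matrix_normal_density[OF pd, of M Y E] deriv[of Y]]
      by (rule DERIV_cong) (simp add: algebra_simps)
  qed
  then show ?thesis using i by (simp add: integral_matrix_normal[OF pd])
qed

section \<open>Haff's identity with a ridge\<close>

declare transpose_matrix_vector [simp del]

section \<open>Measurability of matrix operations and polynomial growth\<close>

lemma borel_measurable_vec:
  fixes f :: "'a \<Rightarrow> 'b::euclidean_space^'n"
  assumes "\<And>i. (\<lambda>x. f x $ i) \<in> borel_measurable G"
  shows "f \<in> borel_measurable G"
  by (subst borel_measurable_euclidean_space)
     (use assms in \<open>auto simp: Basis_vec_def inner_axis intro!: borel_measurable_inner\<close>)

lemma borel_measurable_matrix_inv [measurable (raw)]:
  fixes F :: "'a \<Rightarrow> real^'n^'n"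
  assumes "F \<in> borel_measurable G"
  shows "(\<lambda>x. matrix_inv (F x)) \<in> borel_measurable G"
  using assms by (intro borel_measurable_vec borel_measurable_matrix_inv_component) simp

lemma borel_measurable_matrix_vector_mult2 [measurable (raw)]:
  fixes F :: "'a \<Rightarrow> real^'n^'m"
  assumes "F \<in> borel_measurable G" "z \<in> borel_measurable G"
  shows "(\<lambda>x. F x *v z x) \<in> borel_measurable G"
  unfolding matrix_vector_mult_def using assms by (intro borel_measurable_vec) simp

lemma borel_measurable_matrix_mult [measurable (raw)]:
  fixes F :: "'a \<Rightarrow> real^'n^'m" and H :: "'a \<Rightarrow> real^'k^'n"
  assumes "F \<in> borel_measurable G" "H \<in> borel_measurable G"
  shows "(\<lambda>x. F x ** H x) \<in> borel_measurable G"
  unfolding matrix_matrix_mult_def using assms by (intro borel_measurable_vec) simp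

lemma borel_measurable_transpose [measurable (raw)]:
  fixes F :: "'a \<Rightarrow> real^'n^'m"
  assumes "F \<in> borel_measurable G"
  shows "(\<lambda>x. transpose (F x)) \<in> borel_measurable G"
  unfolding transpose_def using assms by (intro borel_measurable_vec) simp

lemma borel_measurable_trace [measurable (raw)]:
  fixes F :: "'a \<Rightarrow> real^'n^'n"
  assumes "F \<in> borel_measurable G"
  shows "(\<lambda>x. trace (F x)) \<in> borel_measurable G"
  unfolding trace_def using assms by simp

text \<open>A class closed under sums, products and the regularised inverse, and integrable under
  every normal law. Including measurability lets the integrability of each Stein integrand be
  derived from its syntax.\<close>

definition poly_growth :: "('a::real_normed_vector \<Rightarrow> 'b::real_normed_vector) \<Rightarrow> bool" where
  "poly_growth f \<longleftrightarrow> f \<in> borel_measurable borel \<and> (\<exists>C k. \<forall>Y. norm (f Y) \<le> C * (1 + norm Y) ^ k)"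

lemma poly_growthE:
  assumes "poly_growth f"
  obtains C k where "0 \<le> C" "\<And>Y. norm (f Y) \<le> C * (1 + norm Y) ^ k"
proof -
  obtain C k where "\<And>Y. norm (f Y) \<le> C * (1 + norm Y) ^ k" using assms unfolding poly_growth_def by blast
  then have "norm (f Y) \<le> \<bar>C\<bar> * (1 + norm Y) ^ k" for Y
    by (meson abs_ge_self mult_right_mono norm_ge_zero order_trans zero_le_power add_nonneg_nonneg zero_le_one)
  then show thesis by (rule that[of "\<bar>C\<bar>" k, rotated]) simp
qed

lemma poly_growth_measurable: "poly_growth f \<Longrightarrow> f \<in> borel_measurable borel"
  by (simp add: poly_growth_def)

lemma poly_growth_const: "poly_growth (\<lambda>_. c)"
  unfolding poly_growth_def by (intro conjI exI[of _ "norm c"] exI[of _ 0]) auto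

lemma poly_growth_bound:
  assumes "poly_growth g" "f \<in> borel_measurable borel" "\<And>Y. norm (f Y) \<le> norm (g Y)"
  shows "poly_growth f"
  using assms unfolding poly_growth_def by (meson order_trans)

lemma poly_growth_bounded:
  assumes "f \<in> borel_measurable borel" "\<And>Y. norm (f Y) \<le> B"
  shows "poly_growth f"
  using assms unfolding poly_growth_def by (intro conjI exI[of _ B] exI[of _ 0]) auto

lemma poly_growth_linear:
  assumes "f \<in> borel_measurable borel" "\<And>Y. norm (f Y) \<le> C * norm Y"
  shows "poly_growth f"
  unfolding poly_growth_def
proof (intro conjI exI allI)
  fix Y
  have "norm (f Y) \<le> \<bar>C\<bar> * norm Y" using assms(2)[of Y] abs_ge_self[of C] by (meson mult_right_mono norm_ge_zero order_trans)
  also have "\<dots> \<le> \<bar>C\<bar> * (1 + norm Y)" by (intro mult_left_mono) auto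
  finally show "norm (f Y) \<le> \<bar>C\<bar> * (1 + norm Y) ^ 1" by simp
qed (rule assms(1))

lemma poly_growth_add:
  fixes f g :: "'a::real_normed_vector \<Rightarrow> 'b::euclidean_space"
  assumes f: "poly_growth f" and g: "poly_growth g"
  shows "poly_growth (\<lambda>Y. f Y + g Y)"
  unfolding poly_growth_def
proof
  show "(\<lambda>Y. f Y + g Y) \<in> borel_measurable borel"
    using poly_growth_measurable[OF f] poly_growth_measurable[OF g] by simp
  obtain C k where C: "0 \<le> C" "\<And>Y. norm (f Y) \<le> C * (1 + norm Y) ^ k" by (rule poly_growthE[OF f]) blast
  obtain D l where D: "0 \<le> D" "\<And>Y. norm (g Y) \<le> D * (1 + norm Y) ^ l" by (rule poly_growthE[OF g]) blast
  have "norm (f Y + g Y) \<le> (C + D) * (1 + norm Y) ^ (k + l)" for Y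
  proof -
    have "norm (f Y + g Y) \<le> C * (1 + norm Y) ^ k + D * (1 + norm Y) ^ l"
      using C(2)[of Y] D(2)[of Y] norm_triangle_ineq[of "f Y" "g Y"] by linarith
    also have "\<dots> \<le> C * (1 + norm Y) ^ (k + l) + D * (1 + norm Y) ^ (k + l)"
      by (intro add_mono mult_left_mono power_increasing C D) auto
    finally show ?thesis by (simp add: algebra_simps)
  qed
  then show "\<exists>C k. \<forall>Y. norm (f Y + g Y) \<le> C * (1 + norm Y) ^ k" by blast
qed

lemma poly_growth_mult_bound:
  fixes f :: "'a::real_normed_vector \<Rightarrow> 'b::euclidean_space" and g :: "'a \<Rightarrow> 'c::euclidean_space" and h :: "'a \<Rightarrow> 'd::euclidean_space"
  assumes f: "poly_growth f" and g: "poly_growth g"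
    and h: "h \<in> borel_measurable borel" "\<And>Y. norm (h Y) \<le> norm (f Y) * norm (g Y)"
  shows "poly_growth h"
  unfolding poly_growth_def
proof
  obtain C k where C: "0 \<le> C" "\<And>Y. norm (f Y) \<le> C * (1 + norm Y) ^ k" by (rule poly_growthE[OF f]) blast
  obtain D l where D: "0 \<le> D" "\<And>Y. norm (g Y) \<le> D * (1 + norm Y) ^ l" by (rule poly_growthE[OF g]) blast
  have "norm (h Y) \<le> (C * D) * (1 + norm Y) ^ (k + l)" for Y
  proof -
    have "norm (h Y) \<le> (C * (1 + norm Y) ^ k) * (D * (1 + norm Y) ^ l)"
      using C D by (intro order_trans[OF h(2)] mult_mono) auto
    then show ?thesis by (simp add: power_add mult_ac)
  qed
  then show "\<exists>C k. \<forall>Y. norm (h Y) \<le> C * (1 + norm Y) ^ k" by blast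
qed (rule h(1))

lemma poly_growth_mult:
  fixes f g :: "'a::real_normed_vector \<Rightarrow> real"
  assumes "poly_growth f" "poly_growth g"
  shows "poly_growth (\<lambda>Y. f Y * g Y)"
  by (rule poly_growth_mult_bound[OF assms])
     (use assms[THEN poly_growth_measurable] in \<open>auto simp: abs_mult\<close>)

lemma poly_growth_inner:
  fixes f g :: "'a::real_normed_vector \<Rightarrow> 'b::euclidean_space"
  assumes "poly_growth f" "poly_growth g"
  shows "poly_growth (\<lambda>Y. f Y \<bullet> g Y)"
  by (rule poly_growth_mult_bound[OF assms])
     (use assms[THEN poly_growth_measurable] Cauchy_Schwarz_ineq2 in auto)

lemma poly_growth_uminus:
  fixes f :: "'a::real_normed_vector \<Rightarrow> 'b::euclidean_space"
  assumes "poly_growth f" shows "poly_growth (\<lambda>Y. - f Y)"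
  using assms poly_growth_measurable[OF assms] by (intro poly_growth_bound[OF assms]) auto

lemma poly_growth_diff:
  fixes f g :: "'a::real_normed_vector \<Rightarrow> 'b::euclidean_space"
  assumes "poly_growth f" "poly_growth g"
  shows "poly_growth (\<lambda>Y. f Y - g Y)"
  using poly_growth_add[OF assms(1) poly_growth_uminus[OF assms(2)]] by simp

lemma poly_growth_scaleR:
  fixes f :: "'a::real_normed_vector \<Rightarrow> 'b::euclidean_space"
  assumes "poly_growth f" shows "poly_growth (\<lambda>Y. c *\<^sub>R f Y)"
  by (rule poly_growth_mult_bound[OF poly_growth_const[of c] assms])
     (use poly_growth_measurable[OF assms] in auto)

lemma poly_growth_sum:
  fixes f :: "'i \<Rightarrow> 'a::real_normed_vector \<Rightarrow> 'b::euclidean_space"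
  assumes "\<And>i. i \<in> I \<Longrightarrow> poly_growth (f i)"
  shows "poly_growth (\<lambda>Y. \<Sum>i\<in>I. f i Y)"
  using assms
proof (induction I rule: infinite_finite_induct)
  case (insert a I)
  then show ?case using poly_growth_add[of "f a" "\<lambda>Y. \<Sum>i\<in>I. f i Y"] by simp
qed (simp_all add: poly_growth_const)

lemma poly_growth_matrix_vector_mult:
  fixes f :: "'a::real_normed_vector \<Rightarrow> real^'n" and A :: "real^'n^'m"
  assumes "poly_growth f"
  shows "poly_growth (\<lambda>Y. A *v f Y)"
proof -
  have "\<exists>C>0. \<forall>z. norm (A *v z) \<le> norm z * C"
    by (rule bounded_linear.pos_bounded) (simp add: linear_conv_bounded_linear[symmetric])
  then obtain C where "\<And>z. norm (A *v z) \<le> norm z * C" by blast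
  moreover have "(\<lambda>Y. A *v f Y) \<in> borel_measurable borel"
    using poly_growth_measurable[OF assms] by (rule measurable_compose[OF _ borel_measurable_matrix_vector_mult])
  moreover have "norm z * C \<le> norm z * norm \<bar>C\<bar>" for z :: "real^'n" by (intro mult_left_mono) auto
  ultimately show ?thesis
    by (intro poly_growth_mult_bound[OF assms poly_growth_const[of "\<bar>C\<bar>"]]) (auto intro: order_trans)
qed

lemma poly_growth_integrable:
  fixes g :: "real^'p^'n \<Rightarrow> real"
  assumes "pos_def \<Sigma>" "poly_growth g"
  shows "integrable (matrix_normal M \<Sigma>) g"
proof -
  obtain C k where "0 \<le> C" "\<And>Y. norm (g Y) \<le> C * (1 + norm Y) ^ k" by (rule poly_growthE[OF assms(2)]) blast
  then show ?thesis
    by (intro integrable_matrix_normal_poly[OF assms(1) poly_growth_measurable[OF assms(2)], of C k]) auto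
qed

text \<open>The rank-one direction v w^T. Along it \<open>transpose Y *v r\<close> moves by a
  multiple of \<open>w\<close>, and stays fixed if \<open>r\<close> is orthogonal to
  \<open>v\<close>; this separates residual directions from those in the column space of the
  design.\<close>

definition outer :: "real^'n \<Rightarrow> real^'p \<Rightarrow> real^'p^'n" where
  "outer v w = (\<chi> i. v $ i *\<^sub>R w)"

lemma outer_vector: "outer v w *v a = (w \<bullet> a) *\<^sub>R v"
  by (simp add: vec_eq_iff matrix_vector_mult_def outer_def inner_vec_def sum_distrib_left mult_ac)

lemma transpose_mult_eq_sum: "transpose Y *v r = (\<Sum>i\<in>UNIV. r $ i *\<^sub>R Y $ i)" for Y :: "real^'p^'n"
  by (simp add: vec_eq_iff matrix_vector_mult_def transpose_def mult.commute)

lemma transpose_mult_outer: "transpose (Y + t *\<^sub>R outer v w) *v r = transpose Y *v r + (t * (v \<bullet> r)) *\<^sub>R w"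
proof -
  have "transpose (Y + t *\<^sub>R outer v w) *v r = (\<Sum>i\<in>UNIV. r $ i *\<^sub>R Y $ i) + (\<Sum>i\<in>UNIV. (t * (v $ i * r $ i)) *\<^sub>R w)"
    unfolding transpose_mult_eq_sum
    by (simp add: outer_def scaleR_add_right sum.distrib mult_ac)
  also have "(\<Sum>i\<in>UNIV. (t * (v $ i * r $ i)) *\<^sub>R w) = (t * (v \<bullet> r)) *\<^sub>R w"
    by (simp add: scaleR_sum_left[symmetric] inner_vec_def sum_distrib_left)
  finally show ?thesis by (simp only: transpose_mult_eq_sum)
qed

lemma row_form_outer:
  fixes Z :: "real^'p^'n"
  shows "row_form \<Omega> Z (outer v w) = (transpose Z *v v) \<bullet> (\<Omega> *v w)"
  unfolding transpose_mult_eq_sum row_form_def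
  by (simp add: outer_def inner_sum_left matrix_vector_mult_scaleR)

lemma norm_transpose_mult_le:
  fixes Y :: "real^'p^'n"
  shows "norm (transpose Y *v r) \<le> norm r * norm Y"
proof -
  have "norm (transpose Y *v r) \<le> (\<Sum>i\<in>UNIV. \<bar>r $ i\<bar> * \<bar>norm (Y $ i)\<bar>)"
    unfolding transpose_mult_eq_sum by (rule order_trans[OF norm_sum]) simp
  also have "\<dots> \<le> L2_set (\<lambda>i. r $ i) UNIV * L2_set (\<lambda>i. norm (Y $ i)) UNIV"
    by (rule L2_set_mult_ineq)
  also have "\<dots> = norm r * norm Y" by (simp add: norm_vec_def L2_set_def)
  finally show ?thesis .
qed

lemma poly_growth_transpose_mult: "poly_growth (\<lambda>Y :: real^'p^'n. transpose Y *v r)"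
  by (rule poly_growth_linear) (auto intro: norm_transpose_mult_le)

lemma vec_eq_sum_axis: "x = (\<Sum>j\<in>UNIV. x $ j *\<^sub>R axis j 1)" for x :: "real^'n"
proof (subst vec_eq_iff, rule allI)
  fix i
  have "(\<Sum>j\<in>UNIV. x $ j *\<^sub>R axis j 1) $ i = (\<Sum>j\<in>UNIV. if j = i then x $ j else 0)"
    unfolding sum_component by (intro sum.cong) (auto simp: axis_def)
  then show "x $ i = (\<Sum>j\<in>UNIV. x $ j *\<^sub>R axis j 1) $ i" by simp
qed

text \<open>\<open>N\<close> plays the residual projection, and its trace the residual degrees of
  freedom. Because it annihilates the mean, the score along N v w^T is free of
  \<open>M\<close>.\<close>

locale normal_model =
  fixes M :: "real^'p^'n" and \<Sigma> :: "real^'p^'p" and N :: "real^'n^'n"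
  assumes pd: "pos_def \<Sigma>"
    and N_sym: "transpose N = N" and N_idem: "N ** N = N" and N_mean: "N ** M = 0"
begin

abbreviation Om :: "real^'p^'p" where "Om \<equiv> matrix_inv \<Sigma>"
abbreviation law :: "(real^'p^'n) measure" where "law \<equiv> matrix_normal M \<Sigma>"

text \<open>Row \<open>i\<close> of \<open>N ** Y\<close>; the matrix \<open>SS Y\<close> is the sum
  of the outer squares of these rows.\<close>

definition V :: "real^'p^'n \<Rightarrow> 'n \<Rightarrow> real^'p" where "V Y i = transpose Y *v (N *v axis i 1)"
definition SS :: "real^'p^'n \<Rightarrow> real^'p^'p" where "SS Y = transpose Y ** N ** Y"
definition K :: "real \<Rightarrow> real^'p^'n \<Rightarrow> real^'p^'p" where "K e Y = matrix_inv (SS Y + e *\<^sub>R mat 1)"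

sublocale law: prob_space law by (rule prob_space_matrix_normal[OF pd])

lemma inner_N: "(N *v u) \<bullet> w = u \<bullet> (N *v w)"
  using inner_matrix_vector_transpose[of u N w] by (simp add: N_sym)

lemma N_N: "N *v (N *v u) = N *v u"
  by (simp add: matrix_vector_mul_assoc N_idem)

lemma V_inner: "V Y i \<bullet> a = (N *v (Y *v a)) $ i"
proof -
  have "V Y i \<bullet> a = (N *v axis i 1) \<bullet> (Y *v a)"
    unfolding V_def using inner_matrix_vector_transpose[of "N *v axis i 1" Y a] by simp
  then show ?thesis by (simp add: inner_N inner_axis')
qed

lemma inner_SS: "b \<bullet> (SS Y *v a) = (\<Sum>i\<in>UNIV. (V Y i \<bullet> b) * (V Y i \<bullet> a))"
proof -
  have "b \<bullet> (SS Y *v a) = (Y *v b) \<bullet> (N *v (Y *v a))"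
    using inner_matrix_vector_transpose[of b "transpose Y" "N *v (Y *v a)"]
    by (simp only: SS_def matrix_vector_mul_assoc[symmetric] transpose_transpose)
  also have "\<dots> = (N *v (Y *v b)) \<bullet> (N *v (Y *v a))" by (simp add: inner_N N_N)
  also have "\<dots> = (\<Sum>i\<in>UNIV. (V Y i \<bullet> b) * (V Y i \<bullet> a))" by (simp only: V_inner) (simp add: inner_vec_def)
  finally show ?thesis .
qed

lemma psd_SS: "psd (SS Y)"
proof -
  have "transpose (SS Y) = SS Y" by (simp add: SS_def matrix_transpose_mul N_sym matrix_mul_assoc)
  moreover have "0 \<le> x \<bullet> (SS Y *v x)" for x unfolding inner_SS by (intro sum_nonneg) simp
  ultimately show ?thesis by (simp add: psd_def)
qed

lemma transpose_M_N: "transpose M *v (N *v u) = 0"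
proof -
  have "transpose M ** N = transpose (N ** M)" by (simp add: matrix_transpose_mul N_sym)
  also have "\<dots> = 0" by (simp add: N_mean transpose_def vec_eq_iff)
  finally have "transpose M ** N = 0" .
  then show ?thesis by (simp only: matrix_vector_mul_assoc) (simp add: matrix_vector_mult_def vec_eq_iff)
qed

lemma SS_measurable [measurable]: "SS \<in> borel_measurable borel"
  unfolding SS_def by measurable

lemma K_measurable [measurable]: "K e \<in> borel_measurable borel"
  unfolding K_def by measurable

lemma trace_SS_eq: "trace (SS Y) = (\<Sum>i\<in>UNIV. V Y i \<bullet> V Y i)"
proof -
  have "trace (SS Y) = (\<Sum>j\<in>UNIV. \<Sum>i\<in>UNIV. (V Y i \<bullet> axis j 1) * (V Y i \<bullet> axis j 1))"
    unfolding trace_eq_sum_inner_axis inner_SS ..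
  also have "\<dots> = (\<Sum>i\<in>UNIV. \<Sum>j\<in>UNIV. (V Y i \<bullet> axis j 1) * (V Y i \<bullet> axis j 1))" by (rule sum.swap)
  finally show ?thesis by (simp only: inner_eq_sum_axis[symmetric])
qed

lemma poly_growth_V: "poly_growth (\<lambda>Y. V Y i)"
  unfolding V_def by (rule poly_growth_transpose_mult)

lemma poly_growth_trace_SS: "poly_growth (\<lambda>Y. trace (SS Y))"
  unfolding trace_SS_eq by (intro poly_growth_sum poly_growth_inner poly_growth_V)

lemma poly_growth_K:
  assumes "0 < e" "poly_growth z"
  shows "poly_growth (\<lambda>Y. K e Y *v z Y)"
proof (rule poly_growth_bound[OF poly_growth_scaleR[OF assms(2), of "1/e"]])
  show "(\<lambda>Y. K e Y *v z Y) \<in> borel_measurable borel" using poly_growth_measurable[OF assms(2)] by measurable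
  fix Y show "norm (K e Y *v z Y) \<le> norm ((1 / e) *\<^sub>R z Y)"
    using ridge_inv_norm_le[OF psd_SS assms(1), of Y "z Y"] assms(1) by (simp add: K_def field_simps)
qed

lemma poly_growth_trace_K:
  assumes "0 < e" shows "poly_growth (\<lambda>Y. trace (K e Y))"
  unfolding trace_eq_sum_inner_axis
  by (intro poly_growth_sum poly_growth_inner poly_growth_K poly_growth_const assms)


lemma V_line: "V (Y + t *\<^sub>R outer (N *v axis i 1) w) i = V Y i + (t * N $ i $ i) *\<^sub>R w"
proof -
  have "(N *v axis i 1) \<bullet> (N *v axis i 1) = N $ i $ i"
    by (simp add: inner_N N_N) (simp add: inner_axis' matrix_vector_mult_basis column_def)
  then show ?thesis by (simp add: V_def transpose_mult_outer)
qed

lemma SS_line: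
  "SS (Y + t *\<^sub>R outer (N *v axis i 1) w) = SS Y + t *\<^sub>R (outer w (V Y i) + outer (V Y i) w) + t\<^sup>2 *\<^sub>R (N $ i $ i *\<^sub>R outer w w)"
  unfolding matrix_eq
proof
  fix a
  let ?u = "N *v axis i 1"
  have uu: "?u \<bullet> (N *v ?u) = N $ i $ i"
    by (simp add: N_N inner_N) (simp add: inner_axis' matrix_vector_mult_basis column_def)
  have Ya: "(Y + t *\<^sub>R outer ?u w) *v a = Y *v a + (t * (w \<bullet> a)) *\<^sub>R ?u"
    by (simp add: matrix_vector_mult_add_rdistrib scaleR_matrix_vector_assoc[symmetric] outer_vector)
  have Va: "?u \<bullet> (N *v (Y *v a)) = V Y i \<bullet> a"
    by (simp add: inner_N[symmetric] N_N) (simp add: V_inner inner_N inner_axis')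
  have "SS (Y + t *\<^sub>R outer ?u w) *v a = transpose (Y + t *\<^sub>R outer ?u w) *v (N *v (Y *v a + (t * (w \<bullet> a)) *\<^sub>R ?u))"
    by (simp only: SS_def matrix_vector_mul_assoc[symmetric] Ya)
  also have "\<dots> = transpose Y *v (N *v (Y *v a)) + (t * (w \<bullet> a)) *\<^sub>R (transpose Y *v (N *v ?u))
      + (t * (V Y i \<bullet> a)) *\<^sub>R w + (t * (t * (w \<bullet> a) * N $ i $ i)) *\<^sub>R w"
    by (simp only: transpose_mult_outer matrix_vector_right_distrib matrix_vector_mult_scaleR inner_add_right inner_scaleR_right Va uu)
       (simp add: algebra_simps)
  also have "transpose Y *v (N *v ?u) = V Y i" by (simp add: N_N V_def)
  also have "transpose Y *v (N *v (Y *v a)) = SS Y *v a" by (simp only: SS_def matrix_vector_mul_assoc[symmetric])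
  finally show "SS (Y + t *\<^sub>R outer ?u w) *v a =
      (SS Y + t *\<^sub>R (outer w (V Y i) + outer (V Y i) w) + t\<^sup>2 *\<^sub>R (N $ i $ i *\<^sub>R outer w w)) *v a"
    by (simp add: matrix_vector_mult_add_rdistrib scaleR_matrix_vector_assoc[symmetric] outer_vector power2_eq_square algebra_simps)
qed

text \<open>The derivative of the inverse is - K S' K, where S' = w V^T + V w^T is the linear
  coefficient in \<open>SS_line\<close>; the quadratic term there has derivative 0 at t = 0.\<close>

lemma K_line:
  assumes e: "0 < e"
  shows "((\<lambda>t. K e (Y + t *\<^sub>R outer (N *v axis i 1) w) *v x) has_vector_derivative
    - ((V Y i \<bullet> (K e Y *v x)) *\<^sub>R (K e Y *v w) + (w \<bullet> (K e Y *v x)) *\<^sub>R (K e Y *v V Y i))) (at 0)"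
proof -
  let ?D = "outer w (V Y i) + outer (V Y i) w"
  let ?S = "\<lambda>t. SS (Y + t *\<^sub>R outer (N *v axis i 1) w) + e *\<^sub>R mat 1"
  interpret mv: bounded_bilinear "\<lambda>(A::real^'p^'p) (x::real^'p). A *v x"
    by (rule bounded_bilinear_matrix_vector_mult)
  have "(?S has_vector_derivative ?D) (at 0)"
    unfolding SS_line by (auto intro!: derivative_eq_intros)
  then have "((\<lambda>t. matrix_inv (?S t)) has_vector_derivative - (matrix_inv (?S 0) ** ?D ** matrix_inv (?S 0))) (at 0)"
    by (rule has_vector_derivative_matrix_inv) (rule pos_def_det_nz[OF pos_def_ridge[OF psd_SS e]])
  then have "((\<lambda>t. K e (Y + t *\<^sub>R outer (N *v axis i 1) w)) has_vector_derivative - (K e Y ** ?D ** K e Y)) (at 0)"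
    by (simp add: K_def)
  from bounded_linear.has_vector_derivative[OF mv.bounded_linear_left this]
  have "((\<lambda>t. K e (Y + t *\<^sub>R outer (N *v axis i 1) w) *v x) has_vector_derivative - (K e Y ** ?D ** K e Y) *v x) (at 0)" .
  moreover have "- (K e Y ** ?D ** K e Y) *v x =
      - ((V Y i \<bullet> (K e Y *v x)) *\<^sub>R (K e Y *v w) + (w \<bullet> (K e Y *v x)) *\<^sub>R (K e Y *v V Y i))"
    by (simp only: mv.minus_left matrix_vector_mul_assoc[symmetric] matrix_vector_mult_add_rdistrib outer_vector
        matrix_vector_right_distrib matrix_vector_mult_scaleR)
  ultimately show ?thesis by simp
qed

text \<open>Stein's identity for the field \<open>N Y K x x\<^sup>T h(x\<^sup>T K x)\<close>, where the ridge \<open>e\<close> removes the singularity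
  of the inverse of \<open>SS Y\<close>. For \<open>h = 1\<close> it is Haff's identity for a Wishart matrix.\<close>

lemma ridge_haff_identity:
  fixes X :: "real^'p^'n \<Rightarrow> real^'p" and h h' :: "real \<Rightarrow> real"
  assumes e: "0 < e"
    and X: "poly_growth X" and X_line: "\<And>Y t v w. X (Y + t *\<^sub>R outer (N *v v) w) = X Y"
    and h: "\<And>c. 0 \<le> c \<Longrightarrow> (h has_real_derivative h' c) (at c)"
    and hb: "\<And>c. 0 \<le> c \<Longrightarrow> \<bar>h c\<bar> \<le> H" "\<And>c. 0 \<le> c \<Longrightarrow> \<bar>h' c\<bar> \<le> H"
    and [measurable]: "h \<in> borel_measurable borel" "h' \<in> borel_measurable borel"
  defines "a \<equiv> \<lambda>Y. K e Y *v X Y"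
  defines "c \<equiv> \<lambda>Y. X Y \<bullet> a Y"
  shows "(\<integral>Y. h (c Y) * ((X Y - e *\<^sub>R a Y) \<bullet> (Om *v X Y)) \<partial>law) =
    (\<integral>Y. h (c Y) * (trace N * c Y - (c Y - e * (a Y \<bullet> a Y)) - c Y * (real CARD('p) - e * trace (K e Y)))
       - 2 * h' (c Y) * c Y * (c Y - e * (a Y \<bullet> a Y)) \<partial>law)"
proof -
  have Xm [measurable]: "X \<in> borel_measurable borel" by (rule poly_growth_measurable[OF X])
  have pa: "poly_growth a" unfolding a_def by (rule poly_growth_K[OF e X])
  have am [measurable]: "a \<in> borel_measurable borel" by (rule poly_growth_measurable[OF pa])
  have pc: "poly_growth c" unfolding c_def by (intro poly_growth_inner X pa)
  have cm [measurable]: "c \<in> borel_measurable borel" by (rule poly_growth_measurable[OF pc])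
  have psdK: "psd (K e Y)" for Y unfolding K_def by (rule psd_ridge_inv[OF psd_SS e])
  have c0: "0 \<le> c Y" for Y unfolding c_def a_def by (rule psdD(2)[OF psdK])
  have ph: "poly_growth (\<lambda>Y. h (c Y))" "poly_growth (\<lambda>Y. h' (c Y))"
    by (rule poly_growth_bounded[of _ H]; use hb c0 in simp)+
  \<comment> \<open>Entry (i, j) of the field, to be differentiated in direction N e_i e_j^T. The
    double sum over i and j is the divergence along the residual directions.\<close>
  define g where "g i j Y = (V Y i \<bullet> a Y) * (X Y $ j * h (c Y))" for i j Y
  define E :: "'n \<Rightarrow> 'p \<Rightarrow> real^'p^'n" where "E i j = outer (N *v axis i 1) (axis j 1)" for i j
  \<comment> \<open>Product rule: one term comes from row i of N Y, two from the derivative of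
    \<open>K\<close>, the last from h(c). The vector \<open>X Y\<close> is constant in these
    directions.\<close>
  define g' where "g' i j Y = (N $ i $ i * a Y $ j - (V Y i \<bullet> a Y) * (V Y i \<bullet> (K e Y *v axis j 1)) - a Y $ j * (V Y i \<bullet> (K e Y *v V Y i)))
      * (X Y $ j * h (c Y)) + (V Y i \<bullet> a Y) * (X Y $ j * (h' (c Y) * (- 2 * (a Y $ j * (V Y i \<bullet> a Y)))))" for i j Y
  have nth: "poly_growth (\<lambda>Y. f Y $ j)" if "poly_growth f" for f :: "real^'p^'n \<Rightarrow> real^'p" and j
    using poly_growth_inner[OF that poly_growth_const[of "axis j 1"]] by (simp add: inner_axis)
  have pg: "poly_growth (g i j)" for i j
    unfolding g_def by (intro poly_growth_mult poly_growth_inner nth poly_growth_V pa X ph)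
  have pg': "poly_growth (g' i j)" for i j
    unfolding g'_def by (intro poly_growth_mult poly_growth_add poly_growth_diff poly_growth_inner nth
        poly_growth_V pa X ph poly_growth_K e poly_growth_const)
  \<comment> \<open>The mean drops out of the score since M^T N = 0.\<close>
  have sc: "row_form Om (Y - M) (E i j) = V Y i \<bullet> (Om *v axis j 1)" for i j Y
  proof -
    have "transpose (Y - M) *v (N *v axis i 1) = V Y i - transpose M *v (N *v axis i 1)"
      unfolding V_def transpose_mult_eq_sum by (simp add: scaleR_diff_right sum_subtractf)
    then show ?thesis by (simp add: E_def row_form_outer transpose_M_N)
  qed
  have psc: "poly_growth (\<lambda>Y. row_form Om (Y - M) (E i j))" for i j
    unfolding sc by (intro poly_growth_inner poly_growth_V poly_growth_const)
  have deriv: "((\<lambda>t. g i j (Y + t *\<^sub>R E i j)) has_real_derivative g' i j Y) (at 0)" for i j Y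
  proof -
    have Vi: "((\<lambda>t. V (Y + t *\<^sub>R E i j) i) has_vector_derivative N $ i $ i *\<^sub>R axis j 1) (at 0)"
      unfolding E_def V_line by (auto intro!: derivative_eq_intros)
    have aj: "axis j 1 \<bullet> a Y = a Y $ j" by (simp add: inner_axis')
    define a' where "a' = - ((V Y i \<bullet> a Y) *\<^sub>R (K e Y *v axis j 1) + (a Y $ j) *\<^sub>R (K e Y *v V Y i))"
    have a: "((\<lambda>t. a (Y + t *\<^sub>R E i j)) has_vector_derivative a') (at 0)"
      using K_line[OF e, of Y i "axis j 1" "X Y"] unfolding a_def a'_def E_def X_line by (simp add: inner_axis')
    have Kx: "X Y \<bullet> (K e Y *v z) = a Y \<bullet> z" for z
      unfolding a_def by (rule psdD(3)[OF psdK])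
    have c: "((\<lambda>t. c (Y + t *\<^sub>R E i j)) has_real_derivative - 2 * (a Y $ j * (V Y i \<bullet> a Y))) (at 0)"
    proof -
      have "((\<lambda>t. X Y \<bullet> a (Y + t *\<^sub>R E i j)) has_vector_derivative X Y \<bullet> a') (at 0)"
        by (rule bounded_linear.has_vector_derivative[OF bounded_linear_inner_right a])
      moreover have "X Y \<bullet> a' = - 2 * (a Y $ j * (V Y i \<bullet> a Y))"
        unfolding a'_def by (simp add: inner_add_right inner_diff_right Kx inner_axis inner_commute[of "V Y i"])
      ultimately show ?thesis
        by (simp add: c_def E_def X_line has_real_derivative_iff_has_vector_derivative)
    qed
    have va: "((\<lambda>t. V (Y + t *\<^sub>R E i j) i \<bullet> a (Y + t *\<^sub>R E i j)) has_real_derivative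
        N $ i $ i * a Y $ j - (V Y i \<bullet> a Y) * (V Y i \<bullet> (K e Y *v axis j 1)) - a Y $ j * (V Y i \<bullet> (K e Y *v V Y i))) (at 0)"
    proof -
      have "((\<lambda>t. V (Y + t *\<^sub>R E i j) i \<bullet> a (Y + t *\<^sub>R E i j)) has_vector_derivative
          V (Y + 0 *\<^sub>R E i j) i \<bullet> a' + (N $ i $ i *\<^sub>R axis j 1) \<bullet> a (Y + 0 *\<^sub>R E i j)) (at 0)"
        by (rule bounded_bilinear.has_vector_derivative[OF bounded_bilinear_inner Vi a])
      moreover have "V (Y + 0 *\<^sub>R E i j) i \<bullet> a' + (N $ i $ i *\<^sub>R axis j 1) \<bullet> a (Y + 0 *\<^sub>R E i j) =
          N $ i $ i * a Y $ j - (V Y i \<bullet> a Y) * (V Y i \<bullet> (K e Y *v axis j 1)) - a Y $ j * (V Y i \<bullet> (K e Y *v V Y i))"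
        unfolding a'_def by (simp add: inner_add_right inner_diff_right aj algebra_simps)
      ultimately show ?thesis by (simp add: has_real_derivative_iff_has_vector_derivative)
    qed
    have hc: "((\<lambda>t. h (c (Y + t *\<^sub>R E i j))) has_real_derivative h' (c Y) * (- 2 * (a Y $ j * (V Y i \<bullet> a Y)))) (at 0)"
      by (rule DERIV_chain2[OF _ c]) (simp add: h c0)
    have XE: "X (Y + t *\<^sub>R E i j) = X Y" for t by (simp add: E_def X_line)
    show ?thesis unfolding g_def XE
      by (rule DERIV_cong[OF DERIV_mult[OF va DERIV_cmult[OF hc]]]) (simp add: g'_def mult_ac)
  qed
  have st: "(\<integral>Y. g i j Y * row_form Om (Y - M) (E i j) \<partial>law) = (\<integral>Y. g' i j Y \<partial>law)" for i j
    by (rule stein_identity[OF pd _ _ deriv])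
       (intro poly_growth_measurable poly_growth_integrable[OF pd] poly_growth_mult pg pg' psc)+
  \<comment> \<open>Summation over the rows rebuilds \<open>SS Y\<close>, which S K = I - e K then
    removes; the correction \<open>e *\<^sub>R a Y\<close> is the price of the ridge.\<close>
  have Va2: "(\<Sum>i\<in>UNIV. (V Y i \<bullet> a Y) * (V Y i \<bullet> b)) = (X Y - e *\<^sub>R a Y) \<bullet> b" for Y b
    unfolding inner_SS[symmetric] psdD(3)[OF psd_SS] a_def K_def ridge_inv_mult[OF psd_SS e] by simp
  have L: "(\<Sum>i\<in>UNIV. \<Sum>j\<in>UNIV. g i j Y * row_form Om (Y - M) (E i j)) = h (c Y) * ((X Y - e *\<^sub>R a Y) \<bullet> (Om *v X Y))" for Y
  proof -
    have "(\<Sum>j\<in>UNIV. g i j Y * row_form Om (Y - M) (E i j)) = h (c Y) * ((V Y i \<bullet> a Y) * (V Y i \<bullet> (Om *v X Y)))" for i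
    proof -
      have "X Y = (\<Sum>j\<in>UNIV. X Y $ j *\<^sub>R axis j 1)" by (rule vec_eq_sum_axis)
      then have "V Y i \<bullet> (Om *v X Y) = V Y i \<bullet> (Om *v (\<Sum>j\<in>UNIV. X Y $ j *\<^sub>R axis j 1))" by simp
      also have "\<dots> = (\<Sum>j\<in>UNIV. X Y $ j * (V Y i \<bullet> (Om *v axis j 1)))"
        by (simp add: linear_sum[OF matrix_vector_mul_linear] matrix_vector_mult_scaleR inner_sum_right)
      finally show ?thesis unfolding g_def sc by (simp add: sum_distrib_left mult_ac)
    qed
    then show ?thesis by (simp add: sum_distrib_left[symmetric] Va2)
  qed
  \<comment> \<open>This is tr (S K) = p - e tr K. It is the origin of the p in n - k - p - 1; the
    further 1 comes from the term \<open>c Y - e * (a Y \<bullet> a Y)\<close>.\<close>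
  have VKV: "(\<Sum>i\<in>UNIV. V Y i \<bullet> (K e Y *v V Y i)) = real CARD('p) - e * trace (K e Y)" for Y
  proof -
    have "(\<Sum>i\<in>UNIV. V Y i \<bullet> (K e Y *v V Y i)) = (\<Sum>i\<in>UNIV. \<Sum>j\<in>UNIV. (V Y i \<bullet> axis j 1) * (V Y i \<bullet> (K e Y *v axis j 1)))"
      by (subst inner_eq_sum_axis) (simp only: psdD(3)[OF psdK, symmetric])
    also have "\<dots> = (\<Sum>j\<in>UNIV. axis j 1 \<bullet> (SS Y *v (K e Y *v axis j 1)))"
      by (subst sum.swap) (simp only: inner_SS)
    also have "\<dots> = (\<Sum>j\<in>(UNIV::'p set). 1 - e * (axis j 1 \<bullet> (K e Y *v axis j 1)))"
      unfolding K_def ridge_inv_mult[OF psd_SS e] by (simp add: inner_diff_right inner_axis_axis)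
    finally show ?thesis by (simp add: trace_eq_sum_inner_axis sum_subtractf sum_distrib_left)
  qed
  have R: "(\<Sum>i\<in>UNIV. \<Sum>j\<in>UNIV. g' i j Y) =
    h (c Y) * (trace N * c Y - (c Y - e * (a Y \<bullet> a Y)) - c Y * (real CARD('p) - e * trace (K e Y)))
       - 2 * h' (c Y) * c Y * (c Y - e * (a Y \<bullet> a Y))" for Y
  proof -
    have ca: "(\<Sum>j\<in>UNIV. X Y $ j * a Y $ j) = c Y" by (simp add: c_def inner_vec_def)
    have KX: "(\<Sum>j\<in>UNIV. X Y $ j * (V Y i \<bullet> (K e Y *v axis j 1))) = V Y i \<bullet> a Y" for i
    proof -
      have "X Y = (\<Sum>j\<in>UNIV. X Y $ j *\<^sub>R axis j 1)" by (rule vec_eq_sum_axis)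
      then have "V Y i \<bullet> a Y = V Y i \<bullet> (K e Y *v (\<Sum>j\<in>UNIV. X Y $ j *\<^sub>R axis j 1))" unfolding a_def by simp
      then show ?thesis
        by (simp add: linear_sum[OF matrix_vector_mul_linear] matrix_vector_mult_scaleR inner_sum_right)
    qed
    have "(\<Sum>j\<in>UNIV. g' i j Y) = h (c Y) * (N $ i $ i * (\<Sum>j\<in>UNIV. X Y $ j * a Y $ j)
        - (V Y i \<bullet> a Y) * (\<Sum>j\<in>UNIV. X Y $ j * (V Y i \<bullet> (K e Y *v axis j 1)))
        - (\<Sum>j\<in>UNIV. X Y $ j * a Y $ j) * (V Y i \<bullet> (K e Y *v V Y i)))
        - 2 * h' (c Y) * ((V Y i \<bullet> a Y) * (V Y i \<bullet> a Y)) * (\<Sum>j\<in>UNIV. X Y $ j * a Y $ j)" for i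
      unfolding g'_def sum_distrib_left sum_distrib_right sum_subtractf[symmetric] sum.distrib[symmetric]
      by (intro sum.cong refl) (simp add: algebra_simps)
    then have "(\<Sum>i\<in>UNIV. \<Sum>j\<in>UNIV. g' i j Y) = (\<Sum>i\<in>UNIV. h (c Y) * (N $ i $ i * c Y
        - (V Y i \<bullet> a Y) * (V Y i \<bullet> a Y) - c Y * (V Y i \<bullet> (K e Y *v V Y i)))
        - 2 * h' (c Y) * ((V Y i \<bullet> a Y) * (V Y i \<bullet> a Y)) * c Y)"
      by (simp only: ca KX)
    also have "\<dots> = h (c Y) * ((\<Sum>i\<in>UNIV. N $ i $ i) * c Y
        - (\<Sum>i\<in>UNIV. (V Y i \<bullet> a Y) * (V Y i \<bullet> a Y)) - c Y * (\<Sum>i\<in>UNIV. V Y i \<bullet> (K e Y *v V Y i)))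
        - 2 * h' (c Y) * (\<Sum>i\<in>UNIV. (V Y i \<bullet> a Y) * (V Y i \<bullet> a Y)) * c Y"
      by (simp only: sum_subtractf sum_distrib_left sum_distrib_right right_diff_distrib)
    also have "\<dots> = h (c Y) * (trace N * c Y
        - (X Y - e *\<^sub>R a Y) \<bullet> a Y - c Y * (real CARD('p) - e * trace (K e Y)))
        - 2 * h' (c Y) * ((X Y - e *\<^sub>R a Y) \<bullet> a Y) * c Y"
      unfolding Va2 VKV trace_def ..
    also have "(X Y - e *\<^sub>R a Y) \<bullet> a Y = c Y - e * (a Y \<bullet> a Y)" by (simp add: inner_diff_left c_def)
    finally show ?thesis by (simp only: mult_ac)
  qed
  have "(\<integral>Y. h (c Y) * ((X Y - e *\<^sub>R a Y) \<bullet> (Om *v X Y)) \<partial>law) = (\<Sum>i\<in>UNIV. \<Sum>j\<in>UNIV. \<integral>Y. g i j Y * row_form Om (Y - M) (E i j) \<partial>law)"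
    unfolding L[symmetric]
    by (subst Bochner_Integration.integral_sum; (subst Bochner_Integration.integral_sum)?)
       (auto intro!: poly_growth_integrable[OF pd] poly_growth_mult poly_growth_sum pg psc)
  also have "\<dots> = (\<integral>Y. (\<Sum>i\<in>UNIV. \<Sum>j\<in>UNIV. g' i j Y) \<partial>law)"
    unfolding st
    by (subst Bochner_Integration.integral_sum; (subst Bochner_Integration.integral_sum)?)
       (auto intro!: poly_growth_integrable[OF pd] poly_growth_sum pg')
  finally show ?thesis unfolding R .
qed

end

section \<open>Removing the ridge\<close>

text \<open>Fatou's lemma converts a uniform bound on regularised integrals into integrability of
  the limit, before any dominating function is known. Later the limit itself supplies one.\<close>

lemma integrable_Fatou:
  fixes f :: "nat \<Rightarrow> 'a \<Rightarrow> real"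
  assumes f: "\<And>k. integrable M (f k)" and nn: "\<And>k. AE x in M. 0 \<le> f k x"
    and lim: "AE x in M. (\<lambda>k. f k x) \<longlonglongrightarrow> g x" and B: "\<And>k. (\<integral>x. f k x \<partial>M) \<le> B"
    and [measurable]: "g \<in> borel_measurable M"
  shows "integrable M g"
proof -
  have [measurable]: "f k \<in> borel_measurable M" for k using f by auto
  have nn': "AE x in M. \<forall>k. 0 \<le> f k x" using nn by (simp add: AE_all_countable)
  have "(\<integral>\<^sup>+x. ennreal (norm (g x)) \<partial>M) = (\<integral>\<^sup>+x. liminf (\<lambda>k. ennreal (f k x)) \<partial>M)"
  proof (rule nn_integral_cong_AE)
    show "AE x in M. ennreal (norm (g x)) = liminf (\<lambda>k. ennreal (f k x))"
      using lim nn'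
    proof eventually_elim
      case (elim x)
      then have "0 \<le> g x" by (intro LIMSEQ_le_const) auto
      moreover have "(\<lambda>k. ennreal (f k x)) \<longlonglongrightarrow> ennreal (g x)" using elim by (intro tendsto_ennrealI) auto
      ultimately show ?case using lim_imp_Liminf[of sequentially "\<lambda>k. ennreal (f k x)"] by simp
    qed
  qed
  also have "\<dots> \<le> liminf (\<lambda>k. \<integral>\<^sup>+x. ennreal (f k x) \<partial>M)" by (rule nn_integral_liminf) simp
  also have "\<dots> \<le> limsup (\<lambda>k. \<integral>\<^sup>+x. ennreal (f k x) \<partial>M)" by (rule Liminf_le_Limsup) simp
  also have "\<dots> \<le> ennreal B"
  proof (rule Limsup_bounded, rule always_eventually, rule allI)
    fix k
    have "(\<integral>\<^sup>+x. ennreal (f k x) \<partial>M) = ennreal (\<integral>x. f k x \<partial>M)" by (rule nn_integral_eq_integral[OF f nn])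
    then show "(\<integral>\<^sup>+x. ennreal (f k x) \<partial>M) \<le> ennreal B" using B[of k] by (simp add: ennreal_leI)
  qed
  also have "\<dots> < \<infinity>" by simp
  finally show ?thesis by (intro integrableI_bounded) auto
qed

text \<open>By Markov's inequality the event has probability at most e B for every e > 0. It serves
  both for singular residual matrices and for vanishing \<open>c\<close>.\<close>

lemma (in prob_space) AE_not_by_Markov:
  assumes [measurable]: "{x \<in> space M. P x} \<in> events"
    and f: "\<And>e :: real. 0 < e \<Longrightarrow> integrable M (f e)" "\<And>e x. 0 < e \<Longrightarrow> 0 \<le> f e x"
      "\<And>e x. 0 < e \<Longrightarrow> P x \<Longrightarrow> 1 \<le> e * f e x" "\<And>e. 0 < e \<Longrightarrow> (\<integral>x. f e x \<partial>M) \<le> B"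
  shows "AE x in M. \<not> P x"
proof -
  let ?A = "{x \<in> space M. P x}"
  have le: "prob ?A \<le> e * B" if "0 < e" for e
  proof -
    have "prob ?A = (\<integral>x. indicator ?A x \<partial>M)" by simp
    also have "\<dots> \<le> (\<integral>x. e * f e x \<partial>M)"
    proof (rule integral_mono)
      show "integrable M (\<lambda>x. indicator ?A x :: real)" by (intro integrable_real_indicator) (auto simp: emeasure_eq_measure)
    qed (use f[OF that] that in \<open>auto simp: indicator_def\<close>)
    also have "\<dots> \<le> e * B" using f(4)[OF that] that by simp
    finally show ?thesis .
  qed
  have "prob ?A = 0"
  proof (rule ccontr)
    assume "prob ?A \<noteq> 0"
    then have pos: "0 < prob ?A" using zero_less_measure_iff by blast
    have "0 < B" using le[of 1] pos by simp
    have "prob ?A \<le> (prob ?A / (2 * B)) * B" using pos \<open>0 < B\<close> by (intro le) simp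
    then show False using pos \<open>0 < B\<close> by simp
  qed
  then show ?thesis by (subst (asm) prob_eq_0) auto
qed

context normal_model
begin

section \<open>Almost sure invertibility and the first inverse moment\<close>

definition Kinv :: "real^'p^'n \<Rightarrow> real^'p^'p" where "Kinv Y = matrix_inv (SS Y)"

lemma Kinv_measurable [measurable]: "Kinv \<in> borel_measurable borel"
  unfolding Kinv_def by measurable

lemma haff_bound:
  fixes X :: "real^'p^'n \<Rightarrow> real^'p"
  assumes e: "0 < e" and df: "real CARD('p) + 1 < trace N"
    and X: "poly_growth X" and X_line: "\<And>Y t v w. X (Y + t *\<^sub>R outer (N *v v) w) = X Y"
    and C: "0 < C" "\<And>y z. \<bar>y \<bullet> (Om *v z)\<bar> \<le> C * norm y * norm z"
  shows "(trace N - real CARD('p) - 1) * (\<integral>Y. X Y \<bullet> (K e Y *v X Y) \<partial>law) \<le> (\<integral>Y. 2 * C * (X Y \<bullet> X Y) \<partial>law)"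
proof -
  define a where "a Y = K e Y *v X Y" for Y
  define c where "c Y = X Y \<bullet> a Y" for Y
  have pa: "poly_growth a" unfolding a_def by (rule poly_growth_K[OF e X])
  have pc: "poly_growth c" unfolding c_def by (intro poly_growth_inner X pa)
  have c0: "0 \<le> c Y" for Y
    unfolding c_def a_def K_def by (intro psdD(2) psd_ridge_inv psd_SS e)
  note pg = poly_growth_integrable[OF pd] poly_growth_mult poly_growth_diff poly_growth_inner poly_growth_scaleR
    poly_growth_matrix_vector_mult poly_growth_const poly_growth_trace_K X pa pc e
  have "(\<integral>Y. (X Y - e *\<^sub>R a Y) \<bullet> (Om *v X Y) \<partial>law) =
     (\<integral>Y. (trace N * c Y - (c Y - e * (a Y \<bullet> a Y)) - c Y * (real CARD('p) - e * trace (K e Y))) \<partial>law)"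
    using ridge_haff_identity[OF e X X_line, of "\<lambda>_. 1" "\<lambda>_. 0" 1] by (simp add: a_def c_def)
  moreover have "(\<integral>Y. (trace N - real CARD('p) - 1) * c Y \<partial>law) \<le>
     (\<integral>Y. (trace N * c Y - (c Y - e * (a Y \<bullet> a Y)) - c Y * (real CARD('p) - e * trace (K e Y))) \<partial>law)"
  proof (rule integral_mono)
    fix Y
    have "0 \<le> e * (a Y \<bullet> a Y)" "0 \<le> c Y * (e * trace (K e Y))"
      using e c0[of Y] psd_trace_nonneg[OF psd_ridge_inv[OF psd_SS e]] by (auto simp: K_def)
    then show "(trace N - real CARD('p) - 1) * c Y \<le> trace N * c Y - (c Y - e * (a Y \<bullet> a Y)) - c Y * (real CARD('p) - e * trace (K e Y))"
      by (simp add: algebra_simps)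
  qed (intro pg)+
  moreover have "(\<integral>Y. (X Y - e *\<^sub>R a Y) \<bullet> (Om *v X Y) \<partial>law) \<le> (\<integral>Y. 2 * C * (X Y \<bullet> X Y) \<partial>law)"
  proof (rule integral_mono)
    fix Y
    have n: "norm (X Y - e *\<^sub>R a Y) \<le> 2 * norm (X Y)"
      using norm_triangle_ineq4[of "X Y" "e *\<^sub>R a Y"] ridge_inv_norm_le[OF psd_SS e, of Y "X Y"] e
      by (simp add: a_def K_def)
    have "(X Y - e *\<^sub>R a Y) \<bullet> (Om *v X Y) \<le> C * norm (X Y - e *\<^sub>R a Y) * norm (X Y)"
      using C(2)[of "X Y - e *\<^sub>R a Y" "X Y"] by linarith
    also have "\<dots> \<le> C * (2 * norm (X Y)) * norm (X Y)"
      using n C(1) by (intro mult_right_mono mult_left_mono) auto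
    finally show "(X Y - e *\<^sub>R a Y) \<bullet> (Om *v X Y) \<le> 2 * C * (X Y \<bullet> X Y)"
      by (simp add: dot_square_norm power2_eq_square mult_ac)
  qed (intro pg)+
  ultimately show ?thesis by (simp add: c_def a_def)
qed

text \<open>The constant vectors \<open>axis j 1\<close> in the Haff bound control E tr K uniformly
  in the ridge, whereas tr K is at least 1 / e wherever \<open>SS Y\<close> is singular.\<close>

lemma AE_det_SS:
  assumes df: "real CARD('p) + 1 < trace N"
  shows "AE Y in law. det (SS Y) \<noteq> 0"
proof -
  obtain C where C: "0 < C" "\<And>y z. \<bar>y \<bullet> (Om *v z)\<bar> \<le> C * norm y * norm z" by (rule matrix_inner_bound[of Om]) blast
  let ?kap = "trace N - real CARD('p) - 1"
  have kap: "0 < ?kap" using df by simp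
  have Kj: "(\<integral>Y. axis j 1 \<bullet> (K e Y *v axis j 1) \<partial>law) \<le> 2 * C / ?kap" if "0 < e" for e and j :: 'p
    using haff_bound[OF that df poly_growth_const _ C, of "axis j 1"] kap
    using law.prob_space by (simp add: inner_axis_axis field_simps)
  show ?thesis
  proof (rule law.AE_not_by_Markov[where f="\<lambda>e Y. trace (K e Y)" and B="real CARD('p) * (2 * C / ?kap)"])
    show "{x \<in> space law. det (SS x) = 0} \<in> law.events"
      using borel_measurable_det[of SS borel] by simp
    fix e :: real assume e: "0 < e"
    show "integrable law (\<lambda>Y. trace (K e Y))" by (rule poly_growth_integrable[OF pd poly_growth_trace_K[OF e]])
    show "0 \<le> trace (K e Y)" for Y unfolding K_def by (intro psd_trace_nonneg psd_ridge_inv psd_SS e)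
    show "1 \<le> e * trace (K e Y)" if "det (SS Y) = 0" for Y
      using ridge_inv_trace_ge[OF psd_SS e that] by (simp add: K_def)
    have "(\<integral>Y. trace (K e Y) \<partial>law) = (\<Sum>j\<in>(UNIV::'p set). \<integral>Y. axis j 1 \<bullet> (K e Y *v axis j 1) \<partial>law)"
      unfolding trace_eq_sum_inner_axis
      by (rule Bochner_Integration.integral_sum)
         (intro poly_growth_integrable[OF pd] poly_growth_inner poly_growth_K poly_growth_const e)
    also have "\<dots> \<le> (\<Sum>j\<in>(UNIV::'p set). 2 * C / ?kap)" by (intro sum_mono Kj e)
    finally show "(\<integral>Y. trace (K e Y) \<partial>law) \<le> real CARD('p) * (2 * C / ?kap)" by simp
  qed
qed

text \<open>One sequence serves for the ridges and later for the shifts, since Fatou and dominated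
  convergence concern sequences.\<close>

definition eps :: "nat \<Rightarrow> real" where "eps k = 1 / real (Suc k)"

lemma eps_pos: "0 < eps k" and eps_le: "eps k \<le> 1" and eps_lim: "eps \<longlonglongrightarrow> 0"
  by (simp_all add: eps_def[abs_def] LIMSEQ_inverse_real_of_nat[unfolded inverse_eq_divide] del: of_nat_Suc)

lemma K_eps_lim:
  assumes "det (SS Y) \<noteq> 0"
  shows "(\<lambda>k. K (eps k) Y) \<longlonglongrightarrow> Kinv Y"
  unfolding K_def Kinv_def
proof (rule tendsto_matrix_inv[OF _ assms])
  have "(\<lambda>k. SS Y + eps k *\<^sub>R mat 1) \<longlonglongrightarrow> SS Y + 0 *\<^sub>R mat 1"
    by (intro tendsto_intros eps_lim)
  then show "(\<lambda>k. SS Y + eps k *\<^sub>R mat 1) \<longlonglongrightarrow> SS Y" by simp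
qed

lemma K_eps_vector_lim:
  assumes "det (SS Y) \<noteq> 0"
  shows "(\<lambda>k. K (eps k) Y *v z) \<longlonglongrightarrow> Kinv Y *v z"
proof -
  interpret mv: bounded_bilinear "\<lambda>(A::real^'p^'p) (x::real^'p). A *v x"
    by (rule bounded_bilinear_matrix_vector_mult)
  show ?thesis by (intro mv.tendsto K_eps_lim assms tendsto_const)
qed

lemma K_eps_trace_lim:
  assumes "det (SS Y) \<noteq> 0"
  shows "(\<lambda>k. trace (K (eps k) Y)) \<longlonglongrightarrow> trace (Kinv Y)"
  unfolding trace_def by (intro tendsto_sum tendsto_vec_nth K_eps_lim assms)

lemma psd_Kinv: "det (SS Y) \<noteq> 0 \<Longrightarrow> psd (Kinv Y)"
  unfolding Kinv_def by (intro pos_def_imp_psd pos_def_matrix_inv) (simp add: psd_pos_def_iff[OF psd_SS])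

text \<open>Integrability comes from Fatou and the uniform Haff bound. After that the limit
  dominates its own approximations, because x^T (S + e I)^-1 x never exceeds x^T S^-1 x.\<close>

lemma
  fixes X :: "real^'p^'n \<Rightarrow> real^'p"
  assumes df: "real CARD('p) + 1 < trace N"
    and X: "poly_growth X" and X_line: "\<And>Y t v w. X (Y + t *\<^sub>R outer (N *v v) w) = X Y"
  shows integrable_inverse_form: "integrable law (\<lambda>Y. X Y \<bullet> (Kinv Y *v X Y))"
    and integral_inverse_form: "(trace N - real CARD('p) - 1) * (\<integral>Y. X Y \<bullet> (Kinv Y *v X Y) \<partial>law) =
      (\<integral>Y. X Y \<bullet> (Om *v X Y) \<partial>law)"
proof -
  obtain C where C: "0 < C" "\<And>y z. \<bar>y \<bullet> (Om *v z)\<bar> \<le> C * norm y * norm z" by (rule matrix_inner_bound[of Om]) blast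
  let ?kap = "trace N - real CARD('p) - 1"
  have kap: "0 < ?kap" using df by simp
  have Xm [measurable]: "X \<in> borel_measurable borel" by (rule poly_growth_measurable[OF X])
  define a where "a k Y = K (eps k) Y *v X Y" for k Y
  define c where "c k Y = X Y \<bullet> a k Y" for k Y
  define c0 where "c0 Y = X Y \<bullet> (Kinv Y *v X Y)" for Y
  have pa: "poly_growth (a k)" for k unfolding a_def by (rule poly_growth_K[OF eps_pos X])
  have pc: "poly_growth (c k)" for k unfolding c_def by (intro poly_growth_inner X pa)
  have am [measurable]: "a k \<in> borel_measurable borel" for k by (rule poly_growth_measurable[OF pa])
  have cm [measurable]: "c k \<in> borel_measurable borel" for k by (rule poly_growth_measurable[OF pc])
  have c0m [measurable]: "c0 \<in> borel_measurable borel" unfolding c0_def by measurable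
  have cnn: "0 \<le> c k Y" for k Y
    unfolding c_def a_def K_def by (intro psdD(2) psd_ridge_inv psd_SS eps_pos)
  have alim: "(\<lambda>k. a k Y) \<longlonglongrightarrow> Kinv Y *v X Y" if "det (SS Y) \<noteq> 0" for Y
    unfolding a_def by (rule K_eps_vector_lim[OF that])
  have clim: "(\<lambda>k. c k Y) \<longlonglongrightarrow> c0 Y" if "det (SS Y) \<noteq> 0" for Y
    unfolding c_def c0_def by (intro tendsto_intros alim that)
  note AEd = AE_det_SS[OF df]
  have ic0: "integrable law c0"
  proof (rule integrable_Fatou[where f=c and B="(\<integral>Y. 2 * C * (X Y \<bullet> X Y) \<partial>law) / ?kap"])
    show "integrable law (c k)" for k by (rule poly_growth_integrable[OF pd pc])
    show "(\<integral>Y. c k Y \<partial>law) \<le> (\<integral>Y. 2 * C * (X Y \<bullet> X Y) \<partial>law) / ?kap" for k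
      using haff_bound[OF eps_pos df X X_line C, of k] kap unfolding c_def a_def by (simp add: field_simps)
    show "AE Y in law. (\<lambda>k. c k Y) \<longlonglongrightarrow> c0 Y" using AEd by eventually_elim (rule clim)
  qed (use cnn in auto)
  then show "integrable law (\<lambda>Y. X Y \<bullet> (Kinv Y *v X Y))" unfolding c0_def .
  define R where "R k Y = trace N * c k Y - (c k Y - eps k * (a k Y \<bullet> a k Y)) - c k Y * (real CARD('p) - eps k * trace (K (eps k) Y))" for k Y
  have eq: "(\<integral>Y. (X Y - eps k *\<^sub>R a k Y) \<bullet> (Om *v X Y) \<partial>law) = (\<integral>Y. R k Y \<partial>law)" for k
    using ridge_haff_identity[OF eps_pos X X_line, of "\<lambda>_. 1" "\<lambda>_. 0" 1 k] by (simp add: a_def c_def R_def)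
  have Rm [measurable]: "R k \<in> borel_measurable borel" for k unfolding R_def by measurable
  have "(\<lambda>k. \<integral>Y. (X Y - eps k *\<^sub>R a k Y) \<bullet> (Om *v X Y) \<partial>law) \<longlonglongrightarrow> (\<integral>Y. X Y \<bullet> (Om *v X Y) \<partial>law)"
  proof (rule integral_dominated_convergence[where w="\<lambda>Y. 2 * C * (X Y \<bullet> X Y)"])
    show "integrable law (\<lambda>Y. 2 * C * (X Y \<bullet> X Y))"
      by (intro poly_growth_integrable[OF pd] poly_growth_mult poly_growth_const poly_growth_inner X)
    show "AE Y in law. (\<lambda>k. (X Y - eps k *\<^sub>R a k Y) \<bullet> (Om *v X Y)) \<longlonglongrightarrow> X Y \<bullet> (Om *v X Y)"
      using AEd
    proof eventually_elim
      case (elim Y)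
      have "(\<lambda>k. (X Y - eps k *\<^sub>R a k Y) \<bullet> (Om *v X Y)) \<longlonglongrightarrow> (X Y - 0 *\<^sub>R (Kinv Y *v X Y)) \<bullet> (Om *v X Y)"
        by (intro tendsto_intros eps_lim alim elim)
      then show ?case by simp
    qed
    show "AE Y in law. norm ((X Y - eps k *\<^sub>R a k Y) \<bullet> (Om *v X Y)) \<le> 2 * C * (X Y \<bullet> X Y)" for k
    proof (rule always_eventually, rule allI)
      fix Y
      have n: "norm (X Y - eps k *\<^sub>R a k Y) \<le> 2 * norm (X Y)"
        using norm_triangle_ineq4[of "X Y" "eps k *\<^sub>R a k Y"] ridge_inv_norm_le[OF psd_SS eps_pos, of k Y "X Y"] eps_pos[of k]
        by (simp add: a_def K_def)
      have "\<bar>(X Y - eps k *\<^sub>R a k Y) \<bullet> (Om *v X Y)\<bar> \<le> C * norm (X Y - eps k *\<^sub>R a k Y) * norm (X Y)" by (rule C(2))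
      also have "\<dots> \<le> C * (2 * norm (X Y)) * norm (X Y)"
        using n C(1) by (intro mult_right_mono mult_left_mono) auto
      finally show "norm ((X Y - eps k *\<^sub>R a k Y) \<bullet> (Om *v X Y)) \<le> 2 * C * (X Y \<bullet> X Y)"
        by (simp add: dot_square_norm power2_eq_square mult_ac)
    qed
  qed measurable
  moreover have "(\<lambda>k. \<integral>Y. R k Y \<partial>law) \<longlonglongrightarrow> (\<integral>Y. ?kap * c0 Y \<partial>law)"
  proof (rule integral_dominated_convergence[where w="\<lambda>Y. (trace N + 2 + real CARD('p)) * c0 Y"])
    show "integrable law (\<lambda>Y. (trace N + 2 + real CARD('p)) * c0 Y)" using ic0 by simp
    show "AE Y in law. (\<lambda>k. R k Y) \<longlonglongrightarrow> ?kap * c0 Y" using AEd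
    proof eventually_elim
      case (elim Y)
      have "(\<lambda>k. R k Y) \<longlonglongrightarrow> trace N * c0 Y - (c0 Y - 0 * ((Kinv Y *v X Y) \<bullet> (Kinv Y *v X Y))) - c0 Y * (real CARD('p) - 0 * trace (Kinv Y))"
        unfolding R_def by (intro tendsto_intros eps_lim alim clim K_eps_trace_lim elim)
      then show ?case by (simp add: algebra_simps)
    qed
    show "AE Y in law. norm (R k Y) \<le> (trace N + 2 + real CARD('p)) * c0 Y" for k using AEd
    proof eventually_elim
      case (elim Y)
      have 1: "c k Y \<le> c0 Y" unfolding c_def a_def c0_def K_def Kinv_def by (rule ridge_inv_le_inv[OF psd_SS eps_pos elim])
      \<comment> \<open>Each ridge correction lies between 0 and the term that it corrects, so a
        multiple of the limit form alone dominates the right-hand side.\<close>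
      have 2: "0 \<le> eps k * (a k Y \<bullet> a k Y)" "eps k * (a k Y \<bullet> a k Y) \<le> c k Y"
        using eps_pos[of k] ridge_inv_sq_le[OF psd_SS eps_pos, of k Y "X Y"] by (simp_all add: c_def a_def K_def)
      have 3: "0 \<le> eps k * trace (K (eps k) Y)" "eps k * trace (K (eps k) Y) \<le> real CARD('p)"
        using eps_pos[of k] psd_trace_nonneg[OF psd_ridge_inv[OF psd_SS eps_pos]] ridge_inv_trace_le[OF psd_SS eps_pos]
        by (simp_all add: K_def)
      have 4: "\<bar>c k Y * (real CARD('p) - eps k * trace (K (eps k) Y))\<bar> \<le> real CARD('p) * c k Y"
        using mult_left_mono[of "\<bar>real CARD('p) - eps k * trace (K (eps k) Y)\<bar>" "real CARD('p)" "c k Y"] 3 cnn[of k Y]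
        by (simp add: abs_mult mult_ac)
      have t: "0 \<le> trace N" using df by linarith
      have "\<bar>R k Y\<bar> \<le> trace N * c k Y + 2 * c k Y + real CARD('p) * c k Y"
        using 2 4 mult_nonneg_nonneg[OF t cnn[of k Y]] cnn[of k Y] unfolding R_def by linarith
      also have "\<dots> = (trace N + 2 + real CARD('p)) * c k Y" by (simp add: algebra_simps)
      also have "\<dots> \<le> (trace N + 2 + real CARD('p)) * c0 Y" using 1 t by (intro mult_left_mono) auto
      finally show ?case by simp
    qed
  qed measurable
  ultimately have "(\<integral>Y. X Y \<bullet> (Om *v X Y) \<partial>law) = (\<integral>Y. ?kap * c0 Y \<partial>law)"
    unfolding eq by (rule LIMSEQ_unique)
  then show "?kap * (\<integral>Y. X Y \<bullet> (Kinv Y *v X Y) \<partial>law) = (\<integral>Y. X Y \<bullet> (Om *v X Y) \<partial>law)"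
    by (simp add: c0_def)
qed


section \<open>First and second moments of linear statistics\<close>

lemma score_outer: "row_form Om (Y - M) (outer r w) = (transpose Y *v r - transpose M *v r) \<bullet> (Om *v w)"
  unfolding row_form_outer transpose_mult_eq_sum by (simp add: scaleR_diff_right sum_subtractf)

lemma poly_growth_centred: "poly_growth (\<lambda>Y. transpose Y *v r - transpose M *v r)"
  by (intro poly_growth_diff poly_growth_transpose_mult poly_growth_const)

text \<open>Stein's identity for a constant function: the score has mean zero.\<close>

lemma integral_centred: "(\<integral>Y. (transpose Y *v r - transpose M *v r) \<bullet> (Om *v w) \<partial>law) = 0"
proof -
  have "(\<integral>Y. 1 * row_form Om (Y - M) (outer r w) \<partial>law) = (\<integral>Y. 0 \<partial>law)"
    by (rule stein_identity[OF pd]; (simp add: score_outer)?)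
       (intro poly_growth_integrable[OF pd] poly_growth_inner poly_growth_centred poly_growth_const)
  then show ?thesis by (simp add: score_outer)
qed

lemma inner_Om_axis_sum:
  fixes x z :: "real^'p"
  shows "(\<Sum>j\<in>UNIV. x $ j * (z \<bullet> (Om *v axis j 1))) = z \<bullet> (Om *v x)"
proof -
  have "z \<bullet> (Om *v x) = z \<bullet> (Om *v (\<Sum>j\<in>UNIV. x $ j *\<^sub>R axis j 1))" using vec_eq_sum_axis[of x] by simp
  then show ?thesis
    by (simp add: linear_sum[OF matrix_vector_mul_linear] matrix_vector_mult_scaleR inner_sum_right)
qed

lemma poly_growth_nth:
  fixes f :: "real^'p^'n \<Rightarrow> real^'p"
  assumes "poly_growth f" shows "poly_growth (\<lambda>Y. f Y $ j)"
  using poly_growth_inner[OF assms poly_growth_const[of "axis j 1"]] by (simp add: inner_axis)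

text \<open>Stein's identity for coordinate \<open>j\<close> of the centred vector, in direction r
  e_j^T. Each of the p coordinates contributes |r|^2.\<close>

lemma integral_centred_quad:
  "(\<integral>Y. (transpose Y *v r - transpose M *v r) \<bullet> (Om *v (transpose Y *v r - transpose M *v r)) \<partial>law) = real CARD('p) * (r \<bullet> r)"
proof -
  let ?z = "\<lambda>Y. transpose Y *v r - transpose M *v r"
  have j: "(\<integral>Y. ?z Y $ j * row_form Om (Y - M) (outer r (axis j 1)) \<partial>law) = (\<integral>Y. r \<bullet> r \<partial>law)" for j
  proof (rule stein_identity[OF pd])
    show "((\<lambda>t. ?z (Y + t *\<^sub>R outer r (axis j 1)) $ j) has_real_derivative r \<bullet> r) (at 0)" for Y
      unfolding transpose_mult_outer by (auto intro!: derivative_eq_intros)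
    show "integrable law (\<lambda>Y. ?z Y $ j * row_form Om (Y - M) (outer r (axis j 1)))"
      unfolding score_outer
      by (intro poly_growth_integrable[OF pd] poly_growth_mult poly_growth_inner poly_growth_centred poly_growth_const poly_growth_nth)
    show "integrable law (\<lambda>Y. ?z Y $ j)"
      by (intro poly_growth_integrable[OF pd] poly_growth_centred poly_growth_nth)
  qed auto
  have ij: "integrable law (\<lambda>Y. ?z Y $ j * row_form Om (Y - M) (outer r (axis j 1)))" for j
    unfolding score_outer
    by (intro poly_growth_integrable[OF pd] poly_growth_mult poly_growth_inner poly_growth_centred poly_growth_const poly_growth_nth)
  have "(\<integral>Y. ?z Y \<bullet> (Om *v ?z Y) \<partial>law) = (\<integral>Y. (\<Sum>j\<in>UNIV. ?z Y $ j * row_form Om (Y - M) (outer r (axis j 1))) \<partial>law)"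
    unfolding score_outer inner_Om_axis_sum ..
  also have "\<dots> = (\<Sum>j\<in>(UNIV::'p set). \<integral>Y. ?z Y $ j * row_form Om (Y - M) (outer r (axis j 1)) \<partial>law)"
    by (rule Bochner_Integration.integral_sum) (rule ij)
  finally show ?thesis unfolding j using law.prob_space by simp
qed

lemma integral_quad:
  "(\<integral>Y. (transpose Y *v r) \<bullet> (Om *v (transpose Y *v r)) \<partial>law) =
    real CARD('p) * (r \<bullet> r) + (transpose M *v r) \<bullet> (Om *v (transpose M *v r))"
proof -
  let ?x = "\<lambda>Y. transpose Y *v r" and ?m = "transpose M *v r"
  have sym: "u \<bullet> (Om *v w) = w \<bullet> (Om *v u)" for u w
    using psdD(3)[OF pos_def_imp_psd[OF pos_def_matrix_inv[OF pd]], of u w] by (simp add: inner_commute)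
  have ex: "u \<bullet> (Om *v u) = (u - m) \<bullet> (Om *v (u - m)) + 2 * ((u - m) \<bullet> (Om *v m)) + m \<bullet> (Om *v m)" for u m
    by (simp add: matrix_vector_mult_diff_distrib inner_diff_left inner_diff_right) (rule sym)
  have "(\<integral>Y. ?x Y \<bullet> (Om *v ?x Y) \<partial>law) =
     (\<integral>Y. (?x Y - ?m) \<bullet> (Om *v (?x Y - ?m)) + 2 * ((?x Y - ?m) \<bullet> (Om *v ?m)) + ?m \<bullet> (Om *v ?m) \<partial>law)"
    by (rule Bochner_Integration.integral_cong[OF refl]) (rule ex)
  also have "\<dots> = (\<integral>Y. (?x Y - ?m) \<bullet> (Om *v (?x Y - ?m)) \<partial>law) + 2 * (\<integral>Y. (?x Y - ?m) \<bullet> (Om *v ?m) \<partial>law) + ?m \<bullet> (Om *v ?m)"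
  proof -
    have i: "integrable law (\<lambda>Y. (?x Y - ?m) \<bullet> (Om *v (?x Y - ?m)))" "integrable law (\<lambda>Y. (?x Y - ?m) \<bullet> (Om *v ?m))"
      by (intro poly_growth_integrable[OF pd] poly_growth_inner poly_growth_centred poly_growth_matrix_vector_mult poly_growth_const)+
    show ?thesis using i law.prob_space by simp
  qed
  finally show ?thesis by (simp add: integral_centred integral_centred_quad)
qed

section \<open>Directions orthogonal to the residuals\<close>

context
  fixes r :: "real^'n"
  assumes Nr: "N *v r = 0"
begin

lemma V_orth_line: "V (Y + t *\<^sub>R outer r w) i = V Y i"
proof -
  have "r \<bullet> (N *v axis i 1) = 0" using inner_N[of r "axis i 1"] Nr by simp
  then show ?thesis by (simp add: V_def transpose_mult_outer)
qed

text \<open>The rows of \<open>N ** Y\<close> do not move because N r = 0, so the regularised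
  inverse is a constant in the computation that follows.\<close>

lemma SS_orth_line: "SS (Y + t *\<^sub>R outer r w) = SS Y"
  unfolding matrix_eq
proof
  fix a
  have "b \<bullet> (SS (Y + t *\<^sub>R outer r w) *v a) = b \<bullet> (SS Y *v a)" for b
    by (simp add: inner_SS V_orth_line)
  then show "SS (Y + t *\<^sub>R outer r w) *v a = SS Y *v a" by (metis vector_eq_rdot inner_commute)
qed

lemma transpose_mult_N_line: "transpose (Y + t *\<^sub>R outer (N *v v) w) *v r = transpose Y *v r"
  by (simp add: transpose_mult_outer inner_N Nr)

text \<open>The field is x / (c + de) in the directions r e_j^T. The divergence of x gives p / (c +
  de), and the chain rule through \<open>c\<close> gives - 2 c / (c + de)^2; together they tend to
  (p - 2) / c. The shift bounds the factor where \<open>c\<close> vanishes.\<close>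

lemma ridge_stein_shrinkage:
  assumes e: "0 < e" and de: "0 < de"
  defines "x \<equiv> \<lambda>Y :: real^'p^'n. transpose Y *v r"
  defines "c \<equiv> \<lambda>Y. x Y \<bullet> (K e Y *v x Y)"
  shows "(\<integral>Y. ((x Y - transpose M *v r) \<bullet> (Om *v x Y)) / (c Y + de) \<partial>law) =
     (\<integral>Y. (r \<bullet> r) * (real CARD('p) / (c Y + de) - 2 * c Y / (c Y + de)\<^sup>2) \<partial>law)"
proof -
  define a where "a Y = K e Y *v x Y" for Y
  define q where "q Y = 1 / (c Y + de)" for Y
  have px: "poly_growth x" unfolding x_def by (rule poly_growth_transpose_mult)
  have pa: "poly_growth a" unfolding a_def by (rule poly_growth_K[OF e px])
  have pc: "poly_growth c" unfolding c_def a_def[symmetric] by (intro poly_growth_inner px pa)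
  have [measurable]: "c \<in> borel_measurable borel" by (rule poly_growth_measurable[OF pc])
  have psdK: "psd (K e Y)" for Y unfolding K_def by (rule psd_ridge_inv[OF psd_SS e])
  have c0: "0 \<le> c Y" for Y unfolding c_def by (rule psdD(2)[OF psdK])
  have pq: "poly_growth q"
  proof (rule poly_growth_bounded[of _ "1 / de"])
    show "q \<in> borel_measurable borel" unfolding q_def by measurable
    show "norm (q Y) \<le> 1 / de" for Y using c0[of Y] de by (simp add: q_def frac_le)
  qed
  define g where "g j Y = x Y $ j * q Y" for j Y
  define g' where "g' j Y = (r \<bullet> r) * q Y - x Y $ j * (2 * (r \<bullet> r) * a Y $ j * (q Y * q Y))" for j Y
  have pg: "poly_growth (g j)" for j unfolding g_def by (intro poly_growth_mult poly_growth_nth px pq)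
  have pg': "poly_growth (g' j)" for j
    unfolding g'_def by (intro poly_growth_mult poly_growth_diff poly_growth_nth px pq pa poly_growth_const)
  have psc: "poly_growth (\<lambda>Y. row_form Om (Y - M) (outer r (axis j 1)))" for j
    unfolding score_outer by (intro poly_growth_inner poly_growth_centred poly_growth_const)
  have st: "(\<integral>Y. g j Y * row_form Om (Y - M) (outer r (axis j 1)) \<partial>law) = (\<integral>Y. g' j Y \<partial>law)" for j
  proof (rule stein_identity[OF pd])
    fix Y
    let ?E = "outer r (axis j 1) :: real^'p^'n" and ?k = "axis j 1 \<bullet> (K e Y *v axis j 1)"
    have xt: "x (Y + t *\<^sub>R ?E) = x Y + (t * (r \<bullet> r)) *\<^sub>R axis j 1" for t
      by (simp add: x_def transpose_mult_outer)
    \<comment> \<open>Along the line \<open>c\<close> is exactly quadratic in \<open>t\<close>: the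
      vector moves linearly and the matrix is fixed.\<close>
    have ct: "c (Y + t *\<^sub>R ?E) = c Y + 2 * t * (r \<bullet> r) * a Y $ j + (t * (r \<bullet> r))\<^sup>2 * ?k" for t
    proof -
      have "K e (Y + t *\<^sub>R ?E) = K e Y" by (simp add: K_def SS_orth_line)
      moreover have "x Y \<bullet> (K e Y *v axis j 1) = a Y $ j" "axis j 1 \<bullet> (K e Y *v x Y) = a Y $ j"
        unfolding psdD(3)[OF psdK] a_def[symmetric] by (simp_all add: inner_axis inner_axis' a_def)
      ultimately show ?thesis unfolding c_def xt
        by (simp add: matrix_vector_right_distrib matrix_vector_mult_scaleR inner_add_left inner_add_right power2_eq_square algebra_simps)
    qed
    have nz: "c Y + de \<noteq> 0" using c0[of Y] de by simp
    show "((\<lambda>t. g j (Y + t *\<^sub>R ?E)) has_real_derivative g' j Y) (at 0)"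
    proof -
      have "((\<lambda>t. c (Y + t *\<^sub>R ?E)) has_real_derivative 2 * (r \<bullet> r) * a Y $ j) (at 0)"
        unfolding ct by (auto intro!: derivative_eq_intros)
      then have "((\<lambda>t. q (Y + t *\<^sub>R ?E)) has_real_derivative - (2 * (r \<bullet> r) * a Y $ j * (q Y * q Y))) (at 0)"
        unfolding q_def using nz by (auto intro!: derivative_eq_intros)
      moreover have "((\<lambda>t. x (Y + t *\<^sub>R ?E) $ j) has_real_derivative r \<bullet> r) (at 0)"
        unfolding xt by (auto intro!: derivative_eq_intros)
      ultimately have "((\<lambda>t. x (Y + t *\<^sub>R ?E) $ j * q (Y + t *\<^sub>R ?E)) has_real_derivative
          (r \<bullet> r) * q (Y + 0 *\<^sub>R ?E) + - (2 * (r \<bullet> r) * a Y $ j * (q Y * q Y)) * x (Y + 0 *\<^sub>R ?E) $ j) (at 0)"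
        by (intro DERIV_mult)
      then show ?thesis unfolding g_def g'_def by (rule DERIV_cong) simp
    qed
  qed (intro poly_growth_measurable poly_growth_integrable[OF pd] poly_growth_mult pg pg' psc)+
  have "(\<integral>Y. ((x Y - transpose M *v r) \<bullet> (Om *v x Y)) / (c Y + de) \<partial>law) =
     (\<integral>Y. (\<Sum>j\<in>UNIV. g j Y * row_form Om (Y - M) (outer r (axis j 1))) \<partial>law)"
  proof (rule Bochner_Integration.integral_cong[OF refl])
    fix Y
    have "(\<Sum>j\<in>UNIV. g j Y * row_form Om (Y - M) (outer r (axis j 1))) =
        q Y * (\<Sum>j\<in>UNIV. x Y $ j * ((x Y - transpose M *v r) \<bullet> (Om *v axis j 1)))"
      unfolding score_outer g_def by (simp add: sum_distrib_left x_def mult_ac)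
    then show "((x Y - transpose M *v r) \<bullet> (Om *v x Y)) / (c Y + de) = (\<Sum>j\<in>UNIV. g j Y * row_form Om (Y - M) (outer r (axis j 1)))"
      unfolding inner_Om_axis_sum by (simp add: q_def)
  qed
  also have "\<dots> = (\<integral>Y. (\<Sum>j\<in>UNIV. g' j Y) \<partial>law)"
    by (subst (1 2) Bochner_Integration.integral_sum)
       (auto simp: st intro!: poly_growth_integrable[OF pd] poly_growth_mult pg pg' psc)
  also have "\<dots> = (\<integral>Y. (r \<bullet> r) * (real CARD('p) / (c Y + de) - 2 * c Y / (c Y + de)\<^sup>2) \<partial>law)"
  proof (rule Bochner_Integration.integral_cong[OF refl])
    fix Y
    have "(\<Sum>j\<in>UNIV. g' j Y) = (\<Sum>j\<in>(UNIV::'p set). (r \<bullet> r) * q Y) - 2 * (r \<bullet> r) * (q Y * q Y) * (\<Sum>j\<in>UNIV. x Y $ j * a Y $ j)"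
      unfolding g'_def sum_subtractf sum_distrib_left by (simp add: mult_ac)
    also have "(\<Sum>j\<in>UNIV. x Y $ j * a Y $ j) = c Y" by (simp add: c_def a_def inner_vec_def)
    finally show "(\<Sum>j\<in>UNIV. g' j Y) = (r \<bullet> r) * (real CARD('p) / (c Y + de) - 2 * c Y / (c Y + de)\<^sup>2)"
      by (simp add: q_def power2_eq_square algebra_simps)
  qed
  finally show ?thesis .
qed

end

end

section \<open>Shrinkage along a direction orthogonal to the residuals\<close>

text \<open>All bounds come from 0 <= c / (c + d) <= 1. Those by 1 / d serve the limit in the ridge
  at fixed shift, those by 1 / (c + d) the limit in the shift.\<close>

lemma shrink_factor_bounds:
  fixes c d :: real
  assumes "0 \<le> c" "0 < d"
  shows "0 \<le> 1 / (c + d)" "1 / (c + d) \<le> 1 / d" "0 \<le> c / (c + d)\<^sup>2" "c / (c + d)\<^sup>2 \<le> 1 / (c + d)"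
    "0 \<le> c\<^sup>2 / (c + d) ^ 3" "c\<^sup>2 / (c + d) ^ 3 \<le> 1 / (c + d)"
proof -
  have s: "0 < c + d" using assms by simp
  show "0 \<le> 1 / (c + d)" "0 \<le> c / (c + d)\<^sup>2" "0 \<le> c\<^sup>2 / (c + d) ^ 3" using assms by simp_all
  show "1 / (c + d) \<le> 1 / d" using assms by (intro frac_le) auto
  have "c / (c + d) \<le> 1" using s assms by (simp add: divide_le_eq)
  have a: "0 \<le> c / (c + d)" using s assms by simp
  have "c / (c + d)\<^sup>2 = (c / (c + d)) * (1 / (c + d))" by (simp add: power2_eq_square)
  also have "\<dots> \<le> 1 * (1 / (c + d))" by (intro mult_right_mono) (use s \<open>c / (c + d) \<le> 1\<close> in auto)
  finally show "c / (c + d)\<^sup>2 \<le> 1 / (c + d)" by simp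
  have "c\<^sup>2 / (c + d) ^ 3 = (c / (c + d)) * (c / (c + d)\<^sup>2)" by (simp add: power2_eq_square power3_eq_cube)
  also have "\<dots> \<le> 1 * (1 / (c + d))"
    by (rule mult_mono[OF \<open>c / (c + d) \<le> 1\<close> \<open>c / (c + d)\<^sup>2 \<le> 1 / (c + d)\<close>]) (use assms in simp_all)
  finally show "c\<^sup>2 / (c + d) ^ 3 \<le> 1 / (c + d)" by simp
qed

context normal_model
begin

definition xv :: "real^'n \<Rightarrow> real^'p^'n \<Rightarrow> real^'p" where "xv r Y = transpose Y *v r"
text \<open>For suitable \<open>r\<close> these are the diagonal entries of \<open>C_mat\<close>;
  over the columns of a projection they add up to a trace. Where \<open>SS Y\<close> is singular the
  value rests on the default inverse.\<close>

definition cv :: "real^'n \<Rightarrow> real^'p^'n \<Rightarrow> real" where "cv r Y = xv r Y \<bullet> (Kinv Y *v xv r Y)"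

lemma poly_growth_xv: "poly_growth (xv r)"
  unfolding xv_def[abs_def] by (rule poly_growth_transpose_mult)

lemma xv_measurable [measurable]: "xv r \<in> borel_measurable borel"
  by (rule poly_growth_measurable[OF poly_growth_xv])

lemma cv_measurable [measurable]: "cv r \<in> borel_measurable borel"
  unfolding cv_def by measurable

context
  fixes r :: "real^'n"
  assumes Nr: "N *v r = 0" and df: "real CARD('p) + 1 < trace N"
begin

lemma cv_nonneg: "det (SS Y) \<noteq> 0 \<Longrightarrow> 0 \<le> cv r Y"
  unfolding cv_def by (intro psdD(2) psd_Kinv)

definition ck :: "nat \<Rightarrow> real^'p^'n \<Rightarrow> real" where "ck k Y = xv r Y \<bullet> (K (eps k) Y *v xv r Y)"

lemma ck_nonneg: "0 \<le> ck k Y"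
  unfolding ck_def K_def by (intro psdD(2) psd_ridge_inv psd_SS eps_pos)

lemma ck_lim: "det (SS Y) \<noteq> 0 \<Longrightarrow> (\<lambda>k. ck k Y) \<longlonglongrightarrow> cv r Y"
  unfolding ck_def cv_def by (intro tendsto_intros K_eps_vector_lim)

lemma ck_measurable [measurable]: "ck k \<in> borel_measurable borel"
  unfolding ck_def by measurable

lemma integrable_cross: "integrable law (\<lambda>Y. (xv r Y - xv r M) \<bullet> (Om *v xv r Y))"
  by (intro poly_growth_integrable[OF pd] poly_growth_inner poly_growth_diff poly_growth_const
      poly_growth_matrix_vector_mult poly_growth_xv)

lemma integrable_inverse_cv_plus:
  assumes "0 < de"
  shows "integrable law (\<lambda>Y. 1 / (cv r Y + de))"
proof (rule law.integrable_const_bound[of _ "1 / de"])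
  show "AE Y in law. norm (1 / (cv r Y + de)) \<le> 1 / de"
    using AE_det_SS[OF df] by eventually_elim (use shrink_factor_bounds[OF cv_nonneg assms] assms in simp)
qed measurable

text \<open>The ridge is removed while \<open>de\<close> stays fixed: the factor 1 / de dominates
  one side by a multiple of the integrable cross term and the other by a constant.\<close>

lemma
  assumes de: "0 < de"
  shows integral_shrinkage_plus: "(\<integral>Y. ((xv r Y - xv r M) \<bullet> (Om *v xv r Y)) / (cv r Y + de) \<partial>law) =
     (\<integral>Y. (r \<bullet> r) * (real CARD('p) / (cv r Y + de) - 2 * cv r Y / (cv r Y + de)\<^sup>2) \<partial>law)"
    and integrable_shrinkage_plus: "integrable law (\<lambda>Y. ((xv r Y - xv r M) \<bullet> (Om *v xv r Y)) / (cv r Y + de))"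
    and integrable_shrinkage_plus': "integrable law (\<lambda>Y. (r \<bullet> r) * (real CARD('p) / (cv r Y + de) - 2 * cv r Y / (cv r Y + de)\<^sup>2))"
proof -
  let ?z = "\<lambda>Y. (xv r Y - xv r M) \<bullet> (Om *v xv r Y)"
  let ?L = "\<lambda>k Y. ?z Y / (ck k Y + de)"
  let ?R = "\<lambda>c. (r \<bullet> r) * (real CARD('p) / (c + de) - 2 * c / (c + de)\<^sup>2)"
  note AEd = AE_det_SS[OF df]
  have eq: "(\<integral>Y. ?L k Y \<partial>law) = (\<integral>Y. ?R (ck k Y) \<partial>law)" for k
    using ridge_stein_shrinkage[OF Nr eps_pos de, of k] by (simp add: xv_def ck_def)
  have nz: "cv r Y + de \<noteq> 0" if "det (SS Y) \<noteq> 0" for Y using cv_nonneg[OF that] de by simp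
  have w: "integrable law (\<lambda>Y. \<bar>?z Y\<bar> * (1 / de))" using integrable_cross by simp
  have l1: "AE Y in law. (\<lambda>k. ?L k Y) \<longlonglongrightarrow> ?z Y / (cv r Y + de)"
    using AEd by eventually_elim (intro tendsto_intros ck_lim nz)
  have l2: "AE Y in law. norm (?L k Y) \<le> \<bar>?z Y\<bar> * (1 / de)" for k
  proof (rule always_eventually, rule allI)
    fix Y
    have "norm (?L k Y) = \<bar>?z Y\<bar> * (1 / (ck k Y + de))" using ck_nonneg[of k Y] de by (simp add: abs_mult)
    also have "\<dots> \<le> \<bar>?z Y\<bar> * (1 / de)" by (intro mult_left_mono shrink_factor_bounds ck_nonneg de) simp
    finally show "norm (?L k Y) \<le> \<bar>?z Y\<bar> * (1 / de)" .
  qed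
  have L: "(\<lambda>k. \<integral>Y. ?L k Y \<partial>law) \<longlonglongrightarrow> (\<integral>Y. ?z Y / (cv r Y + de) \<partial>law)"
    by (rule integral_dominated_convergence[OF _ _ w l1 l2]) measurable
  show "integrable law (\<lambda>Y. ?z Y / (cv r Y + de))"
    by (rule integrable_dominated_convergence[OF _ _ w l1 l2]) measurable
  have w': "integrable law (\<lambda>Y. (r \<bullet> r) * ((real CARD('p) + 2) / de))" by simp
  have r1: "AE Y in law. (\<lambda>k. ?R (ck k Y)) \<longlonglongrightarrow> ?R (cv r Y)"
    using AEd
  proof eventually_elim
    case (elim Y)
    then show ?case using nz[OF elim] by (intro tendsto_intros ck_lim) auto
  qed
  have r2: "AE Y in law. norm (?R (ck k Y)) \<le> (r \<bullet> r) * ((real CARD('p) + 2) / de)" for k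
  proof (rule always_eventually, rule allI)
    fix Y
    have "\<bar>real CARD('p) / (ck k Y + de) - 2 * ck k Y / (ck k Y + de)\<^sup>2\<bar> \<le>
        real CARD('p) * (1 / (ck k Y + de)) + 2 * (ck k Y / (ck k Y + de)\<^sup>2)"
      using shrink_factor_bounds[OF ck_nonneg de, of k Y] by (intro order_trans[OF abs_triangle_ineq4]) (simp add: abs_mult)
    also have "\<dots> \<le> real CARD('p) * (1 / de) + 2 * (1 / de)"
      using shrink_factor_bounds[OF ck_nonneg de, of k Y] by (intro add_mono mult_left_mono) linarith+
    also have "\<dots> = (real CARD('p) + 2) / de" by (simp add: add_divide_distrib)
    finally have "(r \<bullet> r) * \<bar>real CARD('p) / (ck k Y + de) - 2 * ck k Y / (ck k Y + de)\<^sup>2\<bar> \<le> (r \<bullet> r) * ((real CARD('p) + 2) / de)"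
      by (intro mult_left_mono) auto
    then show "norm (?R (ck k Y)) \<le> (r \<bullet> r) * ((real CARD('p) + 2) / de)" by (simp add: abs_mult)
  qed
  have R: "(\<lambda>k. \<integral>Y. ?R (ck k Y) \<partial>law) \<longlonglongrightarrow> (\<integral>Y. ?R (cv r Y) \<partial>law)"
    by (rule integral_dominated_convergence[OF _ _ w' r1 r2]) measurable
  show "integrable law (\<lambda>Y. ?R (cv r Y))"
    by (rule integrable_dominated_convergence[OF _ _ w' r1 r2]) measurable
  show "(\<integral>Y. ?z Y / (cv r Y + de) \<partial>law) = (\<integral>Y. ?R (cv r Y) \<partial>law)"
    using L R unfolding eq by (rule LIMSEQ_unique)
qed

text \<open>Haff's identity for h(c) = 1 / (c + de)^2 after removal of the ridge. The term with h'
  contributes 4 c^2 / (c + de)^3; as the shift vanishes the coefficient of 1 / c becomes tr N - p -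
  1 + 4, which is the n - k - p + 3 of the shrinkage factor.\<close>

lemma quad_ratio_plus:
  assumes de: "0 < de"
  shows "integrable law (\<lambda>Y. (xv r Y \<bullet> (Om *v xv r Y)) / (cv r Y + de)\<^sup>2)" (is ?int)
    and "(\<integral>Y. (xv r Y \<bullet> (Om *v xv r Y)) / (cv r Y + de)\<^sup>2 \<partial>law) =
     (\<integral>Y. (trace N - real CARD('p) - 1) * (cv r Y / (cv r Y + de)\<^sup>2) + 4 * ((cv r Y)\<^sup>2 / (cv r Y + de) ^ 3) \<partial>law)" (is ?eq)
proof -
  obtain C where C: "0 < C" "\<And>y z. \<bar>y \<bullet> (Om *v z)\<bar> \<le> C * norm y * norm z" by (rule matrix_inner_bound[of Om]) blast
  define a where "a k Y = K (eps k) Y *v xv r Y" for k Y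
  let ?t = "\<lambda>k Y. real CARD('p) - eps k * trace (K (eps k) Y)" and ?s = "\<lambda>k Y. ck k Y - eps k * (a k Y \<bullet> a k Y)"
  define L where "L k Y = ((xv r Y - eps k *\<^sub>R a k Y) \<bullet> (Om *v xv r Y)) / (ck k Y + de)\<^sup>2" for k Y
  define R where "R k Y = (trace N * ck k Y - ?s k Y - ck k Y * ?t k Y) / (ck k Y + de)\<^sup>2 + 4 * (ck k Y * ?s k Y / (ck k Y + de) ^ 3)" for k Y
  note AEd = AE_det_SS[OF df]
  have am [measurable]: "a k \<in> borel_measurable borel" for k unfolding a_def by measurable
  have [measurable]: "L k \<in> borel_measurable borel" "R k \<in> borel_measurable borel" for k unfolding L_def R_def by measurable
  have eq: "(\<integral>Y. L k Y \<partial>law) = (\<integral>Y. R k Y \<partial>law)" for k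
  proof -
    let ?h = "\<lambda>c. 1 / (c + de)\<^sup>2" and ?h' = "\<lambda>c. - 2 / (c + de) ^ 3"
    have "(\<integral>Y. ?h (ck k Y) * ((xv r Y - eps k *\<^sub>R a k Y) \<bullet> (Om *v xv r Y)) \<partial>law) =
      (\<integral>Y. ?h (ck k Y) * (trace N * ck k Y - ?s k Y - ck k Y * ?t k Y) - 2 * ?h' (ck k Y) * ck k Y * ?s k Y \<partial>law)"
      unfolding ck_def a_def
    proof (rule ridge_haff_identity[OF eps_pos poly_growth_xv])
      show "xv r (Y + t *\<^sub>R outer (N *v v) w) = xv r Y" for Y t v w
        unfolding xv_def by (rule transpose_mult_N_line[OF Nr])
      fix c :: real assume c: "0 \<le> c"
      then have nz: "c + de \<noteq> 0" using de by simp
      show "(?h has_real_derivative ?h' c) (at c)"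
        using nz by (auto intro!: derivative_eq_intros simp: power2_eq_square power3_eq_cube divide_simps)
      have "1 / (c + de)\<^sup>2 \<le> 1 / de\<^sup>2" "2 / (c + de) ^ 3 \<le> 2 / de ^ 3"
        using c de by (intro frac_le power_mono; simp)+
      moreover have "0 \<le> 1 / de\<^sup>2" "0 \<le> 2 / de ^ 3" using de by simp_all
      moreover have "\<bar>?h c\<bar> = 1 / (c + de)\<^sup>2" "\<bar>?h' c\<bar> = 2 / (c + de) ^ 3" using c de by simp_all
      ultimately show "\<bar>?h c\<bar> \<le> 1 / de\<^sup>2 + 2 / de ^ 3" "\<bar>?h' c\<bar> \<le> 1 / de\<^sup>2 + 2 / de ^ 3" by linarith+
    qed measurable
    then show ?thesis by (simp add: L_def R_def mult_ac)
  qed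
  have alim: "(\<lambda>k. a k Y) \<longlonglongrightarrow> Kinv Y *v xv r Y" if "det (SS Y) \<noteq> 0" for Y
    unfolding a_def by (rule K_eps_vector_lim[OF that])
  have nz: "cv r Y + de \<noteq> 0" if "det (SS Y) \<noteq> 0" for Y using cv_nonneg[OF that] de by simp
  have w: "integrable law (\<lambda>Y. 2 * C * (xv r Y \<bullet> xv r Y) / de\<^sup>2)"
    by (intro integrable_divide_zero poly_growth_integrable[OF pd] poly_growth_mult poly_growth_const poly_growth_inner poly_growth_xv)
  have l1: "AE Y in law. (\<lambda>k. L k Y) \<longlonglongrightarrow> (xv r Y \<bullet> (Om *v xv r Y)) / (cv r Y + de)\<^sup>2"
    using AEd
  proof eventually_elim
    case (elim Y)
    have "(\<lambda>k. L k Y) \<longlonglongrightarrow> ((xv r Y - 0 *\<^sub>R (Kinv Y *v xv r Y)) \<bullet> (Om *v xv r Y)) / (cv r Y + de)\<^sup>2"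
      unfolding L_def using nz[OF elim] by (intro tendsto_intros eps_lim alim ck_lim elim) auto
    then show ?case by simp
  qed
  have l2: "AE Y in law. norm (L k Y) \<le> 2 * C * (xv r Y \<bullet> xv r Y) / de\<^sup>2" for k
  proof (rule always_eventually, rule allI)
    fix Y
    have n: "norm (xv r Y - eps k *\<^sub>R a k Y) \<le> 2 * norm (xv r Y)"
      using norm_triangle_ineq4[of "xv r Y" "eps k *\<^sub>R a k Y"] ridge_inv_norm_le[OF psd_SS eps_pos, of k Y "xv r Y"] eps_pos[of k]
      by (simp add: a_def K_def)
    have "\<bar>(xv r Y - eps k *\<^sub>R a k Y) \<bullet> (Om *v xv r Y)\<bar> \<le> C * norm (xv r Y - eps k *\<^sub>R a k Y) * norm (xv r Y)" by (rule C(2))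
    also have "\<dots> \<le> C * (2 * norm (xv r Y)) * norm (xv r Y)"
      using n C(1) by (intro mult_right_mono mult_left_mono) auto
    also have "\<dots> = 2 * C * (xv r Y \<bullet> xv r Y)" by (simp add: dot_square_norm power2_eq_square)
    finally have 1: "\<bar>(xv r Y - eps k *\<^sub>R a k Y) \<bullet> (Om *v xv r Y)\<bar> \<le> 2 * C * (xv r Y \<bullet> xv r Y)" .
    have "norm (L k Y) = \<bar>(xv r Y - eps k *\<^sub>R a k Y) \<bullet> (Om *v xv r Y)\<bar> / (ck k Y + de)\<^sup>2" by (simp add: L_def)
    also have "\<dots> \<le> 2 * C * (xv r Y \<bullet> xv r Y) / de\<^sup>2"
      using 1 de ck_nonneg[of k Y] C(1) by (intro frac_le power_mono) auto
    finally show "norm (L k Y) \<le> 2 * C * (xv r Y \<bullet> xv r Y) / de\<^sup>2" .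
  qed
  have Lc: "(\<lambda>k. \<integral>Y. L k Y \<partial>law) \<longlonglongrightarrow> (\<integral>Y. (xv r Y \<bullet> (Om *v xv r Y)) / (cv r Y + de)\<^sup>2 \<partial>law)"
    by (rule integral_dominated_convergence[OF _ _ w l1 l2]) measurable
  show ?int
    by (rule integrable_dominated_convergence[OF _ _ w l1 l2]) measurable
  let ?B = "(trace N + 1 + real CARD('p)) * (1 / de) + 4 * (1 / de)"
  have w': "integrable law (\<lambda>Y. ?B)" by simp
  have r1: "AE Y in law. (\<lambda>k. R k Y) \<longlonglongrightarrow> (trace N - real CARD('p) - 1) * (cv r Y / (cv r Y + de)\<^sup>2) + 4 * ((cv r Y)\<^sup>2 / (cv r Y + de) ^ 3)"
    using AEd
  proof eventually_elim
    case (elim Y)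
    let ?a = "Kinv Y *v xv r Y"
    have "(\<lambda>k. R k Y) \<longlonglongrightarrow> (trace N * cv r Y - (cv r Y - 0 * (?a \<bullet> ?a)) - cv r Y * (real CARD('p) - 0 * trace (Kinv Y))) / (cv r Y + de)\<^sup>2
        + 4 * (cv r Y * (cv r Y - 0 * (?a \<bullet> ?a)) / (cv r Y + de) ^ 3)"
      unfolding R_def using nz[OF elim] by (intro tendsto_intros eps_lim alim ck_lim K_eps_trace_lim elim) auto
    moreover have "trace N * cv r Y - (cv r Y - 0 * (?a \<bullet> ?a)) - cv r Y * (real CARD('p) - 0 * trace (Kinv Y)) = (trace N - real CARD('p) - 1) * cv r Y"
      by (simp add: algebra_simps)
    ultimately show ?case by (simp add: power2_eq_square)
  qed
  have r2: "AE Y in law. norm (R k Y) \<le> ?B" for k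
  proof (rule always_eventually, rule allI)
    fix Y
    have c0: "0 \<le> ck k Y" by (rule ck_nonneg)
    have t: "0 \<le> trace N" using df by linarith
    have 2: "0 \<le> ?s k Y" "?s k Y \<le> ck k Y"
      using eps_pos[of k] ridge_inv_sq_le[OF psd_SS eps_pos, of k Y "xv r Y"] by (simp_all add: ck_def a_def K_def)
    have 3: "\<bar>?t k Y\<bar> \<le> real CARD('p)"
      using eps_pos[of k] psd_trace_nonneg[OF psd_ridge_inv[OF psd_SS eps_pos]] ridge_inv_trace_le[OF psd_SS eps_pos]
      by (simp add: K_def)
    have "\<bar>trace N * ck k Y - ?s k Y - ck k Y * ?t k Y\<bar> \<le> \<bar>trace N * ck k Y\<bar> + \<bar>?s k Y\<bar> + \<bar>ck k Y * ?t k Y\<bar>" by linarith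
    also have "\<dots> \<le> trace N * ck k Y + ck k Y + ck k Y * real CARD('p)"
      using 2 t c0 mult_left_mono[OF 3 c0] by (simp add: abs_mult)
    also have "\<dots> = (trace N + 1 + real CARD('p)) * ck k Y" by (simp add: algebra_simps)
    finally have 4: "\<bar>trace N * ck k Y - ?s k Y - ck k Y * ?t k Y\<bar> \<le> (trace N + 1 + real CARD('p)) * ck k Y" .
    note b = shrink_factor_bounds[OF c0 de]
    have "norm (R k Y) \<le> \<bar>(trace N * ck k Y - ?s k Y - ck k Y * ?t k Y) / (ck k Y + de)\<^sup>2\<bar> + \<bar>4 * (ck k Y * ?s k Y / (ck k Y + de) ^ 3)\<bar>"
      unfolding R_def real_norm_def by (rule abs_triangle_ineq)
    also have "\<bar>(trace N * ck k Y - ?s k Y - ck k Y * ?t k Y) / (ck k Y + de)\<^sup>2\<bar> \<le> (trace N + 1 + real CARD('p)) * (1 / de)"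
    proof -
      have "\<bar>(trace N * ck k Y - ?s k Y - ck k Y * ?t k Y) / (ck k Y + de)\<^sup>2\<bar> = \<bar>trace N * ck k Y - ?s k Y - ck k Y * ?t k Y\<bar> / (ck k Y + de)\<^sup>2"
        by simp
      also have "\<dots> \<le> (trace N + 1 + real CARD('p)) * ck k Y / (ck k Y + de)\<^sup>2" by (rule divide_right_mono[OF 4]) simp
      also have "\<dots> = (trace N + 1 + real CARD('p)) * (ck k Y / (ck k Y + de)\<^sup>2)" by simp
      also have "\<dots> \<le> (trace N + 1 + real CARD('p)) * (1 / de)"
        by (rule mult_left_mono[OF order_trans[OF b(4) b(2)]]) (use t in simp)
      finally show ?thesis .
    qed
    also have "\<bar>4 * (ck k Y * ?s k Y / (ck k Y + de) ^ 3)\<bar> \<le> 4 * (1 / de)"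
    proof -
      have "\<bar>4 * (ck k Y * ?s k Y / (ck k Y + de) ^ 3)\<bar> = 4 * (ck k Y * ?s k Y / (ck k Y + de) ^ 3)"
        using c0 2 de by (intro abs_of_nonneg mult_nonneg_nonneg divide_nonneg_nonneg) auto
      also have "\<dots> \<le> 4 * ((ck k Y)\<^sup>2 / (ck k Y + de) ^ 3)"
        unfolding power2_eq_square using c0 2 de by (intro mult_left_mono divide_right_mono) auto
      also have "\<dots> \<le> 4 * (1 / de)" by (rule mult_left_mono[OF order_trans[OF b(6) b(2)]]) simp
      finally show ?thesis .
    qed
    finally show "norm (R k Y) \<le> ?B" by simp
  qed
  have Rc: "(\<lambda>k. \<integral>Y. R k Y \<partial>law) \<longlonglongrightarrow>
      (\<integral>Y. (trace N - real CARD('p) - 1) * (cv r Y / (cv r Y + de)\<^sup>2) + 4 * ((cv r Y)\<^sup>2 / (cv r Y + de) ^ 3) \<partial>law)"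
    by (rule integral_dominated_convergence[OF _ _ w' r1 r2]) measurable
  show ?eq using Lc Rc unfolding eq by (rule LIMSEQ_unique)
qed

text \<open>Since |x|^2 <= tr S c, the ratio grows only like c^(-1/2). The arithmetic-geometric mean
  inequality trades it for a term of polynomial growth, independent of the shift, and tau^2 / (c +
  de) with \<open>tau\<close> at choice.\<close>

lemma cross_bound:
  assumes nz: "det (SS Y) \<noteq> 0" and de: "0 < cv r Y + de" and d0: "0 \<le> de"
    and C: "\<And>y z. \<bar>y \<bullet> (Om *v z)\<bar> \<le> C * norm y * norm z"
    and tau: "0 < tau"
  shows "2 * tau * (\<bar>(xv r Y - xv r M) \<bullet> (Om *v xv r Y)\<bar> / (cv r Y + de)) \<le>
     C\<^sup>2 * ((xv r Y - xv r M) \<bullet> (xv r Y - xv r M)) * trace (SS Y) + tau\<^sup>2 * (1 / (cv r Y + de))"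
proof -
  let ?D = "C * norm (xv r Y - xv r M)" and ?y = "norm (xv r Y)" and ?q = "1 / (cv r Y + de)"
  have q: "0 \<le> ?q" using de by simp
  have "SS Y *v (Kinv Y *v xv r Y) = xv r Y" unfolding Kinv_def by (rule matrix_inv_vector(1)[OF nz])
  \<comment> \<open>The inequality S^2 <= tr(S) S, evaluated at S^-1 x.\<close>
  then have "xv r Y \<bullet> xv r Y \<le> trace (SS Y) * cv r Y"
    using psd_norm_le_trace[OF psd_SS, of Y "Kinv Y *v xv r Y"] by (simp add: cv_def inner_commute)
  also have "\<dots> \<le> trace (SS Y) * (cv r Y + de)"
    by (intro mult_left_mono psd_trace_nonneg psd_SS) (use d0 in simp)
  finally have "?y\<^sup>2 * ?q \<le> trace (SS Y)" using de by (simp add: dot_square_norm divide_le_eq)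
  then have y: "?D\<^sup>2 * (?y\<^sup>2 * ?q) \<le> ?D\<^sup>2 * trace (SS Y)" by (intro mult_left_mono) auto
  have "2 * tau * (\<bar>(xv r Y - xv r M) \<bullet> (Om *v xv r Y)\<bar> / (cv r Y + de)) =
      2 * tau * (\<bar>(xv r Y - xv r M) \<bullet> (Om *v xv r Y)\<bar> * ?q)" by simp
  also have "\<dots> \<le> 2 * tau * ((?D * ?y) * ?q)"
    by (intro mult_left_mono mult_right_mono C q) (use tau in simp)
  also have "\<dots> = (2 * tau * (?D * ?y)) * ?q" by (simp only: mult.assoc)
  also have "\<dots> \<le> ((?D * ?y)\<^sup>2 + tau\<^sup>2) * ?q"
    by (intro mult_right_mono q) (use sum_squares_bound[of "?D * ?y" tau] in \<open>simp add: mult_ac\<close>)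
  also have "\<dots> = ?D\<^sup>2 * (?y\<^sup>2 * ?q) + tau\<^sup>2 * ?q"
    by (simp only: power_mult_distrib distrib_right mult.assoc)
  also have "\<dots> \<le> ?D\<^sup>2 * trace (SS Y) + tau\<^sup>2 * ?q" using y by simp
  finally show ?thesis by (simp add: power_mult_distrib dot_square_norm)
qed

section \<open>The inverse moment of c and removal of the shift, for p at least 3\<close>

context
  assumes p3: "3 \<le> CARD('p)" and r0: "r \<noteq> 0"
begin

lemma integrable_weight: "integrable law (\<lambda>Y. C\<^sup>2 * ((xv r Y - xv r M) \<bullet> (xv r Y - xv r M)) * trace (SS Y))"
  by (intro poly_growth_integrable[OF pd] poly_growth_mult poly_growth_const poly_growth_inner poly_growth_diff
      poly_growth_xv poly_growth_trace_SS)

text \<open>Write I for E (1 / (c + de)), finite for each shift, and W for the weight in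
  \<open>cross_bound\<close>. Stein's identity bounds tau I by the cross term, and
  \<open>cross_bound\<close> bounds that by (E W + tau^2 I) / (2 tau). Absorbing the last summand
  leaves I <= E W / tau^2, free of the shift.\<close>

lemma inverse_cv_plus_bound: "\<exists>B. \<forall>de>0. (\<integral>Y. 1 / (cv r Y + de) \<partial>law) \<le> B"
proof -
  obtain C where C: "0 < C" "\<And>y z. \<bar>y \<bullet> (Om *v z)\<bar> \<le> C * norm y * norm z" by (rule matrix_inner_bound[of Om]) blast
  let ?W = "\<lambda>Y. C\<^sup>2 * ((xv r Y - xv r M) \<bullet> (xv r Y - xv r M)) * trace (SS Y)"
  let ?z = "\<lambda>Y. (xv r Y - xv r M) \<bullet> (Om *v xv r Y)"
  \<comment> \<open>This is the coefficient that Stein's identity puts on E (1 / (c + de)); using it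
    also as the parameter of \<open>cross_bound\<close> makes exactly half of the left-hand side
    absorbable. It is positive because p >= 3 and \<open>r\<close> is nonzero.\<close>
  define tau where "tau = (real CARD('p) - 2) * (r \<bullet> r)"
  have tau: "0 < tau" using p3 r0 by (simp add: tau_def)
  have "(\<integral>Y. 1 / (cv r Y + de) \<partial>law) \<le> (\<integral>Y. ?W Y \<partial>law) / tau\<^sup>2" if de: "0 < de" for de
  proof -
    let ?I = "\<integral>Y. 1 / (cv r Y + de) \<partial>law"
    note iq = integrable_inverse_cv_plus[OF de]
    have "tau * ?I = (\<integral>Y. tau * (1 / (cv r Y + de)) \<partial>law)" by (rule integral_mult_right_zero[symmetric])
    also have "\<dots> \<le> (\<integral>Y. (r \<bullet> r) * (real CARD('p) / (cv r Y + de) - 2 * cv r Y / (cv r Y + de)\<^sup>2) \<partial>law)"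
    proof (rule integral_mono_AE)
      show "AE Y in law. tau * (1 / (cv r Y + de)) \<le> (r \<bullet> r) * (real CARD('p) / (cv r Y + de) - 2 * cv r Y / (cv r Y + de)\<^sup>2)"
        using AE_det_SS[OF df]
      proof eventually_elim
        case (elim Y)
        have "(real CARD('p) - 2) * (1 / (cv r Y + de)) \<le> real CARD('p) / (cv r Y + de) - 2 * cv r Y / (cv r Y + de)\<^sup>2"
          using mult_left_mono[OF shrink_factor_bounds(4)[OF cv_nonneg[OF elim] de], of 2] by (simp add: diff_divide_distrib)
        then have "(r \<bullet> r) * ((real CARD('p) - 2) * (1 / (cv r Y + de))) \<le> (r \<bullet> r) * (real CARD('p) / (cv r Y + de) - 2 * cv r Y / (cv r Y + de)\<^sup>2)"
          by (intro mult_left_mono) auto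
        then show ?case by (simp add: tau_def mult_ac)
      qed
    qed (rule integrable_mult_right[OF iq], rule integrable_shrinkage_plus'[OF de])
    also have "\<dots> = (\<integral>Y. ?z Y / (cv r Y + de) \<partial>law)" by (rule integral_shrinkage_plus[OF de, symmetric])
    also have "\<dots> \<le> (\<integral>Y. (?W Y + tau\<^sup>2 * (1 / (cv r Y + de))) / (2 * tau) \<partial>law)"
    proof (rule integral_mono_AE)
      show "integrable law (\<lambda>Y. (?W Y + tau\<^sup>2 * (1 / (cv r Y + de))) / (2 * tau))"
        by (intro integrable_divide_zero Bochner_Integration.integrable_add integrable_mult_right iq integrable_weight)
      show "AE Y in law. ?z Y / (cv r Y + de) \<le> (?W Y + tau\<^sup>2 * (1 / (cv r Y + de))) / (2 * tau)"
        using AE_det_SS[OF df]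
      proof eventually_elim
        case (elim Y)
        have pos: "0 < cv r Y + de" using cv_nonneg[OF elim] de by simp
        have "2 * tau * (?z Y / (cv r Y + de)) \<le> 2 * tau * (\<bar>?z Y\<bar> / (cv r Y + de))"
          using tau pos by (intro mult_left_mono divide_right_mono) auto
        also have "\<dots> \<le> ?W Y + tau\<^sup>2 * (1 / (cv r Y + de))"
          by (rule cross_bound[OF elim pos _ C(2) tau]) (use de in simp)
        finally show ?case using tau by (simp add: pos_le_divide_eq mult_ac)
      qed
    qed (use integrable_shrinkage_plus[OF de] in auto)
    also have "\<dots> = ((\<integral>Y. ?W Y \<partial>law) + tau\<^sup>2 * ?I) / (2 * tau)"
    proof -
      have "(\<integral>Y. (?W Y + tau\<^sup>2 * (1 / (cv r Y + de))) / (2 * tau) \<partial>law) = (\<integral>Y. ?W Y + tau\<^sup>2 * (1 / (cv r Y + de)) \<partial>law) / (2 * tau)"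
        by (rule integral_divide_zero)
      also have "(\<integral>Y. ?W Y + tau\<^sup>2 * (1 / (cv r Y + de)) \<partial>law) = (\<integral>Y. ?W Y \<partial>law) + (\<integral>Y. tau\<^sup>2 * (1 / (cv r Y + de)) \<partial>law)"
        by (intro Bochner_Integration.integral_add integrable_mult_right iq integrable_weight)
      also have "(\<integral>Y. tau\<^sup>2 * (1 / (cv r Y + de)) \<partial>law) = tau\<^sup>2 * ?I" by (rule integral_mult_right_zero)
      finally show ?thesis .
    qed
    finally have "2 * tau * (tau * ?I) \<le> (\<integral>Y. ?W Y \<partial>law) + tau\<^sup>2 * ?I"
      using tau by (simp add: pos_le_divide_eq mult_ac)
    then have "tau\<^sup>2 * ?I \<le> (\<integral>Y. ?W Y \<partial>law)" by (simp add: power2_eq_square)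
    then show ?thesis using tau by (simp add: pos_le_divide_eq mult.commute)
  qed
  then show ?thesis by blast
qed

lemma AE_cv_pos: "AE Y in law. 0 < cv r Y"
proof -
  obtain B where B: "\<And>de. 0 < de \<Longrightarrow> (\<integral>Y. 1 / (cv r Y + de) \<partial>law) \<le> B" using inverse_cv_plus_bound by blast
  \<comment> \<open>On the null set of singular \<open>SS Y\<close> the default inverse may make
    \<open>cv r Y\<close> negative. The truncation provides the pointwise nonnegativity required by
    the Markov argument without changing integrals.\<close>
  have ae: "AE Y in law. 1 / (max 0 (cv r Y) + de) = 1 / (cv r Y + de)" for de
    using AE_det_SS[OF df] by eventually_elim (use cv_nonneg in \<open>simp add: max_def\<close>)
  have "AE Y in law. \<not> cv r Y \<le> 0"
  proof (rule law.AE_not_by_Markov[where f="\<lambda>de Y. 1 / (max 0 (cv r Y) + de)" and B=B])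
    fix de :: real assume de: "0 < de"
    show "integrable law (\<lambda>Y. 1 / (max 0 (cv r Y) + de))"
      using integrable_inverse_cv_plus[OF de] by (subst integrable_cong_AE[OF _ _ ae]) auto
    have "(\<integral>Y. 1 / (max 0 (cv r Y) + de) \<partial>law) = (\<integral>Y. 1 / (cv r Y + de) \<partial>law)"
      by (rule integral_cong_AE[OF _ _ ae]) auto
    then show "(\<integral>Y. 1 / (max 0 (cv r Y) + de) \<partial>law) \<le> B" using B[OF de] by simp
  qed auto
  then show ?thesis by eventually_elim simp
qed

lemma integrable_inverse_cv: "integrable law (\<lambda>Y. 1 / cv r Y)"
proof -
  obtain B where B: "\<And>de. 0 < de \<Longrightarrow> (\<integral>Y. 1 / (cv r Y + de) \<partial>law) \<le> B" using inverse_cv_plus_bound by blast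
  show ?thesis
  proof (rule integrable_Fatou[where f="\<lambda>k Y. 1 / (cv r Y + eps k)"])
    show "AE Y in law. 0 \<le> 1 / (cv r Y + eps k)" for k
      using AE_cv_pos by eventually_elim (use eps_pos[of k] in simp)
    show "AE Y in law. (\<lambda>k. 1 / (cv r Y + eps k)) \<longlonglongrightarrow> 1 / cv r Y"
      using AE_cv_pos
    proof eventually_elim
      case (elim Y)
      have "(\<lambda>k. 1 / (cv r Y + eps k)) \<longlonglongrightarrow> 1 / (cv r Y + 0)"
        by (intro tendsto_intros eps_lim) (use elim in simp)
      then show ?case by simp
    qed
  qed (auto intro: B integrable_inverse_cv_plus eps_pos)
qed

lemma
  shows integrable_shrinkage: "integrable law (\<lambda>Y. ((xv r Y - xv r M) \<bullet> (Om *v xv r Y)) / cv r Y)"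
    and integral_shrinkage: "(\<integral>Y. ((xv r Y - xv r M) \<bullet> (Om *v xv r Y)) / cv r Y \<partial>law) =
      (r \<bullet> r) * (real CARD('p) - 2) * (\<integral>Y. 1 / cv r Y \<partial>law)"
proof -
  obtain C where C: "0 < C" "\<And>y z. \<bar>y \<bullet> (Om *v z)\<bar> \<le> C * norm y * norm z" by (rule matrix_inner_bound[of Om]) blast
  let ?z = "\<lambda>Y. (xv r Y - xv r M) \<bullet> (Om *v xv r Y)"
  let ?W = "\<lambda>Y. C\<^sup>2 * ((xv r Y - xv r M) \<bullet> (xv r Y - xv r M)) * trace (SS Y)"
  let ?R = "\<lambda>c de. (r \<bullet> r) * (real CARD('p) / (c + de) - 2 * c / (c + de)\<^sup>2)"
  have AE2: "AE Y in law. det (SS Y) \<noteq> 0 \<and> 0 < cv r Y" using AE_det_SS[OF df] AE_cv_pos by eventually_elim simp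
  have q: "1 / (c + eps k) \<le> 1 / c" if "0 < c" for c k
    using that eps_pos[of k] by (intro frac_le) auto
  have w: "integrable law (\<lambda>Y. (?W Y + 1 / cv r Y) / 2)" using integrable_weight[of C] integrable_inverse_cv by simp
  have l1: "AE Y in law. (\<lambda>k. ?z Y / (cv r Y + eps k)) \<longlonglongrightarrow> ?z Y / cv r Y"
    using AE_cv_pos
  proof eventually_elim
    case (elim Y)
    have "(\<lambda>k. ?z Y / (cv r Y + eps k)) \<longlonglongrightarrow> ?z Y / (cv r Y + 0)"
      by (intro tendsto_intros eps_lim) (use elim in simp)
    then show ?case by simp
  qed
  have l2: "AE Y in law. norm (?z Y / (cv r Y + eps k)) \<le> (?W Y + 1 / cv r Y) / 2" for k
    using AE2
  proof eventually_elim
    case (elim Y)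
    have pos: "0 < cv r Y + eps k" using elim eps_pos[of k] by simp
    \<comment> \<open>With 1 / c already integrable, tau = 1 yields an integrable dominating
      function.\<close>
    have "2 * 1 * (\<bar>?z Y\<bar> / (cv r Y + eps k)) \<le> ?W Y + 1\<^sup>2 * (1 / (cv r Y + eps k))"
      by (rule cross_bound[OF _ pos _ C(2)]) (use elim eps_pos[of k] in auto)
    then have "2 * (\<bar>?z Y\<bar> / (cv r Y + eps k)) \<le> ?W Y + 1 / (cv r Y + eps k)" by simp
    moreover have "norm (?z Y / (cv r Y + eps k)) = \<bar>?z Y\<bar> / (cv r Y + eps k)" using pos by simp
    moreover have "n \<le> (w + q2) / 2" if "2 * a \<le> w + q1" "n = a" "q1 \<le> q2" for n w a q1 q2 :: real
      using that by simp
    ultimately show ?case using q[OF conjunct2[OF elim], of k] by blast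
  qed
  have L: "(\<lambda>k. \<integral>Y. ?z Y / (cv r Y + eps k) \<partial>law) \<longlonglongrightarrow> (\<integral>Y. ?z Y / cv r Y \<partial>law)"
    by (rule integral_dominated_convergence[OF _ _ w l1 l2]) measurable
  show "integrable law (\<lambda>Y. ?z Y / cv r Y)"
    by (rule integrable_dominated_convergence[OF _ _ w l1 l2]) measurable
  have w': "integrable law (\<lambda>Y. (r \<bullet> r) * ((real CARD('p) + 2) * (1 / cv r Y)))"
    by (intro integrable_mult_right integrable_inverse_cv)
  have r1: "AE Y in law. (\<lambda>k. ?R (cv r Y) (eps k)) \<longlonglongrightarrow> (r \<bullet> r) * ((real CARD('p) - 2) * (1 / cv r Y))"
    using AE_cv_pos
  proof eventually_elim
    case (elim Y)
    have "(\<lambda>k. ?R (cv r Y) (eps k)) \<longlonglongrightarrow> ?R (cv r Y) 0"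
      by (intro tendsto_intros eps_lim) (use elim in auto)
    moreover have "?R (cv r Y) 0 = (r \<bullet> r) * ((real CARD('p) - 2) * (1 / cv r Y))"
      using elim by (simp add: power2_eq_square diff_divide_distrib)
    ultimately show ?case by simp
  qed
  have r2: "AE Y in law. norm (?R (cv r Y) (eps k)) \<le> (r \<bullet> r) * ((real CARD('p) + 2) * (1 / cv r Y))" for k
    using AE_cv_pos
  proof eventually_elim
    case (elim Y)
    note b = shrink_factor_bounds[OF less_imp_le[OF elim] eps_pos, of k]
    have "\<bar>real CARD('p) / (cv r Y + eps k) - 2 * cv r Y / (cv r Y + eps k)\<^sup>2\<bar> \<le>
        real CARD('p) * (1 / (cv r Y + eps k)) + 2 * (cv r Y / (cv r Y + eps k)\<^sup>2)"
      using b by (intro order_trans[OF abs_triangle_ineq4]) (simp add: abs_mult)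
    also have "\<dots> \<le> real CARD('p) * (1 / cv r Y) + 2 * (1 / cv r Y)"
      using b q[OF elim, of k] by (intro add_mono mult_left_mono) linarith+
    also have "\<dots> = (real CARD('p) + 2) * (1 / cv r Y)" by (simp add: add_divide_distrib)
    finally have "(r \<bullet> r) * \<bar>real CARD('p) / (cv r Y + eps k) - 2 * cv r Y / (cv r Y + eps k)\<^sup>2\<bar> \<le> (r \<bullet> r) * ((real CARD('p) + 2) * (1 / cv r Y))"
      by (intro mult_left_mono) auto
    then show ?case by (simp add: abs_mult)
  qed
  have R: "(\<lambda>k. \<integral>Y. ?R (cv r Y) (eps k) \<partial>law) \<longlonglongrightarrow> (\<integral>Y. (r \<bullet> r) * ((real CARD('p) - 2) * (1 / cv r Y)) \<partial>law)"
    by (rule integral_dominated_convergence[OF _ _ w' r1 r2]) measurable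
  have "(\<integral>Y. ?z Y / cv r Y \<partial>law) = (\<integral>Y. (r \<bullet> r) * ((real CARD('p) - 2) * (1 / cv r Y)) \<partial>law)"
    using L R unfolding integral_shrinkage_plus[OF eps_pos] by (rule LIMSEQ_unique)
  then show "(\<integral>Y. ?z Y / cv r Y \<partial>law) = (r \<bullet> r) * (real CARD('p) - 2) * (\<integral>Y. 1 / cv r Y \<partial>law)"
    by (simp only: integral_mult_right_zero mult.assoc)
qed

text \<open>The shifted right-hand sides are at most (tr N - p + 3) E (1 / c), so Fatou applies. The
  numerator is nonnegative, hence dropping the shift only increases the ratio and the limit is a
  dominating function.\<close>

lemma
  shows integrable_quad_ratio: "integrable law (\<lambda>Y. (xv r Y \<bullet> (Om *v xv r Y)) / (cv r Y)\<^sup>2)"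
    and integral_quad_ratio: "(\<integral>Y. (xv r Y \<bullet> (Om *v xv r Y)) / (cv r Y)\<^sup>2 \<partial>law) =
      (trace N - real CARD('p) + 3) * (\<integral>Y. 1 / cv r Y \<partial>law)"
proof -
  let ?z = "\<lambda>Y. xv r Y \<bullet> (Om *v xv r Y)"
  let ?kap = "trace N - real CARD('p) - 1"
  let ?R = "\<lambda>c de. ?kap * (c / (c + de)\<^sup>2) + 4 * (c\<^sup>2 / (c + de) ^ 3)"
  have kap: "0 < ?kap" using df by simp
  have z0: "0 \<le> ?z Y" for Y by (intro psdD(2) pos_def_imp_psd pos_def_matrix_inv pd)
  have q: "1 / (c + eps k) \<le> 1 / c" if "0 < c" for c k
    using that eps_pos[of k] by (intro frac_le) auto
  have Rb: "0 \<le> ?R (cv r Y) (eps k)" "?R (cv r Y) (eps k) \<le> (?kap + 4) * (1 / cv r Y)" if pos: "0 < cv r Y" for Y k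
  proof -
    note b = shrink_factor_bounds[OF less_imp_le[OF pos] eps_pos, of k]
    show "0 \<le> ?R (cv r Y) (eps k)" by (intro add_nonneg_nonneg mult_nonneg_nonneg b) (use kap in auto)
    have "?R (cv r Y) (eps k) \<le> ?kap * (1 / cv r Y) + 4 * (1 / cv r Y)"
      by (intro add_mono mult_left_mono order_trans[OF b(4) q[OF pos]] order_trans[OF b(6) q[OF pos]]) (use kap in auto)
    then show "?R (cv r Y) (eps k) \<le> (?kap + 4) * (1 / cv r Y)" by (simp only: distrib_right)
  qed
  have w': "integrable law (\<lambda>Y. (?kap + 4) * (1 / cv r Y))" by (intro integrable_mult_right integrable_inverse_cv)
  have r1: "AE Y in law. (\<lambda>k. ?R (cv r Y) (eps k)) \<longlonglongrightarrow> (?kap + 4) * (1 / cv r Y)"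
    using AE_cv_pos
  proof eventually_elim
    case (elim Y)
    have "(\<lambda>k. ?R (cv r Y) (eps k)) \<longlonglongrightarrow> ?R (cv r Y) 0"
      by (intro tendsto_intros eps_lim) (use elim in auto)
    moreover have "?R (cv r Y) 0 = ?kap * (1 / cv r Y) + 4 * (1 / cv r Y)"
      using elim by (simp add: power2_eq_square power3_eq_cube)
    ultimately show ?case by (simp only: distrib_right)
  qed
  have r2: "AE Y in law. norm (?R (cv r Y) (eps k)) \<le> (?kap + 4) * (1 / cv r Y)" for k
    using AE_cv_pos
  proof eventually_elim
    case (elim Y)
    show ?case using Rb[OF elim, of k] unfolding real_norm_def by (simp only: abs_of_nonneg)
  qed
  have R: "(\<lambda>k. \<integral>Y. ?R (cv r Y) (eps k) \<partial>law) \<longlonglongrightarrow> (\<integral>Y. (?kap + 4) * (1 / cv r Y) \<partial>law)"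
    by (rule integral_dominated_convergence[OF _ _ w' r1 r2]) measurable
  have RB: "(\<integral>Y. ?R (cv r Y) (eps k) \<partial>law) \<le> (\<integral>Y. (?kap + 4) * (1 / cv r Y) \<partial>law)" for k
  proof (rule integral_mono_AE[OF _ w'])
    show "integrable law (\<lambda>Y. ?R (cv r Y) (eps k))"
      by (rule Bochner_Integration.integrable_bound[OF w'])
         (measurable, use r2[of k] in eventually_elim, use abs_ge_self order_trans in \<open>auto simp del: times_divide_eq_right\<close>)
    show "AE Y in law. ?R (cv r Y) (eps k) \<le> (?kap + 4) * (1 / cv r Y)"
      using AE_cv_pos by eventually_elim (rule Rb)
  qed
  have l1: "AE Y in law. (\<lambda>k. ?z Y / (cv r Y + eps k)\<^sup>2) \<longlonglongrightarrow> ?z Y / (cv r Y)\<^sup>2"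
    using AE_cv_pos
  proof eventually_elim
    case (elim Y)
    have "(\<lambda>k. ?z Y / (cv r Y + eps k)\<^sup>2) \<longlonglongrightarrow> ?z Y / (cv r Y + 0)\<^sup>2"
      by (intro tendsto_intros eps_lim) (use elim in simp)
    then show ?case by simp
  qed
  show w: "integrable law (\<lambda>Y. ?z Y / (cv r Y)\<^sup>2)"
  proof (rule integrable_Fatou[OF _ _ l1])
    show "integrable law (\<lambda>Y. ?z Y / (cv r Y + eps k)\<^sup>2)" for k by (rule quad_ratio_plus(1)[OF eps_pos])
    show "(\<integral>Y. ?z Y / (cv r Y + eps k)\<^sup>2 \<partial>law) \<le> (\<integral>Y. (?kap + 4) * (1 / cv r Y) \<partial>law)" for k
      unfolding quad_ratio_plus(2)[OF eps_pos] by (rule RB)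
  qed (use z0 in auto)
  have l2: "AE Y in law. norm (?z Y / (cv r Y + eps k)\<^sup>2) \<le> ?z Y / (cv r Y)\<^sup>2" for k
    using AE_cv_pos
  proof eventually_elim
    case (elim Y)
    have "?z Y / (cv r Y + eps k)\<^sup>2 \<le> ?z Y / (cv r Y)\<^sup>2"
      using elim eps_pos[of k] z0 by (intro divide_left_mono power_mono) auto
    then show ?case using z0[of Y] by simp
  qed
  have L: "(\<lambda>k. \<integral>Y. ?z Y / (cv r Y + eps k)\<^sup>2 \<partial>law) \<longlonglongrightarrow> (\<integral>Y. ?z Y / (cv r Y)\<^sup>2 \<partial>law)"
    by (rule integral_dominated_convergence[OF _ _ w l1 l2]) measurable
  have "(\<integral>Y. ?z Y / (cv r Y)\<^sup>2 \<partial>law) = (\<integral>Y. (?kap + 4) * (1 / cv r Y) \<partial>law)"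
    using L R unfolding quad_ratio_plus(2)[OF eps_pos] by (rule LIMSEQ_unique)
  also have "\<dots> = (?kap + 4) * (\<integral>Y. 1 / cv r Y \<partial>law)" by (rule integral_mult_right_zero)
  finally show "(\<integral>Y. ?z Y / (cv r Y)\<^sup>2 \<partial>law) = (trace N - real CARD('p) + 3) * (\<integral>Y. 1 / cv r Y \<partial>law)"
    by simp
qed

end

end

end

section \<open>Completeness and sufficiency\<close>

text \<open>The values of \<open>u\<close> stay in a compact ball. There a polynomial is uniformly
  within e of \<open>f\<close>, so the integral is at most e times the integral of the absolute
  value of \<open>h\<close>.\<close>

lemma integral_continuous_eq_0_if_polynomials:
  fixes u :: "'a \<Rightarrow> 'b::euclidean_space" and h :: "'a \<Rightarrow> real" and f :: "'b \<Rightarrow> real"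
  assumes h: "integrable M h" and [measurable]: "u \<in> borel_measurable M" and bd: "\<And>x. norm (u x) \<le> B"
    and poly: "\<And>p. real_polynomial_function p \<Longrightarrow> (\<integral>x. h x * p (u x) \<partial>M) = 0"
    and f: "continuous_on UNIV f"
  shows "(\<integral>x. h x * f (u x) \<partial>M) = 0"
proof -
  have cpt: "compact (cball (0::'b) B)" by simp
  have int: "integrable M (\<lambda>x. h x * g (u x))" if g: "continuous_on UNIV g" for g :: "'b \<Rightarrow> real"
  proof -
    have [measurable]: "g \<in> borel_measurable borel" by (rule borel_measurable_continuous_onI[OF g])
    have "compact (g ` cball 0 B)" by (intro compact_continuous_image continuous_on_subset[OF g] cpt) simp
    then have "bounded (g ` cball 0 B)" by (rule compact_imp_bounded)
    then obtain c where "\<forall>z\<in>g ` cball 0 B. norm z \<le> c" unfolding bounded_iff by (elim exE)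
    then have c: "norm (g y) \<le> c" if "y \<in> cball 0 B" for y using that by simp
    show ?thesis
    proof (rule Bochner_Integration.integrable_bound[of _ "\<lambda>x. c * h x"])
      show "integrable M (\<lambda>x. c * h x)" using h by simp
      show "(\<lambda>x. h x * g (u x)) \<in> borel_measurable M" using h by measurable
      show "AE x in M. norm (h x * g (u x)) \<le> norm (c * h x)"
      proof (rule always_eventually, rule allI)
        fix x
        have "\<bar>g (u x)\<bar> \<le> c" using c[of "u x"] bd[of x] by simp
        then show "norm (h x * g (u x)) \<le> norm (c * h x)"
          using mult_left_mono[of "\<bar>g (u x)\<bar>" "\<bar>c\<bar>" "\<bar>h x\<bar>"] by (simp add: abs_mult mult.commute)
      qed
    qed
  qed
  let ?I = "\<integral>x. h x * f (u x) \<partial>M" and ?H = "\<integral>x. \<bar>h x\<bar> \<partial>M"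
  have le: "\<bar>?I\<bar> \<le> e * ?H" if e: "0 < e" for e
  proof -
    obtain p where p: "real_polynomial_function p" "\<And>y. y \<in> cball 0 B \<Longrightarrow> \<bar>f y - p y\<bar> < e"
      by (rule Stone_Weierstrass_real_polynomial_function[OF cpt continuous_on_subset[OF f] e]) auto
    have pc: "continuous_on UNIV p"
      using p(1) by (simp add: continuous_on_polymonial_function real_polynomial_function_eq)
    have "?I = ?I - (\<integral>x. h x * p (u x) \<partial>M)" using poly[OF p(1)] by simp
    also have "\<dots> = (\<integral>x. h x * f (u x) - h x * p (u x) \<partial>M)"
      by (rule Bochner_Integration.integral_diff[symmetric]) (rule int[OF f], rule int[OF pc])
    also have "\<bar>\<dots>\<bar> \<le> (\<integral>x. \<bar>h x * f (u x) - h x * p (u x)\<bar> \<partial>M)" by (rule integral_abs_bound)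
    also have "\<dots> \<le> (\<integral>x. e * \<bar>h x\<bar> \<partial>M)"
    proof (rule integral_mono)
      show "integrable M (\<lambda>x. \<bar>h x * f (u x) - h x * p (u x)\<bar>)"
        by (intro integrable_abs Bochner_Integration.integrable_diff int f pc)
      show "integrable M (\<lambda>x. e * \<bar>h x\<bar>)" using h by simp
      fix x
      have "\<bar>h x * f (u x) - h x * p (u x)\<bar> = \<bar>h x\<bar> * \<bar>f (u x) - p (u x)\<bar>"
        by (simp add: abs_mult[symmetric] right_diff_distrib)
      also have "\<dots> \<le> \<bar>h x\<bar> * e" using p(2)[of "u x"] bd[of x] by (intro mult_left_mono) auto
      finally show "\<bar>h x * f (u x) - h x * p (u x)\<bar> \<le> e * \<bar>h x\<bar>" by (simp add: mult.commute)
    qed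
    finally show ?thesis by simp
  qed
  show ?thesis
  proof (rule ccontr)
    assume "?I \<noteq> 0"
    moreover have H: "0 \<le> ?H" by simp
    ultimately have "\<bar>?I\<bar> \<le> (\<bar>?I\<bar> / (2 * (?H + 1))) * ?H" by (intro le) (simp add: add_nonneg_pos)
    also have "\<dots> = \<bar>?I\<bar> * (?H / (2 * (?H + 1)))" by simp
    also have "\<dots> \<le> \<bar>?I\<bar> * (1 / 2)"
    proof (rule mult_left_mono)
      have "x / (2 * (x + 1)) \<le> 1 / 2" if "0 \<le> x" for x :: real using that by (simp add: field_simps)
      then show "?H / (2 * (?H + 1)) \<le> 1 / 2" using H by blast
    qed simp
    finally show False using \<open>?I \<noteq> 0\<close> by simp
  qed
qed

text \<open>Closed sets generate the Borel sets and are stable under intersection, and their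
  indicators are limits of bounded continuous functions. The sets satisfying the claim form a Dynkin
  system.\<close>

lemma integral_indicator_eq_0_if_polynomials:
  fixes u :: "'a \<Rightarrow> 'b::euclidean_space" and h :: "'a \<Rightarrow> real"
  assumes h: "integrable M h" and um [measurable]: "u \<in> borel_measurable M" and bd: "\<And>x. norm (u x) \<le> B"
    and poly: "\<And>p. real_polynomial_function p \<Longrightarrow> (\<integral>x. h x * p (u x) \<partial>M) = 0"
    and A: "A \<in> sets borel"
  shows "(\<integral>x. h x * indicator A (u x) \<partial>M) = 0"
proof -
  have cont: "(\<integral>x. h x * f (u x) \<partial>M) = 0" if "continuous_on UNIV f" for f :: "'b \<Rightarrow> real"
    by (rule integral_continuous_eq_0_if_polynomials[OF h um bd _ that]) (rule poly)
  have hm [measurable]: "h \<in> borel_measurable M" using h by auto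
  have ind: "integrable M (\<lambda>x. h x * indicator C (u x))" if C: "C \<in> sets borel" for C
  proof (rule Bochner_Integration.integrable_bound[OF h])
    have [measurable]: "(indicator C :: 'b \<Rightarrow> real) \<in> borel_measurable borel" using C by simp
    show "(\<lambda>x. h x * indicator C (u x)) \<in> borel_measurable M" by measurable
  qed (auto simp: indicator_def)
  have "Int_stable (Collect closed :: 'b set set)" "Collect closed \<subseteq> Pow (UNIV :: 'b set)"
    by (auto simp: Int_stable_def)
  moreover have "A \<in> sigma_sets UNIV (Collect closed)"
    using A by (simp add: borel_eq_closed)
  ultimately show ?thesis
  proof (induction rule: sigma_sets_induct_disjoint)
    case (basic C)
    then have cl: "closed C" by simp
    have [measurable]: "C \<in> sets borel" using cl by simp
    show ?case
    proof (cases "C = {}")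
      case False
      \<comment> \<open>Lipschitz cut-offs that equal 1 on \<open>C\<close> and decrease to its
        indicator; closedness makes the distance positive off \<open>C\<close>.\<close>
      define f where "f n x = max 0 (1 - real n * infdist x C)" for n and x :: 'b
      have fc: "continuous_on UNIV (f n)" for n unfolding f_def by (intro continuous_intros)
      have [measurable]: "f n \<in> borel_measurable borel" for n by (rule borel_measurable_continuous_onI[OF fc])
      have lim: "(\<lambda>n. f n x) \<longlonglongrightarrow> indicator C x" for x
      proof (cases "x \<in> C")
        case True then show ?thesis by (simp add: f_def)
      next
        case x: False
        then have "0 < infdist x C" using in_closed_iff_infdist_zero[OF cl False, of x] infdist_nonneg[of x C] by linarith
        then obtain n0 where "1 < real n0 * infdist x C" using ex_less_of_nat_mult by blast
        have "f n x = 0" if "n0 \<le> n" for n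
        proof -
          have "real n0 * infdist x C \<le> real n * infdist x C" using that by (intro mult_right_mono infdist_nonneg) simp
          then show ?thesis using \<open>1 < real n0 * infdist x C\<close> by (simp add: f_def)
        qed
        then have "\<forall>\<^sub>F n in sequentially. f n x = 0" by (auto simp: eventually_sequentially)
        then show ?thesis using x by (simp add: tendsto_eventually)
      qed
      have f01: "\<bar>f n x\<bar> \<le> 1" for n x using infdist_nonneg[of x C] by (simp add: f_def)
      have "(\<lambda>n. \<integral>x. h x * f n (u x) \<partial>M) \<longlonglongrightarrow> (\<integral>x. h x * indicator C (u x) \<partial>M)"
      proof (rule integral_dominated_convergence[where w="\<lambda>x. \<bar>h x\<bar>"])
        show "integrable M (\<lambda>x. \<bar>h x\<bar>)" using h by simp
        show "AE x in M. (\<lambda>n. h x * f n (u x)) \<longlonglongrightarrow> h x * indicator C (u x)"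
          by (intro always_eventually allI tendsto_intros lim)
        show "AE x in M. norm (h x * f n (u x)) \<le> \<bar>h x\<bar>" for n
          using mult_left_mono[OF f01, of "\<bar>h _\<bar>"] by (intro always_eventually allI) (simp add: abs_mult)
        show "(\<lambda>x. h x * indicator C (u x)) \<in> borel_measurable M" by measurable
      qed measurable
      then show ?thesis using cont[OF fc] by (simp add: LIMSEQ_const_iff)
    qed simp
  next
    case empty show ?case by simp
  next
    case (compl C)
    then have [measurable]: "C \<in> sets borel" by (simp add: borel_eq_closed)
    have "(\<integral>x. h x * indicator (UNIV - C) (u x) \<partial>M) = (\<integral>x. h x * 1 - h x * indicator C (u x) \<partial>M)"
      by (intro Bochner_Integration.integral_cong) (auto simp: indicator_def)
    also have "\<dots> = (\<integral>x. h x * 1 \<partial>M) - (\<integral>x. h x * indicator C (u x) \<partial>M)"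
      using h by (intro Bochner_Integration.integral_diff ind) (simp, measurable)
    also have "\<dots> = 0" using cont[of "\<lambda>_. 1"] compl by simp
    finally show ?case .
  next
    case (union C)
    then have [measurable]: "C i \<in> sets borel" for i by (auto simp: borel_eq_closed)
    have fin: "(\<integral>x. h x * indicator (\<Union>i<n. C i) (u x) \<partial>M) = 0" for n
    proof -
      have "(\<integral>x. h x * indicator (\<Union>i<n. C i) (u x) \<partial>M) = (\<integral>x. (\<Sum>i<n. h x * indicator (C i) (u x)) \<partial>M)"
        by (subst indicator_UN_disjoint) (use union(1) in \<open>auto simp: disjoint_family_on_def sum_distrib_left\<close>)
      also have "\<dots> = (\<Sum>i<n. \<integral>x. h x * indicator (C i) (u x) \<partial>M)"
        by (rule Bochner_Integration.integral_sum) (rule ind, measurable)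
      finally show ?thesis using union by simp
    qed
    have "(\<lambda>n. \<integral>x. h x * indicator (\<Union>i<n. C i) (u x) \<partial>M) \<longlonglongrightarrow> (\<integral>x. h x * indicator (\<Union>i. C i) (u x) \<partial>M)"
    proof (rule integral_dominated_convergence[where w="\<lambda>x. \<bar>h x\<bar>"])
      show "integrable M (\<lambda>x. \<bar>h x\<bar>)" using h by simp
      show "AE x in M. (\<lambda>n. h x * indicator (\<Union>i<n. C i) (u x)) \<longlonglongrightarrow> h x * indicator (\<Union>i. C i) (u x)"
        by (intro always_eventually allI tendsto_intros LIMSEQ_indicator_UN)
      show "AE x in M. norm (h x * indicator (\<Union>i<n. C i) (u x)) \<le> \<bar>h x\<bar>" for n
        by (auto simp: indicator_def)
    qed (rule borel_measurable_integrable[OF ind], auto)+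
    then show ?case by (simp add: fin LIMSEQ_const_iff)
  qed
qed

text \<open>An infinite variance of \<open>T'\<close> makes the claim trivial, and a finite one
  supplies the integrability of the square that Jensen's inequality demands.\<close>

lemma ext_variance_le_if_conditional_expectation:
  assumes "prob_space M" and sub: "subalgebra M F"
    and iT: "integrable M T" and iT': "integrable M T'" and TF: "T \<in> borel_measurable F"
    and eq: "\<And>A. A \<in> sets F \<Longrightarrow> (\<integral>x\<in>A. T' x \<partial>M) = (\<integral>x\<in>A. T x \<partial>M)"
  shows "ext_variance M T \<le> ext_variance M T'"
proof -
  interpret prob_space M by fact
  interpret finite_measure_subalgebra M F by standard (rule sub)
  have "space M \<in> sets F" using sub by (metis subalgebra_def sets.top)
  \<comment> \<open>The whole space is an event of \<open>F\<close>, so the means agree and both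
    variances are taken about the same centre.\<close>
  from eq[OF this] have mean: "(\<integral>x. T' x \<partial>M) = (\<integral>x. T x \<partial>M)"
    using iT iT' by (simp add: set_integral_space)
  define \<mu> where "\<mu> = (\<integral>x. T x \<partial>M)"
  show ?thesis
  proof (cases "ext_variance M T' = \<infinity>")
    case False
    define q where "q t = (t - \<mu>)\<^sup>2" for t :: real
    have [measurable]: "T' \<in> borel_measurable M" "T \<in> borel_measurable M" using iT iT' by auto
    have qm [measurable]: "q \<in> borel_measurable borel" unfolding q_def by measurable
    have q0: "0 \<le> q t" for t by (simp add: q_def)
    have V': "ext_variance M T' = (\<integral>\<^sup>+x. ennreal (q (T' x)) \<partial>M)"
      by (simp add: ext_variance_def mean \<mu>_def q_def)
    have V: "ext_variance M T = (\<integral>\<^sup>+x. ennreal (q (T x)) \<partial>M)"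
      by (simp add: ext_variance_def \<mu>_def q_def)
    have iq: "integrable M (\<lambda>x. q (T' x))"
      using False q0 unfolding V' by (intro integrableI_bounded) (auto simp: top.not_eq_extremum)
    have "convex_on UNIV q"
      unfolding q_def
    proof (rule f''_ge0_imp_convex[where f'="\<lambda>t. 2 * (t - \<mu>)" and f''="\<lambda>_. 2"])
    qed (auto intro!: derivative_eq_intros)
    then have J: "AE x in M. q (real_cond_exp M F T' x) \<le> real_cond_exp M F (\<lambda>x. q (T' x)) x"
      by (intro real_cond_exp_jensens_inequality(2)[where I=UNIV]) (use iT' iq in auto)
    have C: "AE x in M. real_cond_exp M F T' x = T x"
      by (rule real_cond_exp_charact[OF eq iT' iT TF])
    have ic: "integrable M (real_cond_exp M F (\<lambda>x. q (T' x)))" by (rule real_cond_exp_int(1)[OF iq])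
    have "ext_variance M T \<le> (\<integral>\<^sup>+x. ennreal (real_cond_exp M F (\<lambda>x. q (T' x)) x) \<partial>M)"
      unfolding V by (rule nn_integral_mono_AE) (use J C in eventually_elim, auto intro: ennreal_leI)
    also have "\<dots> = ennreal (\<integral>x. real_cond_exp M F (\<lambda>x. q (T' x)) x \<partial>M)"
    proof (rule nn_integral_eq_integral[OF ic])
      show "AE x in M. 0 \<le> real_cond_exp M F (\<lambda>x. q (T' x)) x"
        using J by eventually_elim (use q0 order_trans in blast)
    qed
    also have "(\<integral>x. real_cond_exp M F (\<lambda>x. q (T' x)) x \<partial>M) = (\<integral>x. q (T' x) \<partial>M)" by (rule real_cond_exp_int(2)[OF iq])
    also have "ennreal (\<integral>x. q (T' x) \<partial>M) = ext_variance M T'"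
      unfolding V' by (rule nn_integral_eq_integral[symmetric, OF iq]) (simp add: q0)
    finally show ?thesis .
  qed simp
qed


section \<open>The exponential family and its bounded generating statistic\<close>

lemma matrix_mult_row: "(A ** C) $ i = (\<Sum>j\<in>UNIV. A $ i $ j *\<^sub>R C $ j)" for A :: "real^'k^'n" and C :: "real^'p^'k"
  by (simp add: matrix_matrix_mult_def vec_eq_iff)

text \<open>Expanding the normal exponent exhibits the exponential family: \<open>Y\<close> enters
  only through \<open>row_quad \<Omega> Y\<close> and \<open>transpose A ** Y\<close>.\<close>

lemma row_quad_diff_mult:
  fixes A :: "real^'k^'n" and Y :: "real^'p^'n"
  assumes "psd \<Omega>"
  shows "row_quad \<Omega> (Y - A ** B) = row_quad \<Omega> Y - 2 * ((\<chi> j. \<Omega> *v B $ j) \<bullet> (transpose A ** Y)) + row_quad \<Omega> (A ** B)"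
proof -
  have sym: "x \<bullet> (\<Omega> *v y) = y \<bullet> (\<Omega> *v x)" for x y
    using psdD(3)[OF assms, of x y] by (simp add: inner_commute)
  have "row_quad \<Omega> (Y - A ** B) = row_quad \<Omega> Y - 2 * (\<Sum>i\<in>UNIV. Y $ i \<bullet> (\<Omega> *v (A ** B) $ i)) + row_quad \<Omega> (A ** B)"
  proof -
    have "(y - z) \<bullet> (\<Omega> *v (y - z)) = y \<bullet> (\<Omega> *v y) - 2 * (y \<bullet> (\<Omega> *v z)) + z \<bullet> (\<Omega> *v z)" for y z
      using sym[of z y] by (simp add: matrix_vector_mult_diff_distrib inner_diff_left inner_diff_right)
    then show ?thesis by (simp add: row_quad_def sum.distrib sum_subtractf sum_distrib_left)
  qed
  also have "(\<Sum>i\<in>UNIV. Y $ i \<bullet> (\<Omega> *v (A ** B) $ i)) = (\<Sum>i\<in>UNIV. \<Sum>j\<in>UNIV. A $ i $ j * (Y $ i \<bullet> (\<Omega> *v B $ j)))"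
    by (simp add: matrix_mult_row linear_sum[OF matrix_vector_mul_linear] matrix_vector_mult_scaleR inner_sum_right)
  also have "\<dots> = (\<Sum>j\<in>UNIV. \<Sum>i\<in>UNIV. A $ i $ j * (Y $ i \<bullet> (\<Omega> *v B $ j)))" by (rule sum.swap)
  also have "\<dots> = (\<chi> j. \<Omega> *v B $ j) \<bullet> (transpose A ** Y)"
    by (subst inner_vec_def) (simp add: matrix_mult_row transpose_def inner_sum_right inner_commute)
  finally show ?thesis .
qed

text \<open>The unnormalised density with natural parameters Omega = Sigma^-1 and H = B
  Sigma^-1.\<close>

definition exp_stat :: "real^'k^'n \<Rightarrow> real^'p^'p \<Rightarrow> real^'p^'k \<Rightarrow> real^'p^'n \<Rightarrow> real" where
  "exp_stat A \<Omega> H Y = exp (- row_quad \<Omega> Y / 2 + H \<bullet> (transpose A ** Y))"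

lemma row_quad_measurable [measurable]: "row_quad \<Omega> \<in> borel_measurable borel"
  unfolding row_quad_def[abs_def] by measurable

lemma exp_stat_measurable [measurable]: "exp_stat A \<Omega> H \<in> borel_measurable borel"
  unfolding exp_stat_def[abs_def] by measurable

lemma exp_stat_mult: "exp_stat A \<Omega> H Y * exp_stat A \<Omega>' H' Y = exp_stat A (\<Omega> + \<Omega>') (H + H') Y"
proof -
  have "row_quad (\<Omega> + \<Omega>') Y = row_quad \<Omega> Y + row_quad \<Omega>' Y"
    by (simp add: row_quad_def matrix_vector_mult_add_rdistrib inner_add_right sum.distrib)
  then show ?thesis by (simp add: exp_stat_def exp_add[symmetric] inner_add_left add_divide_distrib)
qed

lemma matrix_normal_density_exp_stat:
  fixes A :: "real^'k^'n" and B :: "real^'p^'k"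
  assumes "pos_def \<Sigma>"
  shows "matrix_normal_density (A ** B) \<Sigma> Y = exp (- row_quad (matrix_inv \<Sigma>) (A ** B) / 2) /
    sqrt ((2 * pi) ^ CARD('p) * det \<Sigma>) ^ CARD('n) * exp_stat A (matrix_inv \<Sigma>) (\<chi> j. matrix_inv \<Sigma> *v B $ j) Y"
  unfolding matrix_normal_density_exp row_quad_diff_mult[OF pos_def_imp_psd[OF pos_def_matrix_inv[OF assms]]] exp_stat_def
  by (simp add: exp_add[symmetric] exp_diff add_divide_distrib diff_divide_distrib)

text \<open>Each positive definite Omega occurs with every \<open>H\<close>, because
  \<open>B\<close> ranges over all matrices. The set of natural parameters is thus closed under
  addition.\<close>

lemma pos_def_natural_parameter:
  fixes \<Omega> :: "real^'p^'p" and H :: "real^'p^'k"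
  assumes "pos_def \<Omega>"
  obtains \<Sigma> :: "real^'p^'p" and B :: "real^'p^'k"
  where "pos_def \<Sigma>" "matrix_inv \<Sigma> = \<Omega>" "(\<chi> j. \<Omega> *v B $ j) = H"
proof (rule that[of "matrix_inv \<Omega>" "\<chi> j. matrix_inv \<Omega> *v H $ j"])
  show "pos_def (matrix_inv \<Omega>)" by (rule pos_def_matrix_inv[OF assms])
  show "matrix_inv (matrix_inv \<Omega>) = \<Omega>" by (rule matrix_inv_matrix_inv[OF pos_def_det_nz[OF assms]])
  show "(\<chi> j. \<Omega> *v (\<chi> j. matrix_inv \<Omega> *v H $ j) $ j) = H"
    by (simp add: vec_eq_iff matrix_inv_vector(1)[OF pos_def_det_nz[OF assms]])
qed

text \<open>Completing the square with H = B Omega: the exponent is a constant minus half of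
  \<open>row_quad \<Omega> (Y - A ** B)\<close>.\<close>

lemma exp_stat_bounded:
  fixes A :: "real^'k^'n" and \<Omega> :: "real^'p^'p"
  assumes "pos_def \<Omega>"
  shows "\<exists>c. \<forall>Y. exp_stat A \<Omega> H Y \<le> c"
proof -
  obtain \<Sigma> :: "real^'p^'p" and B :: "real^'p^'k" where B: "(\<chi> j. \<Omega> *v B $ j) = H"
    using pos_def_natural_parameter[OF assms, of H] by metis
  have "exp_stat A \<Omega> H Y \<le> exp (row_quad \<Omega> (A ** B) / 2)" for Y
  proof -
    have psd: "psd \<Omega>" by (rule pos_def_imp_psd[OF assms])
    have "0 \<le> row_quad \<Omega> (Y - A ** B)" unfolding row_quad_def by (intro sum_nonneg psdD(2)[OF psd])
    then show ?thesis unfolding row_quad_diff_mult[OF psd] B by (simp add: exp_stat_def)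
  qed
  then show ?thesis by blast
qed

text \<open>Comparing this matrix with the identity isolates the entry (a, b) of Y^T Y. The
  perturbation changes the form by z_a z_b / 2, small enough to keep it positive definite, also for
  a = b.\<close>

definition pert :: "'p::finite \<Rightarrow> 'p \<Rightarrow> real^'p^'p" where
  "pert a b = mat 1 + (1 / 4) *\<^sub>R (outer (axis a 1) (axis b 1) + outer (axis b 1) (axis a 1))"

lemma pert_form: "z \<bullet> (pert a b *v z) = z \<bullet> z + z $ a * z $ b / 2"
  by (simp add: pert_def matrix_vector_mult_add_rdistrib scaleR_matrix_vector_assoc[symmetric] outer_vector
      inner_add_right inner_axis inner_axis')

lemma pos_def_pert: "pos_def (pert a b)"
  unfolding pos_def_def
proof (intro conjI allI impI)
  show "transpose (pert a b) = pert a b"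
    by (simp add: pert_def transpose_def outer_def mat_def vec_eq_iff mult.commute)
  fix z :: "real^'a" assume "z \<noteq> 0"
  then have pos: "0 < z \<bullet> z" by simp
  have sq: "(z $ i)\<^sup>2 \<le> z \<bullet> z" for i
    using component_le_norm_cart[of z i] abs_le_square_iff[of "z $ i" "norm z"] by (simp add: power2_norm_eq_inner)
  have "- 2 * (z $ a * z $ b) \<le> (z $ a)\<^sup>2 + (z $ b)\<^sup>2" using sum_squares_bound[of "z $ a" "- z $ b"] by simp
  then have "- (z $ a * z $ b) \<le> z \<bullet> z" using sq[of a] sq[of b] by simp
  then show "0 < z \<bullet> (pert a b *v z)" unfolding pert_form using pos by linarith
qed

lemma pos_def_mat_1: "pos_def (mat 1)"
  by (simp add: pos_def_def)

lemma pos_def_add: "pos_def S \<Longrightarrow> pos_def R \<Longrightarrow> pos_def (S + R)"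
  by (auto simp: pos_def_def transpose_def vec_eq_iff matrix_vector_mult_add_rdistrib inner_add_right add_pos_pos)

text \<open>Finitely many members of the exponential family, generating the same sigma-algebra as
  the sufficient statistic \<open>(transpose A ** Y, transpose Y ** Y)\<close> but bounded.\<close>

definition stat :: "real^'k^'n \<Rightarrow> real^'p^'n \<Rightarrow> (real^'p^'k) \<times> (real^'p^'p) \<times> real" where
  "stat A Y = ((\<chi> j l. exp_stat A (mat 1) (axis j (axis l 1)) Y), (\<chi> a b. exp_stat A (pert a b) 0 Y), exp_stat A (mat 1) 0 Y)"

text \<open>Every coordinate of \<open>stat\<close> is a member of the family; this reduces linear
  functions of \<open>stat\<close> to members, uniformly over the three kinds of
  coordinates.\<close>

lemma stat_Basis:
  fixes A :: "real^'k^'n" and b :: "(real^'p^'k) \<times> (real^'p^'p) \<times> real"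
  assumes "b \<in> Basis"
  obtains \<Omega> :: "real^'p^'p" and H :: "real^'p^'k"
  where "pos_def \<Omega>" "\<And>Y :: real^'p^'n. stat A Y \<bullet> b = exp_stat A \<Omega> H Y"
proof -
  from assms consider (1) j l where "b = (axis j (axis l 1), 0)" | (2) i l where "b = (0, axis i (axis l 1), 0)" | (3) "b = (0, 0, 1)"
    by (auto simp: Basis_prod_def Basis_vec_def)
  then show thesis
  proof cases
    case 1 then show ?thesis by (intro that[OF pos_def_mat_1]) (simp add: stat_def inner_axis)
  next
    case 2 then show ?thesis by (intro that[OF pos_def_pert]) (simp add: stat_def inner_axis)
  next
    case 3 then show ?thesis by (intro that[OF pos_def_mat_1]) (simp add: stat_def)
  qed
qed

lemma stat_measurable [measurable]:
  fixes A :: "real^'k^'n"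
  shows "(stat A :: real^'p^'n \<Rightarrow> _) \<in> borel_measurable borel"
proof (subst borel_measurable_euclidean_space, intro ballI)
  fix b :: "(real^'p^'k) \<times> (real^'p^'p) \<times> real" assume "b \<in> Basis"
  then obtain \<Omega> :: "real^'p^'p" and H :: "real^'p^'k"
    where "\<And>Y :: real^'p^'n. stat A Y \<bullet> b = exp_stat A \<Omega> H Y" by (rule stat_Basis) blast
  then show "(\<lambda>Y :: real^'p^'n. stat A Y \<bullet> b) \<in> borel_measurable borel" by simp
qed

lemma stat_bounded:
  fixes A :: "real^'k^'n"
  shows "\<exists>c. \<forall>Y :: real^'p^'n. norm (stat A Y) \<le> c"
proof -
  have "\<exists>c. \<forall>Y :: real^'p^'n. \<bar>stat A Y \<bullet> b\<bar> \<le> c" if b: "b \<in> Basis" for b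
  proof -
    obtain \<Omega> :: "real^'p^'p" and H :: "real^'p^'k"
      where 1: "pos_def \<Omega>" and 2: "\<And>Y :: real^'p^'n. stat A Y \<bullet> b = exp_stat A \<Omega> H Y"
      by (rule stat_Basis[OF b]) blast
    have "0 \<le> exp_stat A \<Omega> H Y" for Y :: "real^'p^'n" by (simp add: exp_stat_def)
    with exp_stat_bounded[OF 1, of A H] show ?thesis unfolding 2 by auto
  qed
  then obtain c where c: "\<And>b (Y :: real^'p^'n). b \<in> Basis \<Longrightarrow> \<bar>stat A Y \<bullet> b\<bar> \<le> c b" by metis
  have "norm (stat A Y) \<le> (\<Sum>b\<in>Basis. c b)" for Y :: "real^'p^'n"
    by (rule order_trans[OF norm_le_l1 sum_mono]) (rule c)
  then show ?thesis by blast
qed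

text \<open>Multiplying by a coordinate of \<open>stat\<close> adds its parameters to (Omega, H) and
  so lands on another member, where the integral vanishes by assumption.\<close>

lemma exp_family_polynomials:
  fixes A :: "real^'k^'n" and h :: "real^'p^'n \<Rightarrow> real"
  assumes h: "\<And>\<Omega> H. pos_def \<Omega> \<Longrightarrow> integrable lborel (\<lambda>Y. h Y * exp_stat A \<Omega> H Y)"
    and h0: "\<And>\<Omega> H. pos_def \<Omega> \<Longrightarrow> (\<integral>Y. h Y * exp_stat A \<Omega> H Y \<partial>lborel) = 0"
    and p: "real_polynomial_function p" and pd: "pos_def \<Omega>"
  shows "(\<integral>Y. (h Y * exp_stat A \<Omega> H Y) * p (stat A Y) \<partial>lborel) = 0"
proof -
  \<comment> \<open>Quantifying over all parameters at once makes this property survive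
    multiplication by a member, as induction on products requires.\<close>
  define R where "R f \<longleftrightarrow> (\<forall>(\<Omega> :: real^'p^'p) (H :: real^'p^'k). pos_def \<Omega> \<longrightarrow> integrable lborel (\<lambda>Y. h Y * exp_stat A \<Omega> H Y * f Y) \<and>
      (\<integral>Y. h Y * exp_stat A \<Omega> H Y * f Y \<partial>lborel) = 0)" for f :: "real^'p^'n \<Rightarrow> real"
  have R_add: "R (\<lambda>Y. f Y + g Y)" if "R f" "R g" for f g
    using that unfolding R_def by (simp add: distrib_left)
  have R_cmult: "R (\<lambda>Y. f Y * c)" if "R f" for f c
    using that unfolding R_def by (simp add: mult.assoc[symmetric])
  have R_sum: "R (\<lambda>Y. \<Sum>b\<in>I. f b Y)" if "finite I" "\<And>b. b \<in> I \<Longrightarrow> R (f b)" for I :: "((real^'p^'k) \<times> (real^'p^'p) \<times> real) set" and f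
    using that
  proof (induction I)
    case empty show ?case by (simp add: R_def)
  qed (auto intro: R_add)
  have R_exp: "R (\<lambda>Y. f Y * exp_stat A \<Omega>' H' Y)" if f: "R f" and pd': "pos_def \<Omega>'" for f \<Omega>' H'
    unfolding R_def
  proof (intro allI impI)
    fix \<Omega> :: "real^'p^'p" and H :: "real^'p^'k" assume "pos_def \<Omega>"
    then have "pos_def (\<Omega> + \<Omega>')" using pd' by (rule pos_def_add)
    then have "integrable lborel (\<lambda>Y. h Y * exp_stat A (\<Omega> + \<Omega>') (H + H') Y * f Y) \<and>
      (\<integral>Y. h Y * exp_stat A (\<Omega> + \<Omega>') (H + H') Y * f Y \<partial>lborel) = 0" using f unfolding R_def by blast
    then show "integrable lborel (\<lambda>Y. h Y * exp_stat A \<Omega> H Y * (f Y * exp_stat A \<Omega>' H' Y)) \<and>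
      (\<integral>Y. h Y * exp_stat A \<Omega> H Y * (f Y * exp_stat A \<Omega>' H' Y) \<partial>lborel) = 0"
      by (simp add: exp_stat_mult[symmetric] mult_ac)
  qed
  have "\<forall>f. R f \<longrightarrow> R (\<lambda>Y. f Y * p (stat A Y))"
    using p
  proof (induction p rule: real_polynomial_function.induct)
    case (linear p)
    interpret p: bounded_linear p by fact
    have e: "p (stat A Y) = (\<Sum>b\<in>Basis. (stat A Y \<bullet> b) * p b)" for Y
    proof -
      have "p (stat A Y) = p (\<Sum>b\<in>Basis. (stat A Y \<bullet> b) *\<^sub>R b)" by (simp add: euclidean_representation)
      then show ?thesis by (simp add: p.sum p.scaleR)
    qed
    show ?case
    proof (intro allI impI)
      fix f assume f: "R f"
      have "R (\<lambda>Y. \<Sum>b\<in>Basis. (f Y * (stat A Y \<bullet> b)) * p b)"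
      proof (rule R_sum[OF finite_Basis])
        fix b :: "(real^'p^'k) \<times> (real^'p^'p) \<times> real" assume "b \<in> Basis"
        then obtain \<Omega> :: "real^'p^'p" and H :: "real^'p^'k"
          where 1: "pos_def \<Omega>" and 2: "\<And>Y :: real^'p^'n. stat A Y \<bullet> b = exp_stat A \<Omega> H Y" by (rule stat_Basis) blast
        show "R (\<lambda>Y. (f Y * (stat A Y \<bullet> b)) * p b)" unfolding 2 by (intro R_cmult R_exp f 1)
      qed
      then show "R (\<lambda>Y. f Y * p (stat A Y))" unfolding e by (simp add: sum_distrib_left mult.assoc)
    qed
  next
    case (const c) show ?case by (auto intro: R_cmult)
  next
    case (add f g) then show ?case by (auto simp: distrib_left intro: R_add)
  next
    case (mult f g)
    show ?case
    proof (intro allI impI)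
      fix k assume "R k"
      then have "R (\<lambda>Y. (k Y * f (stat A Y)) * g (stat A Y))" using mult.IH by blast
      then show "R (\<lambda>Y. k Y * (f (stat A Y) * g (stat A Y)))" by (simp add: mult.assoc)
    qed
  qed
  moreover have "R (\<lambda>_. 1)" using h h0 by (simp add: R_def)
  ultimately have "R (\<lambda>Y. 1 * p (stat A Y))" by blast
  then show ?thesis using pd by (simp add: R_def)
qed

definition stat_algebra :: "real^'k^'n \<Rightarrow> (real^'p^'n) measure" where
  "stat_algebra A = vimage_algebra UNIV (stat A) borel"

lemma stat_measurable_algebra [measurable]: "stat A \<in> borel_measurable (stat_algebra A)"
  unfolding stat_algebra_def by (rule measurable_vimage_algebra1) simp

text \<open>Two members with equal quadratic part have a ratio whose logarithm is an entry of A^T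
  Y.\<close>

lemma sufficient_linear_measurable: "(\<lambda>Y :: real^'p^'n. (transpose A ** Y) $ j $ l) \<in> borel_measurable (stat_algebra A)"
proof -
  have "(\<lambda>s :: (real^'p^'a) \<times> (real^'p^'p) \<times> real. ln (fst s $ j $ l) - ln (snd (snd s))) \<in> borel_measurable borel"
  proof -
    have "(\<lambda>s :: (real^'p^'a) \<times> (real^'p^'p) \<times> real. fst s $ j $ l) \<in> borel_measurable borel"
      "(\<lambda>s :: (real^'p^'a) \<times> (real^'p^'p) \<times> real. snd (snd s)) \<in> borel_measurable borel"
      by (intro borel_measurable_continuous_onI continuous_intros)+
    then show ?thesis by measurable
  qed
  from measurable_compose[OF stat_measurable_algebra this]
  have "(\<lambda>Y :: real^'p^'n. ln (fst (stat A Y) $ j $ l) - ln (snd (snd (stat A Y)))) \<in> borel_measurable (stat_algebra A)" .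
  moreover have "ln (fst (stat A Y) $ j $ l) - ln (snd (snd (stat A Y))) = (transpose A ** Y) $ j $ l" for Y :: "real^'p^'n"
    by (simp add: stat_def exp_stat_def inner_axis')
  ultimately show ?thesis by simp
qed

text \<open>Again a logarithm of a ratio. The factor 4 undoes the 1/4 that arises when the exponent
  halves the perturbation z_a z_b / 2 of \<open>pert\<close>.\<close>

lemma sufficient_quad_measurable: "(\<lambda>Y :: real^'p^'n. (transpose Y ** Y) $ a $ b) \<in> borel_measurable (stat_algebra A)"
proof -
  have "(\<lambda>s :: (real^'p^'a) \<times> (real^'p^'p) \<times> real. 4 * (ln (snd (snd s)) - ln (fst (snd s) $ a $ b))) \<in> borel_measurable borel"
  proof -
    have "(\<lambda>s :: (real^'p^'a) \<times> (real^'p^'p) \<times> real. fst (snd s) $ a $ b) \<in> borel_measurable borel"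
      "(\<lambda>s :: (real^'p^'a) \<times> (real^'p^'p) \<times> real. snd (snd s)) \<in> borel_measurable borel"
      by (intro borel_measurable_continuous_onI continuous_intros)+
    then show ?thesis by measurable
  qed
  from measurable_compose[OF stat_measurable_algebra this]
  have "(\<lambda>Y :: real^'p^'n. 4 * (ln (snd (snd (stat A Y))) - ln (fst (snd (stat A Y)) $ a $ b))) \<in> borel_measurable (stat_algebra A)" .
  moreover have "4 * (ln (snd (snd (stat A Y))) - ln (fst (snd (stat A Y)) $ a $ b)) = (transpose Y ** Y) $ a $ b" for Y :: "real^'p^'n"
    by (simp add: stat_def exp_stat_def row_quad_def pert_form matrix_matrix_mult_def transpose_def sum.distrib sum_divide_distrib[symmetric])
      (simp add: field_simps)
  ultimately show ?thesis by simp
qed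

text \<open>The assumptions range over all parameters although the conclusion concerns one pair: the
  density at that pair is itself a member, and multiplying it by polynomials in \<open>stat\<close>
  reaches the others.\<close>

lemma matrix_normal_complete_sufficient:
  fixes A :: "real^'k^'n" and T T' :: "real^'p^'n \<Rightarrow> real"
  assumes TF: "T \<in> borel_measurable (stat_algebra A)"
    and iT: "\<And>B \<Sigma>. pos_def \<Sigma> \<Longrightarrow> integrable (matrix_normal (A ** B) \<Sigma>) T"
    and iT': "\<And>B \<Sigma>. pos_def \<Sigma> \<Longrightarrow> integrable (matrix_normal (A ** B) \<Sigma>) T'"
    and eq: "\<And>B \<Sigma>. pos_def \<Sigma> \<Longrightarrow> (\<integral>Y. T' Y \<partial>matrix_normal (A ** B) \<Sigma>) = (\<integral>Y. T Y \<partial>matrix_normal (A ** B) \<Sigma>)"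
    and pd0: "pos_def \<Sigma>\<^sub>0"
  shows "ext_variance (matrix_normal (A ** B\<^sub>0) \<Sigma>\<^sub>0) T \<le> ext_variance (matrix_normal (A ** B\<^sub>0) \<Sigma>\<^sub>0) T'"
proof (rule ext_variance_le_if_conditional_expectation[OF prob_space_matrix_normal[OF pd0] _ iT[OF pd0] iT'[OF pd0] TF])
  let ?h = "\<lambda>Y. T' Y - T Y"
  have Tm: "T \<in> borel_measurable borel" "T' \<in> borel_measurable borel"
    using borel_measurable_integrable[OF iT[OF pd0]] borel_measurable_integrable[OF iT'[OF pd0]] by simp_all
  then have hm [measurable]: "?h \<in> borel_measurable borel" by simp
  define cst where "cst \<Sigma> B = exp (- row_quad (matrix_inv \<Sigma>) (A ** B) / 2) / sqrt ((2 * pi) ^ CARD('p) * det \<Sigma>) ^ CARD('n)"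
    for \<Sigma> :: "real^'p^'p" and B :: "real^'p^'k"
  have cst: "0 < cst \<Sigma> B" if "pos_def \<Sigma>" for \<Sigma> B using pos_def_det_pos[OF that] by (simp add: cst_def)
  have fam: "integrable lborel (\<lambda>Y. ?h Y * exp_stat A \<Omega> H Y) \<and> (\<integral>Y. ?h Y * exp_stat A \<Omega> H Y \<partial>lborel) = 0"
    if pdO: "pos_def \<Omega>" for \<Omega> H
  proof -
    obtain \<Sigma> B where S: "pos_def \<Sigma>" "matrix_inv \<Sigma> = \<Omega>" "(\<chi> j. \<Omega> *v B $ j) = H"
      by (rule pos_def_natural_parameter[OF pdO])
    have d: "matrix_normal_density (A ** B) \<Sigma> Y = cst \<Sigma> B * exp_stat A \<Omega> H Y" for Y
      using matrix_normal_density_exp_stat[OF S(1), of A B Y] unfolding S cst_def .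
    have "integrable (matrix_normal (A ** B) \<Sigma>) ?h" using iT[OF S(1)] iT'[OF S(1)] by simp
    then have i: "integrable lborel (\<lambda>Y. cst \<Sigma> B * (?h Y * exp_stat A \<Omega> H Y))"
      using integrable_matrix_normal_iff[OF S(1) hm, of "A ** B"] unfolding d by (simp add: mult_ac)
    have "(\<integral>Y. ?h Y \<partial>matrix_normal (A ** B) \<Sigma>) = 0" using iT[OF S(1)] iT'[OF S(1)] eq[OF S(1)] by simp
    then have "(\<integral>Y. cst \<Sigma> B * (?h Y * exp_stat A \<Omega> H Y) \<partial>lborel) = 0"
      using integral_matrix_normal[OF S(1) hm, of "A ** B"] unfolding d by (simp add: mult_ac)
    with i show ?thesis using cst[OF S(1), of B] by simp
  qed
  have sub: "sets (stat_algebra A :: (real^'p^'n) measure) \<subseteq> sets borel"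
    unfolding stat_algebra_def using measurable_sets[OF stat_measurable] by (auto simp: sets_vimage_algebra2)
  show "subalgebra (matrix_normal (A ** B\<^sub>0) \<Sigma>\<^sub>0) (stat_algebra A)"
    using sub by (simp add: subalgebra_def) (simp add: stat_algebra_def)
  fix E :: "(real^'p^'n) set" assume "E \<in> sets (stat_algebra A)"
  then obtain D where D: "D \<in> sets borel" and E: "E = stat A -` D" by (auto simp: stat_algebra_def sets_vimage_algebra2)
  have Eb [measurable]: "E \<in> sets borel" using \<open>E \<in> sets (stat_algebra A)\<close> sub by auto
  let ?Om = "matrix_inv \<Sigma>\<^sub>0" and ?H = "\<chi> j. matrix_inv \<Sigma>\<^sub>0 *v B\<^sub>0 $ j"
  have pdO: "pos_def ?Om" by (rule pos_def_matrix_inv[OF pd0])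
  obtain c where c: "\<And>Y :: real^'p^'n. norm (stat A Y) \<le> c" using stat_bounded[of A] by blast
  have "(\<integral>Y. (?h Y * exp_stat A ?Om ?H Y) * indicator D (stat A Y) \<partial>lborel) = 0"
    by (rule integral_indicator_eq_0_if_polynomials[OF _ _ c _ D])
       (use fam pdO in \<open>auto intro!: exp_family_polynomials\<close>)
  then have "cst \<Sigma>\<^sub>0 B\<^sub>0 * (\<integral>Y. (?h Y * exp_stat A ?Om ?H Y) * indicator D (stat A Y) \<partial>lborel) = 0" by simp
  then have "(\<integral>Y. matrix_normal_density (A ** B\<^sub>0) \<Sigma>\<^sub>0 Y * (indicator E Y * ?h Y) \<partial>lborel) = 0"
    unfolding integral_mult_right_zero[symmetric] matrix_normal_density_exp_stat[OF pd0] cst_def[symmetric] E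
    by (simp add: indicator_def mult_ac if_distrib cong: if_cong)
  then have "(\<integral>Y. indicator E Y * ?h Y \<partial>matrix_normal (A ** B\<^sub>0) \<Sigma>\<^sub>0) = 0"
    by (subst integral_matrix_normal[OF pd0]) auto
  moreover have "integrable (matrix_normal (A ** B\<^sub>0) \<Sigma>\<^sub>0) (\<lambda>Y. indicator E Y * f Y)"
    if "integrable (matrix_normal (A ** B\<^sub>0) \<Sigma>\<^sub>0) f" for f :: "real^'p^'n \<Rightarrow> real"
    using that integrable_mult_indicator[of E "matrix_normal (A ** B\<^sub>0) \<Sigma>\<^sub>0" f] by simp
  ultimately show "(\<integral>Y\<in>E. T' Y \<partial>matrix_normal (A ** B\<^sub>0) \<Sigma>\<^sub>0) = (\<integral>Y\<in>E. T Y \<partial>matrix_normal (A ** B\<^sub>0) \<Sigma>\<^sub>0)"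
    using iT[OF pd0] iT'[OF pd0] by (simp add: set_lebesgue_integral_def right_diff_distrib)
qed

section \<open>Least squares projections\<close>

definition hat :: "real^'k^'n \<Rightarrow> real^'n^'n" where
  "hat A = A ** gram_inv A ** transpose A"

lemma pos_def_gram:
  fixes A :: "real^'k^'n"
  assumes "inj ((*v) A)"
  shows "pos_def (transpose A ** A)"
  unfolding pos_def_def
proof (intro conjI allI impI)
  show "transpose (transpose A ** A) = transpose A ** A" by (simp add: matrix_transpose_mul)
  fix x :: "real^'k" assume "x \<noteq> 0"
  then have "A *v x \<noteq> 0" using assms by (metis injD matrix_vector_mult_0_right)
  moreover have "x \<bullet> ((transpose A ** A) *v x) = (A *v x) \<bullet> (A *v x)"
    using inner_matrix_vector_transpose[of x "transpose A" "A *v x"] by (simp add: matrix_vector_mul_assoc)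
  ultimately show "0 < x \<bullet> ((transpose A ** A) *v x)" by simp
qed

lemma
  fixes A :: "real^'k^'n"
  assumes "inj ((*v) A)"
  shows gram_inv_mult: "gram_inv A ** (transpose A ** A) = mat 1"
    and pos_def_gram_inv: "pos_def (gram_inv A)"
    and transpose_hat: "transpose (hat A) = hat A"
    and hat_mult_self: "hat A ** A = A"
    and hat_idem: "hat A ** hat A = hat A"
    and trace_hat: "trace (hat A) = real CARD('k)"
proof -
  note pd = pos_def_gram[OF assms]
  show inv: "gram_inv A ** (transpose A ** A) = mat 1"
    unfolding gram_inv_def by (rule matrix_inv_inverse(2)[OF pos_def_det_nz[OF pd]])
  show pi: "pos_def (gram_inv A)" unfolding gram_inv_def by (rule pos_def_matrix_inv[OF pd])
  then have "transpose (gram_inv A) = gram_inv A" by (simp add: pos_def_def)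
  then show "transpose (hat A) = hat A" by (simp add: hat_def matrix_transpose_mul matrix_mul_assoc)
  have "hat A ** A = A ** (gram_inv A ** (transpose A ** A))" by (simp add: hat_def matrix_mul_assoc)
  then show hA: "hat A ** A = A" by (simp add: inv)
  have "hat A ** hat A = (hat A ** A) ** gram_inv A ** transpose A" by (simp add: hat_def matrix_mul_assoc)
  then show "hat A ** hat A = hat A" unfolding hA by (simp add: hat_def)
  have "trace (hat A) = trace (transpose A ** (A ** gram_inv A))"
    unfolding hat_def by (rule trace_mul_sym)
  also have "\<dots> = trace ((transpose A ** A) ** gram_inv A)" by (simp add: matrix_mul_assoc)
  also have "\<dots> = trace (gram_inv A ** (transpose A ** A))" by (rule trace_mul_sym)
  finally show "trace (hat A) = real CARD('k)" by (simp add: inv trace_I)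
qed

text \<open>A 0-1 matrix that turns the choice of columns into right multiplication. Inclusion of
  column spaces and dependence on A^T Y then become matrix identities.\<close>

definition embed :: "('j \<Rightarrow> 'k) \<Rightarrow> real^'j^'k" where
  "embed \<iota> = (\<chi> c a. of_bool (c = \<iota> a))"

lemma sub_cols_eq_mult: "sub_cols A \<iota> = A ** embed \<iota>" for A :: "real^'k^'n"
  by (simp add: sub_cols_def embed_def matrix_matrix_mult_def vec_eq_iff of_bool_def if_distrib cong: if_cong)

lemma inj_embed:
  fixes \<iota> :: "'j::finite \<Rightarrow> 'k::finite"
  assumes "inj \<iota>" shows "inj ((*v) (embed \<iota>))"
proof -
  have "embed \<iota> *v z = 0 \<Longrightarrow> z = 0" for z :: "real^'j"
  proof (subst vec_eq_iff, rule allI)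
    fix a assume z: "embed \<iota> *v z = 0"
    have "(embed \<iota> *v z) $ \<iota> a = (\<Sum>b\<in>UNIV. if b = a then z $ b else 0)"
      unfolding matrix_vector_mult_def embed_def vec_lambda_beta
      by (intro sum.cong) (use assms in \<open>auto simp: inj_eq\<close>)
    with z show "z $ a = 0 $ a" by simp
  qed
  then show ?thesis by (simp add: linear_injective_0[OF matrix_vector_mul_linear])
qed

lemma inj_sub_cols:
  fixes A :: "real^'k^'n" and \<iota> :: "'j::finite \<Rightarrow> 'k"
  assumes "inj ((*v) A)" "inj \<iota>"
  shows "inj ((*v) (sub_cols A \<iota>))"
  using inj_compose[OF assms(1) inj_embed[OF assms(2)]]
  by (simp add: sub_cols_eq_mult matrix_vector_mult_matrix_matrix_mult_compose)

section \<open>Diagonal matrices, traces and quadratic losses\<close>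

lemma diag_mat_mult_row: "(diag_mat d ** B) $ a = d $ a *\<^sub>R B $ a" for B :: "real^'p^'j"
  by (simp add: diag_mat_def matrix_matrix_mult_def vec_eq_iff if_distrib[where f="\<lambda>x. x * _"] cong: if_cong)

lemma diag_mat_mult: "diag_mat c ** diag_mat d = diag_mat (\<chi> a. c $ a * d $ a)"
  by (subst vec_eq_iff) (simp add: diag_mat_mult_row, simp add: diag_mat_def vec_eq_iff)

lemma matrix_inv_diag_mat:
  assumes "\<And>a. c $ a \<noteq> 0"
  shows "matrix_inv (diag_mat c) = diag_mat (\<chi> a. 1 / c $ a)"
  by (rule matrix_inv_eqI(1)) (use assms in \<open>simp add: diag_mat_mult, simp add: diag_mat_def mat_def vec_eq_iff\<close>)

lemma trace_diag_mat: "trace (diag_mat d) = (\<Sum>a\<in>UNIV. d $ a)"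
  by (simp add: trace_def diag_mat_def)

text \<open>Splitting R into R R and cycling the trace puts the projection on both sides. The trace
  becomes a sum of forms x^T K x with x = Y^T R e_i, to which the expectations for a single
  direction apply.\<close>

lemma trace_mult_gram:
  fixes K :: "real^'p^'p" and Y :: "real^'p^'n"
  assumes "transpose R = R" "R ** R = R"
  shows "trace (K ** (transpose Y ** R ** Y)) =
    (\<Sum>i\<in>UNIV. (transpose Y *v (R *v axis i 1)) \<bullet> (K *v (transpose Y *v (R *v axis i 1))))"
proof -
  have "(K ** transpose Y ** R) ** (R ** Y) = K ** (transpose Y ** (R ** R) ** Y)" by (simp only: matrix_mul_assoc)
  then have "trace (K ** (transpose Y ** R ** Y)) = trace ((K ** transpose Y ** R) ** (R ** Y))" by (simp only: assms(2))
  also have "\<dots> = trace ((R ** Y) ** (K ** transpose Y ** R))" by (rule trace_mul_sym)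
  also have "\<dots> = (\<Sum>i\<in>UNIV. axis i 1 \<bullet> (((R ** Y) ** (K ** transpose Y ** R)) *v axis i 1))"
    by (rule trace_eq_sum_inner_axis)
  also have "\<dots> = (\<Sum>i\<in>UNIV. (transpose Y *v (R *v axis i 1)) \<bullet> (K *v (transpose Y *v (R *v axis i 1))))"
  proof (rule sum.cong[OF refl])
    fix i :: 'n
    let ?e = "axis i 1 :: real^'n"
    have "?e \<bullet> (((R ** Y) ** (K ** transpose Y ** R)) *v ?e) = ?e \<bullet> (R *v (Y *v (K *v (transpose Y *v (R *v ?e)))))"
      by (simp only: matrix_vector_mul_assoc[symmetric])
    also have "\<dots> = (transpose Y *v (R *v ?e)) \<bullet> (K *v (transpose Y *v (R *v ?e)))"
      by (simp only: inner_matrix_vector_transpose[of _ R] inner_matrix_vector_transpose[of _ Y] assms(1))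
    finally show "?e \<bullet> (((R ** Y) ** (K ** transpose Y ** R)) *v ?e) =
        (transpose Y *v (R *v ?e)) \<bullet> (K *v (transpose Y *v (R *v ?e)))" .
  qed
  finally show ?thesis .
qed

lemma transpose_mult_axis: "transpose Y *v axis i 1 = Y $ i" for Y :: "real^'p^'n"
  by (simp add: matrix_vector_mult_basis column_def transpose_def)

lemma sq_loss_eq_row_quad:
  fixes AJ :: "real^'j^'n" and M :: "real^'p^'n"
  shows "sq_loss AJ M \<Sigma> \<Phi> = row_quad (matrix_inv \<Sigma>) (AJ ** \<Phi> - M)"
  using trace_mult_gram[of "mat 1 :: real^'n^'n" "matrix_inv \<Sigma>" "AJ ** \<Phi> - M"]
  by (simp add: sq_loss_def row_quad_def matrix_mul_assoc transpose_mult_axis)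

lemma row_quad_uminus: "row_quad \<Omega> (- Z) = row_quad \<Omega> Z"
proof -
  have "\<Omega> *v (- z) = - (\<Omega> *v z)" for z
    using matrix_vector_mult_scaleR[of \<Omega> "-1" z] by simp
  then show ?thesis by (simp add: row_quad_def)
qed

text \<open>Pythagoras in the Omega-weighted norm: the cross term vanishes because \<open>W\<close>
  is orthogonal to the columns of \<open>U\<close>, and U^T U is the inverse of
  \<open>diag_mat d\<close>.\<close>

lemma row_quad_mult_diag:
  fixes U :: "real^'j^'n" and Z :: "real^'p^'j"
  assumes \<Omega>: "psd \<Omega>" and U: "diag_mat d ** (transpose U ** U) = mat 1" and d: "\<And>a. 0 < d $ a"
    and orth: "transpose U ** W = 0"
  shows "row_quad \<Omega> (U ** Z - W) = (\<Sum>a\<in>UNIV. 1 / d $ a * (Z $ a \<bullet> (\<Omega> *v Z $ a))) + row_quad \<Omega> W"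
proof -
  have z0: "row_quad \<Omega> (0 :: real^'p^'n) = 0" by (simp add: row_quad_def)
  have UUZ: "(transpose U ** (U ** Z)) $ a = (1 / d $ a) *\<^sub>R Z $ a" for a
  proof -
    have "Z = diag_mat d ** (transpose U ** (U ** Z))" using U by (simp add: matrix_mul_assoc)
    then have "Z $ a = d $ a *\<^sub>R (transpose U ** (U ** Z)) $ a" by (metis diag_mat_mult_row)
    then show ?thesis using d[of a] by simp
  qed
  have "row_quad \<Omega> (U ** Z) = (\<chi> j. \<Omega> *v Z $ j) \<bullet> (transpose U ** (U ** Z))"
    using row_quad_diff_mult[OF \<Omega>, of "U ** Z" U Z] by (simp add: z0)
  also have "\<dots> = (\<Sum>a\<in>UNIV. 1 / d $ a * (Z $ a \<bullet> (\<Omega> *v Z $ a)))"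
    by (subst inner_vec_def) (simp add: UUZ inner_commute)
  finally have q: "row_quad \<Omega> (U ** Z) = (\<Sum>a\<in>UNIV. 1 / d $ a * (Z $ a \<bullet> (\<Omega> *v Z $ a)))" .
  have "row_quad \<Omega> (U ** Z - W) = row_quad \<Omega> (W - U ** Z)"
    using row_quad_uminus[of \<Omega> "W - U ** Z"] by simp
  then show ?thesis unfolding row_quad_diff_mult[OF \<Omega>, of W U Z] orth q by simp
qed

lemma transpose_mult_row: "(transpose U ** Y) $ a = transpose Y *v (U *v axis a 1)"
  for U :: "real^'j^'n" and Y :: "real^'p^'n"
  unfolding matrix_mult_row transpose_mult_eq_sum
  by (simp add: transpose_def matrix_vector_mult_basis column_def)

lemma model_mean_eq_mult: "model_mean A K B = A ** (\<chi> j. if j \<in> K then B $ j else 0)" for A :: "real^'k^'n"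
proof -
  have "(\<Sum>j\<in>K. A $ i $ j * B $ j $ l) = (\<Sum>j\<in>UNIV. A $ i $ j * (if j \<in> K then B $ j else 0) $ l)" for i l
    by (rule sum.mono_neutral_cong_left) auto
  then show ?thesis by (simp add: model_mean_def matrix_matrix_mult_def vec_eq_iff)
qed

section \<open>The shrinkage estimator in a submodel\<close>

lemma matrix_diff_mult: "(B - C) ** X = B ** X - C ** X" for B C :: "real^'n^'m" and X :: "real^'p^'n"
  by (rule bounded_bilinear.diff_left[OF bounded_bilinear_matrix_mult])

lemma matrix_mult_diff: "X ** (B - C) = X ** B - X ** C" for B C :: "real^'p^'n" and X :: "real^'n^'m"
  by (rule bounded_bilinear.diff_right[OF bounded_bilinear_matrix_mult])

lemma transpose_diff: "transpose (B - C) = transpose B - transpose C" for B C :: "real^'n^'m"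
  by (simp add: transpose_def vec_eq_iff)

text \<open>The mean is only required to be fixed by \<open>hat A\<close>. This covers all true
  models at once, including those with columns outside the candidate set enumerated by
  \<open>\<iota>\<close>.\<close>

locale regression_submodel =
  fixes A :: "real^'k^'n" and \<iota> :: "'j::finite \<Rightarrow> 'k" and P :: "real^'j^'j" and d :: "real^'j"
    and M :: "real^'p^'n" and \<Sigma> :: "real^'p^'p"
  assumes inj_A: "inj ((*v) A)" and inj_iota: "inj \<iota>"
    and orth_P: "orthogonal_matrix P"
    and diag_P: "transpose P ** gram_inv (sub_cols A \<iota>) ** P = diag_mat d"
    and hat_M: "hat A ** M = M" and pd_Sigma: "pos_def \<Sigma>"
    and dims: "CARD('p) + CARD('k) + 1 < CARD('n)" and p3: "3 \<le> CARD('p)"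
begin

abbreviation AJ :: "real^'j^'n" where "AJ \<equiv> sub_cols A \<iota>"
abbreviation Nmat :: "real^'n^'n" where "Nmat \<equiv> mat 1 - hat A"
abbreviation Rmat :: "real^'n^'n" where "Rmat \<equiv> hat A - hat AJ"

lemma inj_AJ: "inj ((*v) AJ)" by (rule inj_sub_cols[OF inj_A inj_iota])

lemma hat_AJ: "hat A ** AJ = AJ"
  by (simp add: sub_cols_eq_mult matrix_mul_assoc hat_mult_self[OF inj_A])

lemma hat_hat: "hat A ** hat AJ = hat AJ" "hat AJ ** hat A = hat AJ"
proof -
  have "hat A ** hat AJ = (hat A ** AJ) ** gram_inv AJ ** transpose AJ"
    unfolding hat_def[of AJ] by (simp only: matrix_mul_assoc)
  then show 1: "hat A ** hat AJ = hat AJ" unfolding hat_AJ by (simp only: hat_def[of AJ])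
  have "hat AJ ** hat A = transpose (hat A ** hat AJ)"
    by (simp only: matrix_transpose_mul transpose_hat[OF inj_A] transpose_hat[OF inj_AJ])
  then show "hat AJ ** hat A = hat AJ" unfolding 1 by (simp only: transpose_hat[OF inj_AJ])
qed

sublocale normal_model M \<Sigma> Nmat
proof
  show "pos_def \<Sigma>" by (rule pd_Sigma)
  show "transpose Nmat = Nmat" by (simp add: transpose_diff transpose_hat[OF inj_A] transpose_mat)
  show "Nmat ** Nmat = Nmat" by (simp add: matrix_diff_mult matrix_mult_diff hat_idem[OF inj_A])
  show "Nmat ** M = 0" by (simp add: matrix_diff_mult hat_M)
qed

lemma trace_N: "trace Nmat = real CARD('n) - real CARD('k)"
  by (simp add: trace_sub trace_I trace_hat[OF inj_A])

lemma df: "real CARD('p) + 1 < trace Nmat"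
  using dims unfolding trace_N by linarith

lemma SS_eq: "SS = resid_SS A"
proof
  show "SS Y = resid_SS A Y" for Y unfolding SS_def unfolding resid_SS_def hat_def ..
qed

section \<open>Orthogonal directions of the submodel\<close>

definition U :: "real^'j^'n" where "U = AJ ** P"
text \<open>The columns of \<open>U\<close> are orthogonal with squared norms 1 / d_a. Scaling by
  d_a makes Y^T r_a the row a of \<open>X_mat\<close> and gives r_a the squared norm d_a.\<close>

definition r :: "'j \<Rightarrow> real^'n" where "r a = d $ a *\<^sub>R (U *v axis a 1)"

lemma P_P: "transpose P ** P = mat 1" "P ** transpose P = mat 1"
  using orth_P by (simp_all add: orthogonal_matrix_def)

lemma d_pos: "0 < d $ a"
proof -
  let ?v = "P *v axis a 1"
  have "transpose P *v ?v = axis a 1" by (simp add: matrix_vector_mul_assoc P_P)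
  then have "?v \<noteq> 0" by (metis axis_eq_0_iff matrix_vector_mult_0_right zero_neq_one)
  then have "0 < ?v \<bullet> (gram_inv AJ *v ?v)" using pos_def_gram_inv[OF inj_AJ] by (simp add: pos_def_def)
  also have "?v \<bullet> (gram_inv AJ *v ?v) = axis a 1 \<bullet> ((transpose P ** gram_inv AJ ** P) *v axis a 1)"
    using inner_matrix_vector_transpose[of "axis a 1" "transpose P" "gram_inv AJ *v ?v"]
    by (simp only: matrix_vector_mul_assoc transpose_transpose matrix_mul_assoc)
  also have "\<dots> = d $ a" unfolding diag_P by (simp add: inner_axis' matrix_vector_mult_basis column_def diag_mat_def)
  finally show ?thesis .
qed

lemma gram_inv_eq: "gram_inv AJ = P ** diag_mat d ** transpose P"
proof -
  have "P ** diag_mat d ** transpose P = (P ** transpose P) ** gram_inv AJ ** (P ** transpose P)"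
    unfolding diag_P[symmetric] by (simp only: matrix_mul_assoc)
  then show ?thesis by (simp add: P_P)
qed

lemma U_gram: "diag_mat d ** (transpose U ** U) = mat 1"
proof -
  have "diag_mat d ** (transpose U ** U) = transpose P ** gram_inv AJ ** (P ** transpose P) ** (transpose AJ ** AJ) ** P"
    unfolding diag_P[symmetric] U_def by (simp only: matrix_transpose_mul matrix_mul_assoc)
  also have "\<dots> = transpose P ** (gram_inv AJ ** (transpose AJ ** AJ)) ** P" by (simp add: P_P matrix_mul_assoc)
  finally show ?thesis by (simp add: gram_inv_mult[OF inj_AJ] P_P)
qed

lemma r_norm: "r a \<bullet> r a = d $ a"
proof -
  have "(transpose U ** U) $ a $ a = (U *v axis a 1) \<bullet> (U *v axis a 1)"
    using inner_matrix_vector_transpose[of "axis a 1" "transpose U" "U *v axis a 1"]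
    by (simp only: transpose_mult_row transpose_transpose) (simp add: inner_axis')
  moreover have "d $ a * (transpose U ** U) $ a $ a = 1"
    using arg_cong[OF U_gram, of "\<lambda>B. B $ a $ a"] by (simp add: diag_mat_mult_row mat_def)
  ultimately show ?thesis by (simp add: r_def)
qed

lemma r_nz: "r a \<noteq> 0"
proof
  assume "r a = 0"
  then have "r a \<bullet> r a = 0" by (simp only: inner_zero_left)
  with r_norm[of a] d_pos[of a] show False by simp
qed

lemma N_r: "Nmat *v r a = 0"
proof -
  have "Nmat ** AJ = 0" by (simp add: matrix_diff_mult hat_AJ)
  then have "Nmat ** U = 0" by (simp add: U_def matrix_mul_assoc)
  then show ?thesis by (simp add: r_def matrix_vector_mult_scaleR matrix_vector_mul_assoc)
qed

lemma diag_U_row: "(diag_mat d ** (transpose U ** Y)) $ a = xv (r a) Y"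
  by (simp add: diag_mat_mult_row transpose_mult_row xv_def r_def matrix_vector_mult_scaleR)

lemma X_mat_eq: "X_mat A \<iota> P d Y = diag_mat d ** (transpose U ** Y)"
  by (simp add: X_mat_def U_def matrix_transpose_mul matrix_mul_assoc)

text \<open>The event on which all inverses involved are genuine. Outside it
  \<open>matrix_inv\<close> returns a default value, so the scalar formulas below hold only almost
  surely.\<close>

definition good :: "real^'p^'n \<Rightarrow> bool" where
  "good Y \<longleftrightarrow> det (SS Y) \<noteq> 0 \<and> (\<forall>a. 0 < cv (r a) Y)"

lemma AE_good: "AE Y in law. good Y"
proof -
  have "AE Y in law. \<forall>a. 0 < cv (r a) Y"
    using AE_cv_pos[OF N_r df p3 r_nz] by (simp add: AE_all_countable)
  with AE_det_SS[OF df] show ?thesis unfolding good_def by eventually_elim simp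
qed

text \<open>Up to the common factor E (1 / c), shrinkage in direction a changes the risk by - 2 lam
  (p - 2) + lam^2 (n - k - p + 3) / d_a. This value is the minimiser, with minimum - (p - 2)
  lam.\<close>

definition lam :: "'j \<Rightarrow> real" where
  "lam a = d $ a * (real CARD('p) - 2) / (trace Nmat - real CARD('p) + 3)"

lemma Lambda_mat_eq: "Lambda_mat TYPE('n) TYPE('p) TYPE('k) d = diag_mat (\<chi> a. lam a)"
  by (simp add: Lambda_mat_def lam_def trace_N)

lemma Lambda_C_inv:
  assumes "good Y"
  shows "Lambda_mat TYPE('n) TYPE('p) TYPE('k) d ** matrix_inv (C_mat A \<iota> P d Y) = diag_mat (\<chi> a. lam a / cv (r a) Y)"
proof -
  have "C_mat A \<iota> P d Y = diag_mat (\<chi> a. cv (r a) Y)"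
    by (simp add: C_mat_def X_mat_eq diag_U_row cv_def Kinv_def SS_eq)
  moreover have "cv (r a) Y \<noteq> 0" for a using assms by (simp add: good_def less_imp_neq[symmetric])
  ultimately show ?thesis by (simp add: Lambda_mat_eq matrix_inv_diag_mat diag_mat_mult)
qed

text \<open>The bias of the candidate model: the part of the mean orthogonal to its columns, equal
  to \<open>Rmat ** M\<close>.\<close>

definition Res :: "real^'p^'n" where "Res = M - U ** (\<chi> a. xv (r a) M)"

lemma U_Res: "transpose U ** Res = 0"
proof -
  let ?Xi = "diag_mat d ** (transpose U ** M)"
  have Xi: "(\<chi> a. xv (r a) M) = ?Xi" by (simp add: vec_eq_iff[of _ ?Xi] diag_U_row)
  have "diag_mat d ** (transpose U ** U) ** transpose U ** M = transpose U ** M" by (simp add: U_gram)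
  moreover have "transpose U ** U ** diag_mat d = mat 1"
    using U_gram by (rule matrix_left_right_inverse[THEN iffD1])
  ultimately show ?thesis
    unfolding Res_def Xi matrix_mult_diff by (simp add: matrix_mul_assoc)
qed

lemma hat_AJ_eq: "hat AJ = U ** diag_mat d ** transpose U"
  by (simp add: hat_def gram_inv_eq U_def matrix_transpose_mul matrix_mul_assoc)

lemma R_M: "Rmat ** M = Res"
proof -
  let ?Xi = "diag_mat d ** (transpose U ** M)"
  have Xi: "(\<chi> a. xv (r a) M) = ?Xi" by (simp add: vec_eq_iff[of _ ?Xi] diag_U_row)
  show ?thesis unfolding Res_def Xi matrix_diff_mult hat_M by (simp add: hat_AJ_eq matrix_mul_assoc)
qed

lemma R_sym: "transpose Rmat = Rmat"
  by (simp add: transpose_diff transpose_hat[OF inj_A] transpose_hat[OF inj_AJ])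

lemma R_idem: "Rmat ** Rmat = Rmat"
  by (simp add: matrix_diff_mult matrix_mult_diff hat_idem[OF inj_A] hat_idem[OF inj_AJ] hat_hat)

lemma N_R: "Nmat *v (Rmat *v v) = 0"
proof -
  have "Nmat ** Rmat = 0" by (simp add: matrix_diff_mult matrix_mult_diff hat_idem[OF inj_A] hat_hat)
  then show ?thesis by (simp add: matrix_vector_mul_assoc)
qed

abbreviation loss :: "real^'p^'n \<Rightarrow> real" where
  "loss Y \<equiv> sq_loss AJ M \<Sigma> (B_hat A \<iota> P d Y)"

definition loss' :: "real^'p^'n \<Rightarrow> real" where
  "loss' Y = (\<Sum>a\<in>UNIV. 1 / d $ a * ((xv (r a) Y - xv (r a) M) \<bullet> (Om *v (xv (r a) Y - xv (r a) M))
      - 2 * lam a * (((xv (r a) Y - xv (r a) M) \<bullet> (Om *v xv (r a) Y)) / cv (r a) Y)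
      + (lam a)\<^sup>2 * ((xv (r a) Y \<bullet> (Om *v xv (r a) Y)) / (cv (r a) Y)\<^sup>2))) + row_quad Om Res"

lemma psd_Om: "psd Om" by (rule pos_def_imp_psd[OF pos_def_matrix_inv[OF pd_Sigma]])

text \<open>The error splits orthogonally into the bias \<open>Res\<close> and a combination of the
  columns of \<open>U\<close>, so the loss decouples into one scalar expression per
  direction.\<close>

lemma loss_eq:
  assumes g: "good Y"
  shows "loss Y = loss' Y"
proof -
  define z where "z a = (xv (r a) Y - xv (r a) M) - (lam a / cv (r a) Y) *\<^sub>R xv (r a) Y" for a
  let ?X = "diag_mat d ** (transpose U ** Y)" and ?L = "diag_mat (\<chi> a. lam a / cv (r a) Y)"
  have "AJ ** B_hat A \<iota> P d Y = U ** ((mat 1 - ?L) ** ?X)"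
    unfolding B_hat_def Lambda_C_inv[OF g] U_def by (simp only: matrix_transpose_mul matrix_mul_assoc)
  moreover have "(mat 1 - ?L) ** ?X = (\<chi> a. z a) + (\<chi> a. xv (r a) M)"
    by (subst vec_eq_iff) (simp add: matrix_diff_mult diag_mat_mult_row[of "\<chi> a. lam a / cv (r a) Y"] diag_U_row z_def)
  moreover have "U ** ((\<chi> a. z a) + (\<chi> a. xv (r a) M)) = U ** (\<chi> a. z a) + U ** (\<chi> a. xv (r a) M)"
    by (rule bounded_bilinear.add_right[OF bounded_bilinear_matrix_mult])
  ultimately have "AJ ** B_hat A \<iota> P d Y - M = U ** (\<chi> a. z a) - Res" by (simp add: Res_def)
  then have L: "loss Y = (\<Sum>a\<in>UNIV. 1 / d $ a * (z a \<bullet> (Om *v z a))) + row_quad Om Res"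
    unfolding sq_loss_eq_row_quad
    by (simp only: row_quad_mult_diag[OF psd_Om U_gram d_pos U_Res]) simp
  have q: "z a \<bullet> (Om *v z a) = (xv (r a) Y - xv (r a) M) \<bullet> (Om *v (xv (r a) Y - xv (r a) M))
      - 2 * lam a * (((xv (r a) Y - xv (r a) M) \<bullet> (Om *v xv (r a) Y)) / cv (r a) Y)
      + (lam a)\<^sup>2 * ((xv (r a) Y \<bullet> (Om *v xv (r a) Y)) / (cv (r a) Y)\<^sup>2)" for a
  proof -
    have "(u - t *\<^sub>R x) \<bullet> (Om *v (u - t *\<^sub>R x)) = u \<bullet> (Om *v u) - 2 * t * (u \<bullet> (Om *v x)) + t\<^sup>2 * (x \<bullet> (Om *v x))" for u x t
      using psdD(3)[OF psd_Om, of u x]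
      by (simp add: matrix_vector_mult_diff_distrib matrix_vector_mult_scaleR inner_diff_left inner_diff_right
          power2_eq_square inner_commute right_diff_distrib)
    from this[of "xv (r a) Y - xv (r a) M" "lam a / cv (r a) Y" "xv (r a) Y"] show ?thesis
      by (simp add: z_def power_divide)
  qed
  show ?thesis unfolding L loss'_def q ..
qed

text \<open>Every direction contributes p from its variance; its two shrinkage terms are both
  multiples of E (1 / c).\<close>

lemma
  shows integrable_loss': "integrable law loss'"
    and integral_loss': "(\<integral>Y. loss' Y \<partial>law) = real CARD('p) * real CARD('j)
      - (real CARD('p) - 2) * (\<Sum>a\<in>UNIV. lam a * (\<integral>Y. 1 / cv (r a) Y \<partial>law)) + row_quad Om Res"
proof -
  let ?q = "\<lambda>a Y. (xv (r a) Y - xv (r a) M) \<bullet> (Om *v (xv (r a) Y - xv (r a) M))"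
  let ?s = "\<lambda>a Y. ((xv (r a) Y - xv (r a) M) \<bullet> (Om *v xv (r a) Y)) / cv (r a) Y"
  let ?t = "\<lambda>a Y. (xv (r a) Y \<bullet> (Om *v xv (r a) Y)) / (cv (r a) Y)\<^sup>2"
  let ?I = "\<lambda>a. \<integral>Y. 1 / cv (r a) Y \<partial>law"
  have iq: "integrable law (?q a)" for a
    by (intro poly_growth_integrable[OF pd] poly_growth_inner poly_growth_diff poly_growth_const poly_growth_matrix_vector_mult poly_growth_xv)
  have sh: "integrable law (?s a)" for a by (rule integrable_shrinkage[OF N_r df p3 r_nz])
  have it: "integrable law (?t a)" for a by (rule integrable_quad_ratio[OF N_r df p3 r_nz])
  have i1: "integrable law (\<lambda>Y. 1 / d $ a * (?q a Y - 2 * lam a * ?s a Y + (lam a)\<^sup>2 * ?t a Y))" for a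
    by (intro integrable_mult_right Bochner_Integration.integrable_add Bochner_Integration.integrable_diff iq sh it)
  have i2: "integrable law (\<lambda>Y. \<Sum>a\<in>UNIV. 1 / d $ a * (?q a Y - 2 * lam a * ?s a Y + (lam a)\<^sup>2 * ?t a Y))"
    by (rule Bochner_Integration.integrable_sum) (rule i1)
  show "integrable law loss'" unfolding loss'_def[abs_def]
    by (intro Bochner_Integration.integrable_add i2) simp
  have e: "(\<integral>Y. 1 / d $ a * (?q a Y - 2 * lam a * ?s a Y + (lam a)\<^sup>2 * ?t a Y) \<partial>law) =
      real CARD('p) - (real CARD('p) - 2) * (lam a * ?I a)" for a
  proof -
    have "(\<integral>Y. 1 / d $ a * (?q a Y - 2 * lam a * ?s a Y + (lam a)\<^sup>2 * ?t a Y) \<partial>law) =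
        1 / d $ a * (\<integral>Y. ?q a Y - 2 * lam a * ?s a Y + (lam a)\<^sup>2 * ?t a Y \<partial>law)" by (rule integral_mult_right_zero)
    also have "(\<integral>Y. ?q a Y - 2 * lam a * ?s a Y + (lam a)\<^sup>2 * ?t a Y \<partial>law) =
        (\<integral>Y. ?q a Y - 2 * lam a * ?s a Y \<partial>law) + (\<integral>Y. (lam a)\<^sup>2 * ?t a Y \<partial>law)"
      by (intro Bochner_Integration.integral_add Bochner_Integration.integrable_diff integrable_mult_right iq sh it)
    also have "(\<integral>Y. ?q a Y - 2 * lam a * ?s a Y \<partial>law) = (\<integral>Y. ?q a Y \<partial>law) - (\<integral>Y. 2 * lam a * ?s a Y \<partial>law)"
      by (intro Bochner_Integration.integral_diff integrable_mult_right iq sh)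
    also have "(\<integral>Y. 2 * lam a * ?s a Y \<partial>law) = 2 * lam a * (\<integral>Y. ?s a Y \<partial>law)" by (rule integral_mult_right_zero)
    also have "(\<integral>Y. (lam a)\<^sup>2 * ?t a Y \<partial>law) = (lam a)\<^sup>2 * (\<integral>Y. ?t a Y \<partial>law)" by (rule integral_mult_right_zero)
    also have "(\<integral>Y. ?q a Y \<partial>law) = real CARD('p) * d $ a"
      using integral_centred_quad[of "r a"] by (simp add: xv_def r_norm)
    also have "(\<integral>Y. ?s a Y \<partial>law) = d $ a * (real CARD('p) - 2) * ?I a"
      using integral_shrinkage[OF N_r df p3 r_nz, of a] by (simp add: r_norm)
    also have "(\<integral>Y. ?t a Y \<partial>law) = (trace Nmat - real CARD('p) + 3) * ?I a"
      by (rule integral_quad_ratio[OF N_r df p3 r_nz])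
    also have "(lam a)\<^sup>2 * ((trace Nmat - real CARD('p) + 3) * ?I a) = d $ a * (real CARD('p) - 2) * (lam a * ?I a)"
    proof -
      \<comment> \<open>The choice of \<open>lam\<close> makes the quadratic term exactly half of
        the cross term in size and opposite in sign, so a single copy with negative sign
        remains.\<close>
      have "lam a * (trace Nmat - real CARD('p) + 3) = d $ a * (real CARD('p) - 2)"
        using df by (simp add: lam_def)
      then show ?thesis by (simp add: power2_eq_square)
    qed
    finally show ?thesis using d_pos[of a] by (simp add: field_simps)
  qed
  have "(\<integral>Y. loss' Y \<partial>law) = (\<integral>Y. (\<Sum>a\<in>UNIV. 1 / d $ a * (?q a Y - 2 * lam a * ?s a Y + (lam a)\<^sup>2 * ?t a Y)) \<partial>law) + (\<integral>Y. row_quad Om Res \<partial>law)"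
    unfolding loss'_def by (rule Bochner_Integration.integral_add[OF i2]) simp
  also have "(\<integral>Y. (\<Sum>a\<in>UNIV. 1 / d $ a * (?q a Y - 2 * lam a * ?s a Y + (lam a)\<^sup>2 * ?t a Y)) \<partial>law) =
      (\<Sum>a\<in>UNIV. real CARD('p) - (real CARD('p) - 2) * (lam a * ?I a))"
    unfolding e[symmetric] by (rule Bochner_Integration.integral_sum) (rule i1)
  finally show "(\<integral>Y. loss' Y \<partial>law) = real CARD('p) * real CARD('j)
      - (real CARD('p) - 2) * (\<Sum>a\<in>UNIV. lam a * ?I a) + row_quad Om Res"
    using law.prob_space by (simp add: sum_subtractf sum_distrib_left)
qed

definition zmcp' :: "real^'p^'n \<Rightarrow> real" where
  "zmcp' Y = (trace Nmat - real CARD('p) - 1) * (real CARD('p) + (\<Sum>i\<in>UNIV. cv (Rmat *v axis i 1) Y))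
     + real CARD('p) * (2 * real CARD('j) + real CARD('p) + 1 - real CARD('n))
     - (real CARD('p) - 2) * (\<Sum>a\<in>UNIV. lam a * (1 / cv (r a) Y))"

text \<open>Since I - hat A_J = (I - hat A) + R, the matrix S_J is S + Y^T R Y. The trace is then p
  plus a sum of inverse forms in the directions R e_i, each annihilated by the residual
  projection.\<close>

lemma zmcp_eq:
  assumes g: "good Y"
  shows "ZMCp A \<iota> P d Y = zmcp' Y"
proof -
  have "resid_SS AJ Y = SS Y + transpose Y ** Rmat ** Y"
  proof -
    have "mat 1 - hat AJ = Nmat + Rmat" by simp
    then have "resid_SS AJ Y = transpose Y ** (Nmat + Rmat) ** Y" by (simp add: resid_SS_def hat_def)
    also have "\<dots> = SS Y + transpose Y ** Rmat ** Y"
      unfolding SS_def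
      by (simp only: bounded_bilinear.add_left[OF bounded_bilinear_matrix_mult] bounded_bilinear.add_right[OF bounded_bilinear_matrix_mult])
    finally show ?thesis .
  qed
  then have "matrix_inv (resid_SS A Y) ** resid_SS AJ Y = Kinv Y ** SS Y + Kinv Y ** (transpose Y ** Rmat ** Y)"
    unfolding Kinv_def SS_eq by (simp only: bounded_bilinear.add_right[OF bounded_bilinear_matrix_mult])
  also have "Kinv Y ** SS Y = mat 1"
    using g unfolding good_def Kinv_def by (intro matrix_inv_inverse(2)) simp
  finally have "trace (matrix_inv (resid_SS A Y) ** resid_SS AJ Y) = real CARD('p) + trace (Kinv Y ** (transpose Y ** Rmat ** Y))"
    by (simp add: trace_add trace_I)
  also have "trace (Kinv Y ** (transpose Y ** Rmat ** Y)) = (\<Sum>i\<in>UNIV. cv (Rmat *v axis i 1) Y)"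
    unfolding trace_mult_gram[OF R_sym R_idem] cv_def xv_def ..
  finally show ?thesis
    unfolding ZMCp_def zmcp'_def Lambda_C_inv[OF g] trace_diag_mat by (simp add: trace_N)
qed

text \<open>The factor n - k - p - 1 turns each inverse form into its counterpart with Sigma^-1,
  whose mean is a variance part plus a squared bias. The sums are p tr R and the bias term of the
  risk.\<close>

lemma
  shows integrable_zmcp': "integrable law zmcp'"
    and integral_zmcp': "(\<integral>Y. zmcp' Y \<partial>law) = (\<integral>Y. loss' Y \<partial>law)"
proof -
  let ?I = "\<lambda>a. \<integral>Y. 1 / cv (r a) Y \<partial>law"
  have line: "xv (Rmat *v axis i 1) (Y + t *\<^sub>R outer (Nmat *v v) w) = xv (Rmat *v axis i 1) Y" for i Y t v w
    unfolding xv_def by (rule transpose_mult_N_line[OF N_R])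
  have ic: "integrable law (cv (Rmat *v axis i 1))" for i
    using integrable_inverse_form[OF df poly_growth_xv line] by (simp add: cv_def[abs_def])
  have ec: "(trace Nmat - real CARD('p) - 1) * (\<integral>Y. cv (Rmat *v axis i 1) Y \<partial>law) = real CARD('p) * (axis i 1 \<bullet> (Rmat *v axis i 1))
      + Res $ i \<bullet> (Om *v Res $ i)" for i
  proof -
    have "(trace Nmat - real CARD('p) - 1) * (\<integral>Y. cv (Rmat *v axis i 1) Y \<partial>law) = real CARD('p) * ((Rmat *v axis i 1) \<bullet> (Rmat *v axis i 1))
        + (transpose M *v (Rmat *v axis i 1)) \<bullet> (Om *v (transpose M *v (Rmat *v axis i 1)))"
      using integral_inverse_form[OF df poly_growth_xv line, of i] integral_quad[of "Rmat *v axis i 1"]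
      by (simp add: cv_def xv_def)
    also have "transpose M *v (Rmat *v axis i 1) = Res $ i"
      using transpose_mult_row[of Rmat M i] by (simp add: R_sym R_M)
    also have "(Rmat *v axis i 1) \<bullet> (Rmat *v axis i 1) = axis i 1 \<bullet> (Rmat *v (Rmat *v axis i 1))"
      using inner_matrix_vector_transpose[of "axis i 1" Rmat "Rmat *v axis i 1"] by (simp only: R_sym)
    also have "Rmat *v (Rmat *v axis i 1) = Rmat *v axis i 1" by (simp only: matrix_vector_mul_assoc R_idem)
    finally show ?thesis .
  qed
  have iv: "integrable law (\<lambda>Y. 1 / cv (r a) Y)" for a by (rule integrable_inverse_cv[OF N_r df p3 r_nz])
  define k0 where "k0 = (trace Nmat - real CARD('p) - 1) * real CARD('p) + real CARD('p) * (2 * real CARD('j) + real CARD('p) + 1 - real CARD('n))"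
  have z: "zmcp' Y = k0 + (\<Sum>i\<in>UNIV. (trace Nmat - real CARD('p) - 1) * cv (Rmat *v axis i 1) Y) - (\<Sum>a\<in>UNIV. (real CARD('p) - 2) * lam a * (1 / cv (r a) Y))" for Y
    unfolding zmcp'_def k0_def by (simp add: distrib_left sum_distrib_left mult.assoc)
  have i1: "integrable law (\<lambda>Y. \<Sum>i\<in>UNIV. (trace Nmat - real CARD('p) - 1) * cv (Rmat *v axis i 1) Y)"
    by (intro Bochner_Integration.integrable_sum integrable_mult_right ic)
  have i2: "integrable law (\<lambda>Y. \<Sum>a\<in>UNIV. (real CARD('p) - 2) * lam a * (1 / cv (r a) Y))"
    by (intro Bochner_Integration.integrable_sum integrable_mult_right iv)
  have i3: "integrable law (\<lambda>Y. k0 + (\<Sum>i\<in>UNIV. (trace Nmat - real CARD('p) - 1) * cv (Rmat *v axis i 1) Y))"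
    by (intro Bochner_Integration.integrable_add i1) simp
  show "integrable law zmcp'"
    unfolding z[abs_def] by (rule Bochner_Integration.integrable_diff[OF i3 i2])
  have "(\<integral>Y. zmcp' Y \<partial>law) = (\<integral>Y. k0 + (\<Sum>i\<in>UNIV. (trace Nmat - real CARD('p) - 1) * cv (Rmat *v axis i 1) Y) \<partial>law)
      - (\<integral>Y. (\<Sum>a\<in>UNIV. (real CARD('p) - 2) * lam a * (1 / cv (r a) Y)) \<partial>law)"
    unfolding z by (rule Bochner_Integration.integral_diff[OF i3 i2])
  also have "(\<integral>Y. k0 + (\<Sum>i\<in>UNIV. (trace Nmat - real CARD('p) - 1) * cv (Rmat *v axis i 1) Y) \<partial>law) =
      (\<integral>Y. k0 \<partial>law) + (\<integral>Y. (\<Sum>i\<in>UNIV. (trace Nmat - real CARD('p) - 1) * cv (Rmat *v axis i 1) Y) \<partial>law)"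
    by (rule Bochner_Integration.integral_add[OF _ i1]) simp
  also have "(\<integral>Y. k0 \<partial>law) = k0" using law.prob_space by simp
  also have "(\<integral>Y. (\<Sum>i\<in>UNIV. (trace Nmat - real CARD('p) - 1) * cv (Rmat *v axis i 1) Y) \<partial>law) = (\<Sum>i\<in>UNIV. \<integral>Y. (trace Nmat - real CARD('p) - 1) * cv (Rmat *v axis i 1) Y \<partial>law)"
    by (intro Bochner_Integration.integral_sum integrable_mult_right ic)
  also have "\<dots> = (\<Sum>i\<in>UNIV. real CARD('p) * (axis i 1 \<bullet> (Rmat *v axis i 1)) + Res $ i \<bullet> (Om *v Res $ i))"
    unfolding ec[symmetric] by (intro sum.cong refl integral_mult_right_zero)
  also have "\<dots> = real CARD('p) * trace Rmat + row_quad Om Res"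
    by (simp add: sum.distrib trace_eq_sum_inner_axis row_quad_def sum_distrib_left)
  also have "(\<integral>Y. (\<Sum>a\<in>UNIV. (real CARD('p) - 2) * lam a * (1 / cv (r a) Y)) \<partial>law) =
      (\<Sum>a\<in>UNIV. \<integral>Y. (real CARD('p) - 2) * lam a * (1 / cv (r a) Y) \<partial>law)"
    by (intro Bochner_Integration.integral_sum integrable_mult_right iv)
  also have "\<dots> = (\<Sum>a\<in>UNIV. (real CARD('p) - 2) * lam a * ?I a)"
    by (intro sum.cong refl integral_mult_right_zero)
  also have "\<dots> = (real CARD('p) - 2) * (\<Sum>a\<in>UNIV. lam a * ?I a)" by (simp add: sum_distrib_left mult.assoc)
  also have "trace Rmat = real CARD('k) - real CARD('j)"
    by (simp add: trace_sub trace_hat[OF inj_A] trace_hat[OF inj_AJ])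
  \<comment> \<open>The constant \<open>k0\<close> equals p (2 j - k), with j =
    \<open>CARD('j)\<close>; adding p (k - j) leaves the variance term p j of the risk.\<close>
  also have "k0 + (real CARD('p) * (real CARD('k) - real CARD('j)) + row_quad Om Res) = real CARD('p) * real CARD('j) + row_quad Om Res"
    unfolding k0_def trace_N by (simp add: algebra_simps)
  finally show "(\<integral>Y. zmcp' Y \<partial>law) = (\<integral>Y. loss' Y \<partial>law)" unfolding integral_loss' by simp
qed

end


section \<open>Measurability with respect to the sufficient statistic\<close>

lemma borel_measurable_vec_nth_comp [measurable (raw)]:
  fixes f :: "'a \<Rightarrow> 'b::euclidean_space^'n"
  assumes "f \<in> borel_measurable G"
  shows "(\<lambda>x. f x $ i) \<in> borel_measurable G"
  by (rule measurable_compose[OF assms borel_measurable_vec_nth])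

lemma borel_measurable_diag_mat [measurable (raw)]:
  assumes "\<And>a. (\<lambda>x. f x a) \<in> borel_measurable G"
  shows "(\<lambda>x. diag_mat (\<chi> a. f x a)) \<in> borel_measurable G"
  unfolding diag_mat_def
proof (intro borel_measurable_vec)
  fix a b
  show "(\<lambda>x. (\<chi> a b. if a = b then (\<chi> a. f x a) $ a else 0) $ a $ b) \<in> borel_measurable G"
    using assms by (cases "a = b") simp_all
qed

text \<open>Only A^T Y and Y^T Y appear on the right. For a submatrix, A_J^T Y is in turn a linear
  function of A^T Y.\<close>

lemma resid_SS_sufficient:
  fixes A :: "real^'k^'n" and Y :: "real^'p^'n"
  shows "resid_SS A Y = transpose Y ** Y - transpose (transpose A ** Y) ** gram_inv A ** (transpose A ** Y)"
  by (simp add: resid_SS_def matrix_diff_mult matrix_mult_diff matrix_transpose_mul matrix_mul_assoc)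

context
  fixes A :: "real^'k^'n" and \<iota> :: "'j::finite \<Rightarrow> 'k" and P :: "real^'j^'j" and d :: "real^'j"
    and G :: "(real^'p^'n) measure"
  assumes lin: "(\<lambda>Y. transpose A ** Y) \<in> borel_measurable G"
    and quad: "(\<lambda>Y. transpose Y ** Y) \<in> borel_measurable G"
begin

lemma sub_cols_lin_measurable: "(\<lambda>Y. transpose (sub_cols A \<iota>) ** Y) \<in> borel_measurable G"
proof -
  have "(\<lambda>Y. transpose (embed \<iota>) ** (transpose A ** Y)) \<in> borel_measurable G"
    by (rule borel_measurable_matrix_mult[OF _ lin]) simp
  then show ?thesis by (simp add: sub_cols_eq_mult matrix_transpose_mul matrix_mul_assoc)
qed

lemma resid_SS_measurable: "(\<lambda>Y. resid_SS A Y) \<in> borel_measurable G"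
  "(\<lambda>Y. resid_SS (sub_cols A \<iota>) Y) \<in> borel_measurable G"
  unfolding resid_SS_sufficient
  by (intro borel_measurable_diff quad borel_measurable_matrix_mult borel_measurable_transpose lin
      sub_cols_lin_measurable borel_measurable_const)+

lemma X_mat_measurable: "(\<lambda>Y. X_mat A \<iota> P d Y) \<in> borel_measurable G"
proof -
  have "(\<lambda>Y. (diag_mat d ** transpose P) ** (transpose (sub_cols A \<iota>) ** Y)) \<in> borel_measurable G"
    by (rule borel_measurable_matrix_mult[OF _ sub_cols_lin_measurable]) simp
  then show ?thesis by (simp add: X_mat_def matrix_mul_assoc)
qed

lemma C_mat_measurable: "(\<lambda>Y. C_mat A \<iota> P d Y) \<in> borel_measurable G"
  unfolding C_mat_def
  by (intro borel_measurable_diag_mat borel_measurable_inner borel_measurable_vec_nth_comp X_mat_measurable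
      borel_measurable_matrix_vector_mult2 borel_measurable_matrix_inv resid_SS_measurable)

text \<open>\<open>G\<close> stays arbitrary because the result is used twice: for the algebra
  generated by the sufficient statistic, which gives optimality, and for the Borel sets.\<close>

lemma ZMCp_measurable: "ZMCp A \<iota> P d \<in> borel_measurable G"
  unfolding ZMCp_def[abs_def]
  by (intro borel_measurable_diff borel_measurable_add borel_measurable_times borel_measurable_const
      borel_measurable_trace borel_measurable_matrix_mult borel_measurable_matrix_inv resid_SS_measurable C_mat_measurable)

lemma B_hat_measurable: "(\<lambda>Y. B_hat A \<iota> P d Y) \<in> borel_measurable G"
proof -
  have "(\<lambda>Y. P ** (mat 1 - Lambda_mat TYPE('n) TYPE('p) TYPE('k) d ** matrix_inv (C_mat A \<iota> P d Y)) ** X_mat A \<iota> P d Y) \<in> borel_measurable G"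
    by (intro borel_measurable_diff borel_measurable_const borel_measurable_matrix_mult borel_measurable_matrix_inv
        X_mat_measurable C_mat_measurable)
  then show ?thesis by (simp add: B_hat_def X_mat_def matrix_mul_assoc)
qed

lemma sq_loss_measurable: "(\<lambda>Y. sq_loss (sub_cols A \<iota>) M \<Sigma> (B_hat A \<iota> P d Y)) \<in> borel_measurable G"
  unfolding sq_loss_def
  by (intro borel_measurable_diff borel_measurable_const borel_measurable_matrix_mult borel_measurable_transpose
      borel_measurable_trace B_hat_measurable)

end

section \<open>Unbiasedness of the risk estimator\<close>

context regression_submodel
begin

lemma borel_measurable_statistics:
  "ZMCp A \<iota> P d \<in> borel_measurable (borel :: (real^'p^'n) measure)" "loss \<in> borel_measurable borel"
proof -
  have m: "(\<lambda>Y :: real^'p^'n. transpose A ** Y) \<in> borel_measurable borel" "(\<lambda>Y :: real^'p^'n. transpose Y ** Y) \<in> borel_measurable borel"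
    by measurable
  show "ZMCp A \<iota> P d \<in> borel_measurable (borel :: (real^'p^'n) measure)" by (rule ZMCp_measurable[OF m])
  show "loss \<in> borel_measurable borel" by (rule sq_loss_measurable[OF m])
qed

text \<open>The scalar expressions agree with loss and estimator on the almost sure event
  \<open>good\<close>. Measurability of the originals, default inverses included, makes the transfer
  of integrals legitimate.\<close>

lemma
  shows integrable_loss: "integrable law loss"
    and integrable_ZMCp: "integrable law (ZMCp A \<iota> P d)"
    and integral_ZMCp: "(\<integral>Y. ZMCp A \<iota> P d Y \<partial>law) = sq_risk AJ M \<Sigma> (B_hat A \<iota> P d)"
proof -
  note m = borel_measurable_statistics
  have ml: "loss \<in> borel_measurable law" and mz: "ZMCp A \<iota> P d \<in> borel_measurable law" using m by simp_all
  note ml' = borel_measurable_integrable[OF integrable_loss'] and mz' = borel_measurable_integrable[OF integrable_zmcp']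
  have l: "AE Y in law. loss Y = loss' Y" using AE_good by eventually_elim (rule loss_eq)
  have z: "AE Y in law. ZMCp A \<iota> P d Y = zmcp' Y" using AE_good by eventually_elim (rule zmcp_eq)
  show "integrable law loss" using integrable_cong_AE[OF ml ml' l] integrable_loss' by simp
  show "integrable law (ZMCp A \<iota> P d)" using integrable_cong_AE[OF mz mz' z] integrable_zmcp' by simp
  have "(\<integral>Y. ZMCp A \<iota> P d Y \<partial>law) = (\<integral>Y. loss' Y \<partial>law)"
    using integral_cong_AE[OF mz mz' z] by (simp add: integral_zmcp')
  also have "\<dots> = (\<integral>Y. loss Y \<partial>law)" using integral_cong_AE[OF ml ml' l] by simp
  finally show "(\<integral>Y. ZMCp A \<iota> P d Y \<partial>law) = sq_risk AJ M \<Sigma> (B_hat A \<iota> P d)"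
    by (simp add: sq_risk_def)
qed

end

theorem theorem4:
  fixes A :: "real^'k^'n"
    and J :: "'k set"
    and \<iota> :: "'j::{finite,linorder} \<Rightarrow> 'k"
    and P :: "real^('j::{finite,linorder})^('j::{finite,linorder})"
    and d :: "real^('j::{finite,linorder})"
    and \<Theta> :: "('k set \<times> (real^'p^'k) \<times> (real^'p^'p)) set"
  assumes rank_A: "rank A = CARD('k)"
    and dims: "CARD('n) > CARD('p) + CARD('k) + 1"
    and p_ge_3: "CARD('p) \<ge> 3"
    and J_nonempty: "J \<noteq> {}"
    and enum_J: "bij_betw \<iota> UNIV J"
    and orth_P: "orthogonal_matrix P"
    and diag_P: "transpose P ** gram_inv (sub_cols A \<iota>) ** P = diag_mat d"
    and d_decreasing: "\<And>a b. a \<le> b \<Longrightarrow> d $ b \<le> d $ a"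
    and params: "\<Theta> = {(J\<^sub>s, B, \<Sigma>). J\<^sub>s \<subseteq> UNIV \<and> pos_def \<Sigma>}"
  shows "(\<forall>(J\<^sub>s, B, \<Sigma>)\<in>\<Theta>.
            integrable (matrix_normal (model_mean A J\<^sub>s B) \<Sigma>)
              (\<lambda>Y. sq_loss (sub_cols A \<iota>) (model_mean A J\<^sub>s B) \<Sigma> (B_hat A \<iota> P d Y)))
       \<and> umvu_estimator \<Theta>
            (\<lambda>(J\<^sub>s, B, \<Sigma>). matrix_normal (model_mean A J\<^sub>s B) \<Sigma>)
            (ZMCp A \<iota> P d)
            (\<lambda>(J\<^sub>s, B, \<Sigma>). sq_risk (sub_cols A \<iota>) (model_mean A J\<^sub>s B) \<Sigma> (B_hat A \<iota> P d))"
proof -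
  let ?L = "\<lambda>(J\<^sub>s, B, \<Sigma>). matrix_normal (model_mean A J\<^sub>s B) \<Sigma> :: (real^'p^'n) measure"
  let ?g = "\<lambda>(J\<^sub>s, B, \<Sigma>). sq_risk (sub_cols A \<iota>) (model_mean A J\<^sub>s B :: real^'p^'n) \<Sigma> (B_hat A \<iota> P d)"
  have inj_A: "inj ((*v) A)" using rank_A by (simp add: full_rank_injective)
  have inj_iota: "inj \<iota>" using enum_J by (rule bij_betw_imp_inj_on)
  have sub: "regression_submodel A \<iota> P d (A ** B) \<Sigma>" if "pos_def \<Sigma>" for B :: "real^'p^'k" and \<Sigma>
    by unfold_locales (use that inj_A inj_iota orth_P diag_P dims p_ge_3 in
        \<open>auto simp: matrix_mul_assoc hat_mult_self[OF inj_A]\<close>)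
  have mean: "model_mean A J\<^sub>s B = A ** (\<chi> j. if j \<in> J\<^sub>s then B $ j else 0)" for J\<^sub>s and B :: "real^'p^'k"
    by (rule model_mean_eq_mult)
  have loss: "integrable (matrix_normal (model_mean A J\<^sub>s B) \<Sigma>)
      (\<lambda>Y. sq_loss (sub_cols A \<iota>) (model_mean A J\<^sub>s B) \<Sigma> (B_hat A \<iota> P d Y))" if "pos_def \<Sigma>" for J\<^sub>s and B :: "real^'p^'k" and \<Sigma>
    unfolding mean by (rule regression_submodel.integrable_loss[OF sub[OF that]])
  have unb: "unbiased_estimator \<Theta> ?L (ZMCp A \<iota> P d) ?g"
    unfolding unbiased_estimator_def params mean
    by (auto intro: regression_submodel.integrable_ZMCp[OF sub] regression_submodel.integral_ZMCp[OF sub])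
  have meas: "ZMCp A \<iota> P d \<in> borel_measurable (stat_algebra A :: (real^'p^'n) measure)"
    by (intro ZMCp_measurable borel_measurable_vec sufficient_linear_measurable sufficient_quad_measurable)
  have opt: "ext_variance (?L \<theta>) (ZMCp A \<iota> P d) \<le> ext_variance (?L \<theta>) T'"
    if T': "unbiased_estimator \<Theta> ?L T' ?g" and \<theta>: "\<theta> \<in> \<Theta>" for T' \<theta>
  proof -
    \<comment> \<open>The full column set realises every mean \<open>A ** B\<close>, so a competitor
      is unbiased on the whole exponential family, as the completeness argument requires.\<close>
    have full: "(UNIV, B, \<Sigma>) \<in> \<Theta>" "?L (UNIV, B, \<Sigma>) = matrix_normal (A ** B) \<Sigma>" if "pos_def \<Sigma>" for B :: "real^'p^'k" and \<Sigma>
      using that by (simp_all add: params mean)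
    note U = unb[unfolded unbiased_estimator_def, rule_format, OF full(1)]
    note U' = T'[unfolded unbiased_estimator_def, rule_format, OF full(1)]
    obtain J\<^sub>s B \<Sigma> where th: "\<theta> = (J\<^sub>s, B, \<Sigma>)" "pos_def \<Sigma>" using \<theta> by (auto simp: params)
    \<comment> \<open>A submodel mean is \<open>A\<close> times the coefficient matrix with the rows
      outside \<open>J\<^sub>s\<close> set to zero, so each parameter is a point of the full
      family.\<close>
    have "ext_variance (matrix_normal (A ** (\<chi> j. if j \<in> J\<^sub>s then B $ j else 0)) \<Sigma>) (ZMCp A \<iota> P d) \<le>
        ext_variance (matrix_normal (A ** (\<chi> j. if j \<in> J\<^sub>s then B $ j else 0)) \<Sigma>) T'"
    proof (rule matrix_normal_complete_sufficient[OF meas _ _ _ th(2)])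
      fix B' :: "real^'p^'k" and \<Sigma>' :: "real^'p^'p" assume pd: "pos_def \<Sigma>'"
      show "integrable (matrix_normal (A ** B') \<Sigma>') (ZMCp A \<iota> P d)"
        using U[OF pd, of B'] by (simp only: full(2)[OF pd])
      show "integrable (matrix_normal (A ** B') \<Sigma>') T'"
        using U'[OF pd, of B'] by (simp only: full(2)[OF pd])
      show "(\<integral>Y. T' Y \<partial>matrix_normal (A ** B') \<Sigma>') = (\<integral>Y. ZMCp A \<iota> P d Y \<partial>matrix_normal (A ** B') \<Sigma>')"
        using U[OF pd, of B'] U'[OF pd, of B'] by (simp only: full(2)[OF pd])
    qed
    then show ?thesis by (simp add: th mean)
  qed
  show ?thesis
    using loss unb opt unfolding umvu_estimator_def by (auto simp: params)
qed

end
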